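(* Every bounded Borel measure on $E$ belongs to $\mathbb{M}$; that is, $\mathcal{M}_b\subset\mathbb{M}$.
   Context: Setting. $E$ is a locally compact separable metric space, $m$ is a positive Radon measure on $E$ with $\mathrm{supp}[m]=E$, and $(\mathcal{E},D[\mathcal{E}])$ is a symmetric regular Dirichlet form on $L^2(E;m)$, assumed transient: there is a strictly positive function $g$ on $E$ with $\int_E|u|g\,dm\le\sqrt{\mathcal{E}(u,u)}$ for $u\in D[\mathcal{E}]$. $\mathbb{X}=((X_t)_{t\ge0},(P_x)_{x\in E},(\mathcal{F}_t)_{t\ge0},\zeta)$ is the associated symmetric Hunt process with life time $\zeta$; $E_x$ is expectation under $P_x$. For $\alpha\ge0$, $R_\alpha h(x)=E_x\int_0^\zeta e^{-\alpha t}h(X_t)\,dt$, and $R=R_0$. It is assumed that $R_\alpha(x,\cdot)\ll m$ for all $x\in E$, $\alpha>0$. Hence for every $\alpha\ge0$ there is a symmetric Borel kernel $r_\alpha:E\times E\to[0,\infty]$, $\alpha$-excessive in each variable, with $R_\alpha h(x)=\int_E h(y)r_\alpha(x,y)\,m(dy)$; put $r=r_0$. For a positive Borel measure $\mu$, $R\mu(x)=\int_E r(x,y)\,\mu(dy)$. Capacity: $\mathrm{Cap}(U)=\inf\{\mathcal{E}(u,u):u\in D[\mathcal{E}],\,u\ge\mathbf{1}_U\ m\text{-a.e.}\}$ for open $U$, and $\mathrm{Cap}(B)=\inf\{\mathrm{Cap}(U):B\subset U,\ U\text{ open}\}$ for arbitrary $B\subset E$; "q.e." means outside a set of capacity zero.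 $\mathcal{M}_b$ is the set of all bounded (signed) Borel measures on $E$. $\mathbb{M}$ is the class of (signed, possibly unbounded) Borel measures $\mu$ on $E$ with $R|\mu|(x)<\infty$ for q.e. $x\in E$, where $|\mu|=\mu^++\mu^-$. *)

theory Defs
  imports "HOL-Probability.Probability"
begin

section \<open>Symmetric regular transient Dirichlet forms\<close>

text \<open>
  The state space \<open>E\<close> is the type \<open>'a :: {metric_space, second_countable_topology}\<close>: for metric
  spaces, second countability is separability.  Local compactness is the assumption
  \<open>locally_compact_space euclidean\<close>.

  On such a space a positive Radon measure is the same as a Borel measure that is finite on
  compact sets (regularity is automatic).
\<close>

definition radon_full_support ::
    "('a :: {metric_space, second_countable_topology}) measure \<Rightarrow> bool" where
  "radon_full_support m \<longleftrightarrow>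
     sets m = sets borel \<and>
     (\<forall>K. compact K \<longrightarrow> emeasure m K < \<infinity>) \<and>
     (\<forall>U. open U \<longrightarrow> U \<noteq> {} \<longrightarrow> 0 < emeasure m U)"

text \<open>
  Elements of \<open>L\<^sup>2(E;m)\<close> are represented by Borel functions; a form domain is a set of
  functions that is closed under changes on \<open>m\<close>-null sets.
\<close>

definition L2_functions :: "'a measure \<Rightarrow> ('a \<Rightarrow> real) set" where
  "L2_functions m = {u \<in> borel_measurable m. integrable m (\<lambda>x. (u x)\<^sup>2)}"

definition L2_inner :: "'a measure \<Rightarrow> ('a \<Rightarrow> real) \<Rightarrow> ('a \<Rightarrow> real) \<Rightarrow> real" where
  "L2_inner m u v = (\<integral>x. u x * v x \<partial>m)"

text \<open>\<open>\<E>\<^sub>\<alpha>(u, v) = \<E>(u, v) + \<alpha> (u, v)\<close>\<close>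

definition form_shift :: "'a measure \<Rightarrow> (('a \<Rightarrow> real) \<Rightarrow> ('a \<Rightarrow> real) \<Rightarrow> real) \<Rightarrow>
    real \<Rightarrow> ('a \<Rightarrow> real) \<Rightarrow> ('a \<Rightarrow> real) \<Rightarrow> real" where
  "form_shift m \<E> \<alpha> u v = \<E> u v + \<alpha> * L2_inner m u v"

locale symmetric_dirichlet_form =
  fixes m :: "'a measure"
    and D :: "('a \<Rightarrow> real) set"
    and \<E> :: "('a \<Rightarrow> real) \<Rightarrow> ('a \<Rightarrow> real) \<Rightarrow> real"
  assumes domain_L2: "D \<subseteq> L2_functions m"
    and domain_AE: "\<And>u v. u \<in> D \<Longrightarrow> v \<in> borel_measurable m \<Longrightarrow> AE x in m. u x = v x \<Longrightarrow> v \<in> D"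
    and form_AE: "\<And>u v w. u \<in> D \<Longrightarrow> v \<in> D \<Longrightarrow> w \<in> D \<Longrightarrow> AE x in m. u x = v x \<Longrightarrow> \<E> u w = \<E> v w"
    and domain_zero: "(\<lambda>x. 0) \<in> D"
    and domain_add: "\<And>u v. u \<in> D \<Longrightarrow> v \<in> D \<Longrightarrow> (\<lambda>x. u x + v x) \<in> D"
    and domain_scale: "\<And>c u. u \<in> D \<Longrightarrow> (\<lambda>x. c * u x) \<in> D"
    and form_sym: "\<And>u v. u \<in> D \<Longrightarrow> v \<in> D \<Longrightarrow> \<E> u v = \<E> v u"
    and form_add: "\<And>u v w. u \<in> D \<Longrightarrow> v \<in> D \<Longrightarrow> w \<in> D \<Longrightarrow> \<E> (\<lambda>x. u x + v x) w = \<E> u w + \<E> v w"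
    and form_scale: "\<And>c u w. u \<in> D \<Longrightarrow> w \<in> D \<Longrightarrow> \<E> (\<lambda>x. c * u x) w = c * \<E> u w"
    and form_nonneg: "\<And>u. u \<in> D \<Longrightarrow> 0 \<le> \<E> u u"
    and domain_dense: "\<And>f e. f \<in> L2_functions m \<Longrightarrow> 0 < e \<Longrightarrow>
      \<exists>u\<in>D. L2_inner m (\<lambda>x. f x - u x) (\<lambda>x. f x - u x) < e"
    and form_closed: "\<And>u :: nat \<Rightarrow> 'a \<Rightarrow> real. (\<And>n. u n \<in> D) \<Longrightarrow>
      (\<And>e. 0 < e \<Longrightarrow> \<exists>N. \<forall>i\<ge>N. \<forall>j\<ge>N. form_shift m \<E> 1 (\<lambda>x. u i x - u j x) (\<lambda>x. u i x - u j x) < e) \<Longrightarrow>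
      \<exists>v\<in>D. (\<lambda>n. form_shift m \<E> 1 (\<lambda>x. u n x - v x) (\<lambda>x. u n x - v x)) \<longlonglongrightarrow> 0"
    and form_markovian: "\<And>u. u \<in> D \<Longrightarrow>
      (\<lambda>x. min (max (u x) 0) 1) \<in> D \<and>
      \<E> (\<lambda>x. min (max (u x) 0) 1) (\<lambda>x. min (max (u x) 0) 1) \<le> \<E> u u"

definition C_c :: "('a :: topological_space \<Rightarrow> real) set" where
  "C_c = {f. continuous_on UNIV f \<and> compact (closure {x. f x \<noteq> 0})}"

definition regular_form :: "'a :: {metric_space, second_countable_topology} measure \<Rightarrow>
    ('a \<Rightarrow> real) set \<Rightarrow> (('a \<Rightarrow> real) \<Rightarrow> ('a \<Rightarrow> real) \<Rightarrow> real) \<Rightarrow> bool" where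
  "regular_form m D \<E> \<longleftrightarrow>
     (\<forall>u\<in>D. \<forall>e>0. \<exists>f\<in>D \<inter> C_c. form_shift m \<E> 1 (\<lambda>x. u x - f x) (\<lambda>x. u x - f x) < e) \<and>
     (\<forall>u\<in>C_c. \<forall>e>0. \<exists>f\<in>D \<inter> C_c. \<forall>x. \<bar>u x - f x\<bar> < e)"

definition transient_form :: "'a measure \<Rightarrow>
    ('a \<Rightarrow> real) set \<Rightarrow> (('a \<Rightarrow> real) \<Rightarrow> ('a \<Rightarrow> real) \<Rightarrow> real) \<Rightarrow> bool" where
  "transient_form m D \<E> \<longleftrightarrow>
     (\<exists>g\<in>borel_measurable m. (\<forall>x. 0 < g x) \<and>
        (\<forall>u\<in>D. (\<integral>\<^sup>+x. ennreal (\<bar>u x\<bar> * g x) \<partial>m) \<le> ennreal (sqrt (\<E> u u))))"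


section \<open>Capacity\<close>

text \<open>The infimum is taken in \<open>[0, \<infinity>]\<close>; it is \<open>\<infinity>\<close> if there is no admissible \<open>u\<close>.\<close>

definition open_capacity :: "'a measure \<Rightarrow> ('a \<Rightarrow> real) set \<Rightarrow>
    (('a \<Rightarrow> real) \<Rightarrow> ('a \<Rightarrow> real) \<Rightarrow> real) \<Rightarrow> 'a set \<Rightarrow> ennreal" where
  "open_capacity m D \<E> U = (INF u\<in>{u \<in> D. AE x in m. indicator U x \<le> u x}. ennreal (\<E> u u))"

definition capacity :: "'a :: topological_space measure \<Rightarrow> ('a \<Rightarrow> real) set \<Rightarrow>
    (('a \<Rightarrow> real) \<Rightarrow> ('a \<Rightarrow> real) \<Rightarrow> real) \<Rightarrow> 'a set \<Rightarrow> ennreal" where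
  "capacity m D \<E> B = (INF U\<in>{U. open U \<and> B \<subseteq> U}. open_capacity m D \<E> U)"

definition quasi_everywhere :: "'a :: topological_space measure \<Rightarrow> ('a \<Rightarrow> real) set \<Rightarrow>
    (('a \<Rightarrow> real) \<Rightarrow> ('a \<Rightarrow> real) \<Rightarrow> real) \<Rightarrow> ('a \<Rightarrow> bool) \<Rightarrow> bool" where
  "quasi_everywhere m D \<E> Q \<longleftrightarrow> (\<exists>N. capacity m D \<E> N = 0 \<and> (\<forall>x. x \<notin> N \<longrightarrow> Q x))"


section \<open>Hunt processes\<close>

text \<open>
  The cemetery \<open>\<partial>\<close> is \<open>None\<close>; \<open>E \<union> {\<partial>}\<close> is the type \<open>'a option\<close> with the topology of the
  one-point compactification (\<open>\<partial>\<close> is isolated if \<open>E\<close> is compact).  Time runs through \<open>[0, \<infinity>]\<close>.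
\<close>

definition cemetery_topology :: "'a :: topological_space option topology" where
  "cemetery_topology = Alexandroff_compactification euclidean"

definition cemetery_borel :: "'a :: topological_space option measure" where
  "cemetery_borel = sigma UNIV ((`) Some ` sets borel)"

text \<open>
  \<open>P\<close> is the family of laws, \<open>M\<close> carries the underlying measurable space, \<open>F\<close> is the filtration.
  The strong Markov property is
  \<open>P\<^sub>z(X\<^bsub>\<sigma>+s\<^esub> \<in> B | F\<^sub>\<sigma>) = P\<^bsub>X\<^sub>\<sigma>\<^esub>(X\<^sub>s \<in> B)\<close>, written out as the defining identity of the conditional
  probability.  On \<open>{\<sigma> = \<infinity>}\<close> it is trivial, because \<open>X\<^sub>\<infinity> = \<partial>\<close> and \<open>\<partial>\<close> is a trap.
\<close>

locale hunt_process = filtration "space M" F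
  for M :: "'w measure"
    and F :: "ennreal \<Rightarrow> 'w measure"
    and P :: "'a :: {metric_space, second_countable_topology} option \<Rightarrow> 'w measure"
    and X :: "ennreal \<Rightarrow> 'w \<Rightarrow> 'a option" +
  assumes law_prob: "\<And>z. prob_space (P z)"
    and law_sets: "\<And>z. sets (P z) = sets M"
    and filtration_sub: "\<And>t. sets (F t) \<subseteq> sets M"
    and filtration_right_cont: "\<And>t. t < \<infinity> \<Longrightarrow> sets (F t) = (\<Inter>s\<in>{t<..}. sets (F s))"
    and adapted: "\<And>t. X t \<in> measurable (F t) cemetery_borel"
    and law_measurable: "\<And>t B. B \<in> sets cemetery_borel \<Longrightarrow>
      (\<lambda>x. emeasure (P (Some x)) {\<omega> \<in> space M. X t \<omega> \<in> B}) \<in> borel_measurable borel"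
    and normal: "\<And>z. AE \<omega> in P z. X 0 \<omega> = z"
    and trap: "\<And>t. AE \<omega> in P None. X t \<omega> = None"
    and at_infinity_dead: "\<And>\<omega>. \<omega> \<in> space M \<Longrightarrow> X \<infinity> \<omega> = None"
    and stays_dead: "\<And>\<omega> s t. \<omega> \<in> space M \<Longrightarrow> X s \<omega> = None \<Longrightarrow> s \<le> t \<Longrightarrow> X t \<omega> = None"
    and shift_ex: "\<And>t. \<exists>\<theta>. \<forall>\<omega>\<in>space M. \<theta> \<omega> \<in> space M \<and> (\<forall>s. X s (\<theta> \<omega>) = X (s + t) \<omega>)"
    and path_right_cont: "\<And>\<omega> t. \<omega> \<in> space M \<Longrightarrow> t < \<infinity> \<Longrightarrow>
      limitin cemetery_topology (\<lambda>s. X s \<omega>) (X t \<omega>) (at_right t)"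
    and path_left_limit: "\<And>\<omega> t. \<omega> \<in> space M \<Longrightarrow> 0 < t \<Longrightarrow> t < \<infinity> \<Longrightarrow>
      \<exists>l. limitin cemetery_topology (\<lambda>s. X s \<omega>) l (at_left t)"
    and strong_markov: "\<And>z \<sigma> s A B. stopping_time F \<sigma> \<Longrightarrow> A \<in> sets (pre_sigma \<sigma>) \<Longrightarrow>
      B \<in> sets cemetery_borel \<Longrightarrow>
      emeasure (P z) {\<omega> \<in> A. X (\<sigma> \<omega> + s) \<omega> \<in> B} =
      (\<integral>\<^sup>+\<omega>\<in>A. emeasure (P (X (\<sigma> \<omega>) \<omega>)) {\<omega>' \<in> space M. X s \<omega>' \<in> B} \<partial>P z)"
    and quasi_left_cont: "\<And>z \<sigma> \<sigma>'. (\<And>n :: nat. stopping_time F (\<sigma> n)) \<Longrightarrow>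
      (\<And>\<omega>. \<omega> \<in> space M \<Longrightarrow> incseq (\<lambda>n. \<sigma> n \<omega>)) \<Longrightarrow>
      (\<And>\<omega>. \<omega> \<in> space M \<Longrightarrow> \<sigma>' \<omega> = (SUP n. \<sigma> n \<omega>)) \<Longrightarrow>
      AE \<omega> in P z. \<sigma>' \<omega> < \<infinity> \<longrightarrow>
        limitin cemetery_topology (\<lambda>n. X (\<sigma> n \<omega>) \<omega>) (X (\<sigma>' \<omega>) \<omega>) sequentially"

definition life_time :: "(ennreal \<Rightarrow> 'w \<Rightarrow> 'a option) \<Rightarrow> 'w \<Rightarrow> ennreal" where
  "life_time X \<omega> = Inf {t. X t \<omega> = None}"

text \<open>\<open>p\<^sub>t f(x) = E\<^sub>x[f(X\<^sub>t); t < \<zeta>]\<close>\<close>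

definition transition :: "('a option \<Rightarrow> 'w measure) \<Rightarrow> (ennreal \<Rightarrow> 'w \<Rightarrow> 'a option) \<Rightarrow>
    real \<Rightarrow> ('a \<Rightarrow> ennreal) \<Rightarrow> 'a \<Rightarrow> ennreal" where
  "transition P X t f x =
     (\<integral>\<^sup>+\<omega>. (case X (ennreal t) \<omega> of None \<Rightarrow> 0 | Some y \<Rightarrow> f y) \<partial>P (Some x))"

definition resolvent :: "('a option \<Rightarrow> 'w measure) \<Rightarrow> (ennreal \<Rightarrow> 'w \<Rightarrow> 'a option) \<Rightarrow>
    real \<Rightarrow> ('a \<Rightarrow> ennreal) \<Rightarrow> 'a \<Rightarrow> ennreal" where
  "resolvent P X \<alpha> h x =
     (\<integral>\<^sup>+\<omega>. (\<integral>\<^sup>+t\<in>{t. 0 \<le> t \<and> ennreal t < life_time X \<omega>}.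
        ennreal (exp (- \<alpha> * t)) * h (the (X (ennreal t) \<omega>)) \<partial>lborel) \<partial>P (Some x))"

definition excessive :: "('a option \<Rightarrow> 'w measure) \<Rightarrow> (ennreal \<Rightarrow> 'w \<Rightarrow> 'a option) \<Rightarrow>
    real \<Rightarrow> ('a :: topological_space \<Rightarrow> ennreal) \<Rightarrow> bool" where
  "excessive P X \<alpha> f \<longleftrightarrow>
     f \<in> borel_measurable borel \<and>
     (\<forall>x. \<forall>t>0. ennreal (exp (- \<alpha> * t)) * transition P X t f x \<le> f x) \<and>
     (\<forall>x. ((\<lambda>t. ennreal (exp (- \<alpha> * t)) * transition P X t f x) \<longlongrightarrow> f x) (at_right 0))"

definition symmetric_transition :: "'a :: topological_space measure \<Rightarrow>
    ('a option \<Rightarrow> 'w measure) \<Rightarrow> (ennreal \<Rightarrow> 'w \<Rightarrow> 'a option) \<Rightarrow> bool" where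
  "symmetric_transition m P X \<longleftrightarrow>
     (\<forall>t>0. \<forall>f\<in>borel_measurable borel. \<forall>g\<in>borel_measurable borel.
        (\<integral>\<^sup>+x. transition P X t f x * g x \<partial>m) = (\<integral>\<^sup>+x. f x * transition P X t g x \<partial>m))"

text \<open>
  The \<open>L\<^sup>2\<close>-resolvent \<open>G\<^sub>\<alpha>h\<close> of the form is the element of the domain with
  \<open>\<E>\<^sub>\<alpha>(G\<^sub>\<alpha>h, v) = (h, v)\<close> for all \<open>v\<close> in the domain.  The process is associated with the form if
  \<open>R\<^sub>\<alpha>h\<close> is an \<open>m\<close>-version of \<open>G\<^sub>\<alpha>h\<close> for \<open>\<alpha> > 0\<close> and \<open>h \<in> L\<^sup>2(E;m)\<close>; by linearity it is enough to
  require this for nonnegative \<open>h\<close>.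
\<close>

definition form_resolvent :: "'a measure \<Rightarrow> ('a \<Rightarrow> real) set \<Rightarrow>
    (('a \<Rightarrow> real) \<Rightarrow> ('a \<Rightarrow> real) \<Rightarrow> real) \<Rightarrow> real \<Rightarrow> ('a \<Rightarrow> real) \<Rightarrow> ('a \<Rightarrow> real) \<Rightarrow> bool" where
  "form_resolvent m D \<E> \<alpha> h u \<longleftrightarrow> u \<in> D \<and> (\<forall>v\<in>D. form_shift m \<E> \<alpha> u v = L2_inner m h v)"

definition associated :: "'a measure \<Rightarrow> ('a \<Rightarrow> real) set \<Rightarrow>
    (('a \<Rightarrow> real) \<Rightarrow> ('a \<Rightarrow> real) \<Rightarrow> real) \<Rightarrow>
    ('a option \<Rightarrow> 'w measure) \<Rightarrow> (ennreal \<Rightarrow> 'w \<Rightarrow> 'a option) \<Rightarrow> bool" where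
  "associated m D \<E> P X \<longleftrightarrow>
     (\<forall>\<alpha>>0. \<forall>h\<in>L2_functions m. (\<forall>x. 0 \<le> h x) \<longrightarrow>
        (AE x in m. resolvent P X \<alpha> (\<lambda>y. ennreal (h y)) x < \<infinity>) \<and>
        form_resolvent m D \<E> \<alpha> h (\<lambda>x. enn2real (resolvent P X \<alpha> (\<lambda>y. ennreal (h y)) x)))"

text \<open>\<open>R\<^sub>\<alpha>(x, \<cdot>) \<lless> m\<close> for all \<open>x\<close> and \<open>\<alpha> > 0\<close>, where \<open>R\<^sub>\<alpha>(x, B) = R\<^sub>\<alpha> 1\<^sub>B(x)\<close>\<close>

definition resolvent_absolutely_continuous :: "'a measure \<Rightarrow>
    ('a option \<Rightarrow> 'w measure) \<Rightarrow> (ennreal \<Rightarrow> 'w \<Rightarrow> 'a option) \<Rightarrow> bool" where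
  "resolvent_absolutely_continuous m P X \<longleftrightarrow>
     (\<forall>\<alpha>>0. \<forall>x. \<forall>B\<in>null_sets m. resolvent P X \<alpha> (indicator B) x = 0)"

text \<open>
  Absolute continuity yields such a family of kernels, and a density that is excessive in each
  variable is unique.
\<close>

definition resolvent_kernel :: "'a :: {metric_space, second_countable_topology} measure \<Rightarrow>
    ('a option \<Rightarrow> 'w measure) \<Rightarrow> (ennreal \<Rightarrow> 'w \<Rightarrow> 'a option) \<Rightarrow>
    (real \<Rightarrow> 'a \<Rightarrow> 'a \<Rightarrow> ennreal) \<Rightarrow> bool" where
  "resolvent_kernel m P X r \<longleftrightarrow>
     (\<forall>\<alpha>\<ge>0.
        (\<lambda>(x, y). r \<alpha> x y) \<in> borel_measurable (borel \<Otimes>\<^sub>M borel) \<and>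
        (\<forall>x y. r \<alpha> x y = r \<alpha> y x) \<and>
        (\<forall>y. excessive P X \<alpha> (\<lambda>x. r \<alpha> x y)) \<and>
        (\<forall>x. excessive P X \<alpha> (\<lambda>y. r \<alpha> x y)) \<and>
        (\<forall>h\<in>borel_measurable borel. \<forall>x. resolvent P X \<alpha> h x = (\<integral>\<^sup>+y. h y * r \<alpha> x y \<partial>m)))"

locale potential_setting =
  symmetric_dirichlet_form m D \<E> + hunt_process M F P X
  for m :: "'a :: {metric_space, second_countable_topology} measure"
    and D :: "('a \<Rightarrow> real) set"
    and \<E> :: "('a \<Rightarrow> real) \<Rightarrow> ('a \<Rightarrow> real) \<Rightarrow> real"
    and M :: "'w measure"
    and F :: "ennreal \<Rightarrow> 'w measure"
    and P :: "'a option \<Rightarrow> 'w measure"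
    and X :: "ennreal \<Rightarrow> 'w \<Rightarrow> 'a option"
    and r :: "real \<Rightarrow> 'a \<Rightarrow> 'a \<Rightarrow> ennreal" +
  assumes locally_compact: "locally_compact_space (euclidean :: 'a topology)"
    and radon: "radon_full_support m"
    and regular: "regular_form m D \<E>"
    and transient: "transient_form m D \<E>"
    and symmetric: "symmetric_transition m P X"
    and associated: "associated m D \<E> P X"
    and abs_cont: "resolvent_absolutely_continuous m P X"
    and kernel: "resolvent_kernel m P X r"


section \<open>Signed Borel measures\<close>

text \<open>
  A signed measure is a countably additive set function with values in \<open>[-\<infinity>, \<infinity>]\<close> omitting at
  least one of \<open>\<plusminus>\<infinity>\<close>.  Only its values on Borel sets matter.
\<close>

definition signed_borel_measure :: "('a :: topological_space set \<Rightarrow> ereal) \<Rightarrow> bool" where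
  "signed_borel_measure \<mu> \<longleftrightarrow>
     \<mu> {} = 0 \<and>
     ((\<forall>B\<in>sets borel. \<mu> B \<noteq> \<infinity>) \<or> (\<forall>B\<in>sets borel. \<mu> B \<noteq> -\<infinity>)) \<and>
     (\<forall>A :: nat \<Rightarrow> 'a set. range A \<subseteq> sets borel \<longrightarrow> disjoint_family A \<longrightarrow>
        (\<lambda>i. \<mu> (A i)) sums \<mu> (\<Union>i. A i))"

text \<open>
  The parts \<open>\<mu>\<^sup>+\<close> and \<open>\<mu>\<^sup>-\<close> of the Jordan decomposition, as upper and lower variation.
  Here \<open>e2ennreal\<close> sends negative numbers to \<open>0\<close>.
\<close>

definition positive_part :: "('a :: topological_space set \<Rightarrow> ereal) \<Rightarrow> 'a set \<Rightarrow> ennreal" where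
  "positive_part \<mu> B = (SUP C\<in>{C \<in> sets borel. C \<subseteq> B}. e2ennreal (\<mu> C))"

definition negative_part :: "('a :: topological_space set \<Rightarrow> ereal) \<Rightarrow> 'a set \<Rightarrow> ennreal" where
  "negative_part \<mu> B = (SUP C\<in>{C \<in> sets borel. C \<subseteq> B}. e2ennreal (- \<mu> C))"

definition total_variation :: "('a :: topological_space set \<Rightarrow> ereal) \<Rightarrow> 'a measure" where
  "total_variation \<mu> = measure_of UNIV (sets borel) (\<lambda>B. positive_part \<mu> B + negative_part \<mu> B)"

definition potential :: "(real \<Rightarrow> 'a \<Rightarrow> 'a \<Rightarrow> ennreal) \<Rightarrow> 'a measure \<Rightarrow> 'a \<Rightarrow> ennreal" where
  "potential r \<nu> x = (\<integral>\<^sup>+y. r 0 x y \<partial>\<nu>)"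

definition bounded_measures :: "('a :: topological_space set \<Rightarrow> ereal) set" where
  "bounded_measures =
     {\<mu>. signed_borel_measure \<mu> \<and> emeasure (total_variation \<mu>) UNIV < \<infinity>}"

definition qe_finite_potential_measures :: "'a :: topological_space measure \<Rightarrow>
    ('a \<Rightarrow> real) set \<Rightarrow> (('a \<Rightarrow> real) \<Rightarrow> ('a \<Rightarrow> real) \<Rightarrow> real) \<Rightarrow>
    (real \<Rightarrow> 'a \<Rightarrow> 'a \<Rightarrow> ennreal) \<Rightarrow> ('a set \<Rightarrow> ereal) set" where
  "qe_finite_potential_measures m D \<E> r =
     {\<mu>. signed_borel_measure \<mu> \<and>
         quasi_everywhere m D \<E> (\<lambda>x. potential r (total_variation \<mu>) x < \<infinity>)}"



subsection \<open>The total variation is a measure\<close>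

text \<open>
  This guards against the convention that \<open>measure_of\<close> yields the zero measure if the given set
  function is not a measure.
\<close>

lemma variation_countably_additive:
  fixes f :: "'a :: topological_space set \<Rightarrow> ereal"
  assumes empty: "f {} = 0"
    and sub: "\<And>A :: nat \<Rightarrow> 'a set. range A \<subseteq> sets borel \<Longrightarrow> disjoint_family A \<Longrightarrow>
      e2ennreal (f (\<Union>i. A i)) \<le> (\<Sum>i. e2ennreal (f (A i)))"
    and pos: "\<And>A :: nat \<Rightarrow> 'a set. range A \<subseteq> sets borel \<Longrightarrow> disjoint_family A \<Longrightarrow>
      (\<forall>i. 0 \<le> f (A i)) \<Longrightarrow> e2ennreal (f (\<Union>i. A i)) = (\<Sum>i. e2ennreal (f (A i)))"
  shows "countably_additive (sets borel) (positive_part f)"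
proof (rule countably_additiveI)
  fix A :: "nat \<Rightarrow> 'a set"
  assume A: "range A \<subseteq> sets borel" and dis: "disjoint_family A"
  have A': "A i \<in> sets borel" for i using A by auto
  show "(\<Sum>i. positive_part f (A i)) = positive_part f (\<Union>i. A i)"
  proof (rule antisym)
    show "positive_part f (\<Union>i. A i) \<le> (\<Sum>i. positive_part f (A i))"
      unfolding positive_part_def[of f "\<Union>i. A i"]
    proof (rule SUP_least)
      fix C assume C: "C \<in> {C \<in> sets borel. C \<subseteq> (\<Union>i. A i)}"
      have CA: "range (\<lambda>i. C \<inter> A i) \<subseteq> sets borel" using C A' by auto
      have d: "disjoint_family (\<lambda>i. C \<inter> A i)" using dis by (auto simp: disjoint_family_on_def)
      have C_eq: "(\<Union>i. C \<inter> A i) = C" using C by auto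
      have "e2ennreal (f C) \<le> (\<Sum>i. e2ennreal (f (C \<inter> A i)))"
        using sub[OF CA d] unfolding C_eq .
      also have "\<dots> \<le> (\<Sum>i. positive_part f (A i))"
        unfolding positive_part_def using CA by (intro suminf_le SUP_upper) auto
      finally show "e2ennreal (f C) \<le> (\<Sum>i. positive_part f (A i))" .
    qed
    show "(\<Sum>i. positive_part f (A i)) \<le> positive_part f (\<Union>i. A i)"
    proof (rule suminf_le_const[OF summableI])
      fix n
      have key: "(\<Sum>i<n. e2ennreal (f (C i))) \<le> positive_part f (\<Union>i. A i)"
        if C: "\<And>i. C i \<in> sets borel \<and> C i \<subseteq> A i" for C
      proof -
        define C' where "C' i = (if i < n \<and> 0 \<le> f (C i) then C i else {})" for i
        have r: "range C' \<subseteq> sets borel" using C by (auto simp: C'_def)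
        have d: "disjoint_family C'" using dis C
          unfolding C'_def by (intro disjoint_family_subset[OF dis]) auto
        have p: "\<forall>i. 0 \<le> f (C' i)" by (auto simp: C'_def empty)
        have "(\<Sum>i<n. e2ennreal (f (C i))) = (\<Sum>i<n. e2ennreal (f (C' i)))"
          by (intro sum.cong refl) (simp add: C'_def empty e2ennreal_neg)
        also have "\<dots> \<le> (\<Sum>i. e2ennreal (f (C' i)))" by (rule sum_le_suminf) auto
        also have "\<dots> = e2ennreal (f (\<Union>i. C' i))" using pos[OF r d p] by simp
        also have "\<dots> \<le> positive_part f (\<Union>i. A i)"
          unfolding positive_part_def using r C by (intro SUP_upper) (auto simp: C'_def split: if_splits)
        finally show ?thesis .
      qed
      have S: "(\<Sum>i<k. positive_part f (A i)) + (\<Sum>i=k..<n. e2ennreal (f (C i)))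
          \<le> positive_part f (\<Union>i. A i)"
        if "k \<le> n" "\<And>i. C i \<in> sets borel \<and> C i \<subseteq> A i" for k C
        using that
      proof (induction k arbitrary: C)
        case 0
        then show ?case using key[of C] by (simp add: atLeast0LessThan)
      next
        case (Suc k)
        let ?S = "{B \<in> sets borel. B \<subseteq> A k}"
        let ?a = "(\<Sum>i<k. positive_part f (A i)) + (\<Sum>i=Suc k..<n. e2ennreal (f (C i)))"
        have "?a + e2ennreal (f B) \<le> positive_part f (\<Union>i. A i)" if B: "B \<in> ?S" for B
        proof -
          have "(\<Sum>i<k. positive_part f (A i)) + (\<Sum>i=k..<n. e2ennreal (f ((C(k := B)) i)))
              \<le> positive_part f (\<Union>i. A i)"
            using Suc B by (intro Suc.IH) auto
          moreover have "(\<Sum>i=k..<n. e2ennreal (f ((C(k := B)) i)))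
              = e2ennreal (f B) + (\<Sum>i=Suc k..<n. e2ennreal (f (C i)))"
            using Suc.prems by (subst sum.atLeast_Suc_lessThan) auto
          ultimately show ?thesis by (simp add: ac_simps)
        qed
        then have "(SUP B\<in>?S. ?a + e2ennreal (f B)) \<le> positive_part f (\<Union>i. A i)"
          by (rule SUP_least)
        also have "(SUP B\<in>?S. ?a + e2ennreal (f B)) = ?a + positive_part f (A k)"
          unfolding positive_part_def by (rule ennreal_SUP_add_right[symmetric]) auto
        finally show ?case by (simp add: ac_simps)
      qed
      show "(\<Sum>i<n. positive_part f (A i)) \<le> positive_part f (\<Union>i. A i)"
        using S[of n A] A' by simp
    qed
  qed
qed


lemma e2ennreal_sum_le: "e2ennreal (\<Sum>i<n. g i :: ereal) \<le> (\<Sum>i<n. e2ennreal (g i))" for n :: nat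
proof (induction n)
  case 0
  then show ?case by (simp add: e2ennreal_neg)
next
  case (Suc n)
  have *: "e2ennreal (a + b) \<le> e2ennreal a + e2ennreal b" for a b :: ereal
  proof -
    have "e2ennreal (a + b) \<le> e2ennreal (max 0 a + max 0 b)"
      by (intro e2ennreal_mono add_mono) auto
    also have "\<dots> = e2ennreal (max 0 a) + e2ennreal (max 0 b)"
      by (simp add: plus_ennreal.abs_eq eq_onp_def)
    also have "\<dots> = e2ennreal a + e2ennreal b"
      by (simp add: max_def e2ennreal_neg)
    finally show ?thesis .
  qed
  show ?case using order_trans[OF * add_right_mono[OF Suc]] by simp
qed

lemma e2ennreal_sums_le:
  fixes g :: "nat \<Rightarrow> ereal"
  assumes "g sums s"
  shows "e2ennreal s \<le> (\<Sum>i. e2ennreal (g i))"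
proof (rule LIMSEQ_le_const2)
  have "e2ennreal (\<Sum>i<n. g i) \<le> (\<Sum>i. e2ennreal (g i))" for n
    by (rule order_trans[OF e2ennreal_sum_le sum_le_suminf]) auto
  then show "\<exists>N. \<forall>n\<ge>N. e2ennreal (\<Sum>i<n. g i) \<le> (\<Sum>i. e2ennreal (g i))"
    by blast
  show "(\<lambda>n. e2ennreal (\<Sum>i<n. g i)) \<longlonglongrightarrow> e2ennreal s"
    using assms unfolding sums_def by (rule tendsto_e2ennrealI)
qed

lemma e2ennreal_sums_eq:
  fixes g :: "nat \<Rightarrow> ereal"
  assumes "g sums s" "\<And>i. 0 \<le> g i"
  shows "e2ennreal s = (\<Sum>i. e2ennreal (g i))"
proof -
  have "e2ennreal (\<Sum>i<n. g i) = (\<Sum>i<n. e2ennreal (g i))" for n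
    using assms(2) by (induction n) (auto simp: e2ennreal_neg plus_ennreal.abs_eq[symmetric] eq_onp_def sum_nonneg)
  moreover have "(\<lambda>n. e2ennreal (\<Sum>i<n. g i)) \<longlonglongrightarrow> e2ennreal s"
    using assms(1) unfolding sums_def by (rule tendsto_e2ennrealI)
  ultimately show ?thesis by (simp add: sums_def[symmetric] sums_iff)
qed

lemma ereal_sums_uminus:
  fixes g :: "nat \<Rightarrow> ereal"
  assumes "g sums s" "(\<forall>i. g i \<noteq> \<infinity>) \<or> (\<forall>i. g i \<noteq> -\<infinity>)"
  shows "(\<lambda>i. - g i) sums (- s)"
proof -
  have "(\<Sum>i<n. - g i) = - (\<Sum>i<n. g i) \<and>
     ((\<forall>i. g i \<noteq> \<infinity>) \<longrightarrow> (\<Sum>i<n. g i) \<noteq> \<infinity>) \<and> ((\<forall>i. g i \<noteq> -\<infinity>) \<longrightarrow> (\<Sum>i<n. g i) \<noteq> -\<infinity>)" for n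
  proof (induction n)
    case (Suc n)
    then show ?case
      using assms(2) by (cases "g n"; cases "\<Sum>i<n. g i") auto
  qed auto
  then show ?thesis using assms(1) by (simp add: sums_def tendsto_uminus_ereal)
qed

lemma
  assumes "signed_borel_measure \<mu>"
  shows sets_total_variation: "sets (total_variation \<mu>) = sets borel"
    and emeasure_total_variation:
      "B \<in> sets borel \<Longrightarrow> emeasure (total_variation \<mu>) B = positive_part \<mu> B + negative_part \<mu> B"
proof -
  show "sets (total_variation \<mu>) = sets borel"
    unfolding total_variation_def using sets.sigma_sets_eq[of borel] by simp
  have neg: "negative_part \<mu> = positive_part (\<lambda>B. - \<mu> B)"
    by (auto simp: negative_part_def positive_part_def)
  have S: "(\<lambda>i. \<mu> (A i)) sums \<mu> (\<Union>i. A i)" "(\<lambda>i. - \<mu> (A i)) sums (- \<mu> (\<Union>i. A i))"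
    if "range A \<subseteq> sets borel" "disjoint_family A" for A :: "nat \<Rightarrow> _"
  proof -
    show *: "(\<lambda>i. \<mu> (A i)) sums \<mu> (\<Union>i. A i)"
      using assms that by (auto simp: signed_borel_measure_def)
    show "(\<lambda>i. - \<mu> (A i)) sums (- \<mu> (\<Union>i. A i))"
      using assms that by (intro ereal_sums_uminus[OF *]) (auto simp: signed_borel_measure_def)
  qed
  have e: "\<mu> {} = 0" using assms by (simp add: signed_borel_measure_def)
  have p: "countably_additive (sets borel) (positive_part \<mu>)"
    using e S(1) by (intro variation_countably_additive e2ennreal_sums_le e2ennreal_sums_eq) auto
  have n: "countably_additive (sets borel) (negative_part \<mu>)"
    unfolding neg
  proof (rule variation_countably_additive)
    fix A :: "nat \<Rightarrow> 'a set" assume A: "range A \<subseteq> sets borel" "disjoint_family A"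
    show "e2ennreal (- \<mu> (\<Union>i. A i)) \<le> (\<Sum>i. e2ennreal (- \<mu> (A i)))"
      by (rule e2ennreal_sums_le[OF S(2)[OF A]])
    assume "\<forall>i. 0 \<le> - \<mu> (A i)"
    then show "e2ennreal (- \<mu> (\<Union>i. A i)) = (\<Sum>i. e2ennreal (- \<mu> (A i)))"
      by (intro e2ennreal_sums_eq[OF S(2)[OF A]]) auto
  qed (simp add: e)
  assume B: "B \<in> sets borel"
  show "emeasure (total_variation \<mu>) B = positive_part \<mu> B + negative_part \<mu> B"
    unfolding total_variation_def
  proof (rule emeasure_measure_of_sigma)
    show "sigma_algebra UNIV (sets borel :: 'a set set)"
      using sets.sigma_algebra_axioms[of "borel :: 'a measure"] by simp
    have [simp]: "{C \<in> sets borel. C \<subseteq> {}} = {{} :: 'a set}" by auto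
    show "positive (sets borel) (\<lambda>B. positive_part \<mu> B + negative_part \<mu> B)"
      by (simp add: positive_def positive_part_def negative_part_def e e2ennreal_neg)
    show "countably_additive (sets borel) (\<lambda>B. positive_part \<mu> B + negative_part \<mu> B)"
      using p n by (auto simp: countably_additive_def suminf_add[symmetric])
  qed (rule B)
qed
end

theory Submission
  imports Defs "HOL-Real_Asymp.Real_Asymp"
begin

text \<open>
  Let \<open>\<nu> = \<bar>\<mu>\<bar>\<close>, a finite measure, and \<open>u
      = R\<nu>\<close>.  The set \<open>{u = \<infinity>}\<close> is Borel, so by Choquet's
  capacitability theorem for the capacity of \<open>\<E>\<^sub>1\<close>, which dominates the capacity of
      \<open>\<E>\<close>, it is
  enough to consider its compact subsets \<open>K\<close>.  Transience and the maximum principle give \<open>u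
      < \<infinity>\<close>
  almost everywhere.  If \<open>u(x)
      < \<infinity>\<close>, then the process started at \<open>x\<close> does not hit \<open>K\<close>, because
  \<open>E\<^sub>x u(X\<^sub>T) \<le> u(x)\<close> for stopping times \<open>T\<close>;
      by quasi-left-continuity the expected discounts
  \<open>E\<^sub>x exp(-T\<^sub>n)\<close> at the hitting times \<open>T\<^sub>n\<close> of neighbourhoods
      \<open>V\<^sub>n\<close> decreasing to \<open>K\<close> tend to \<open>0\<close>.
  These functions of \<open>x\<close> are \<open>1\<close>-supermedian, equal to \<open>1\<close> on
      \<open>V\<^sub>n\<close> and dominated by the equilibrium
  potential of a fixed neighbourhood of \<open>K\<close>.  Hence they belong to the form domain and their energies
  tend to \<open>0\<close>, so that \<open>K\<close> has capacity zero.
\<close>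

section \<open>Capacitability of Borel sets\<close>

text \<open>What has to be excluded is that the infinity set of the potential is m-null but of
  positive capacity. The gap is closed by an argument that needs its starting points only m-almost
  everywhere: pointwise convergence of the hitting functions gives L2 convergence under their common
  majorant, and for 1-supermedian functions below a fixed element of the domain L2 convergence
  already forces the energy to 0. Compact sets are needed because positions at the times of entry
  into shrinking neighbourhoods must escape neither to the cemetery nor out of K; a general Borel
  set has no such neighbourhoods. The form \<open>\<E>\<^sub>1\<close> replaces \<E> because
  closedness is completeness with respect to \<open>\<E>\<^sub>1\<close>. Two devices keep the tools
  elementary. Near-minimizers in decreasing convex sets replace weak limits, and the potential is
  squeezed between functions \<open>R 0 h\<close>, so that the stopping inequality has to be proved
  only for these.\<close>

definition analytic_set :: "'a :: {metric_space, second_countable_topology} set \<Rightarrow> bool" where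
  "analytic_set A \<longleftrightarrow> (\<exists>H :: ('a \<times> (nat \<Rightarrow> nat)) set. closed H
      \<and> A = fst ` H)"

lemma analytic_set_closed: "closed A \<Longrightarrow> analytic_set A"
  unfolding analytic_set_def
  by (intro exI[of _ "A \<times> UNIV"]) (auto intro: closed_Times simp: image_iff)

text \<open>Countably many witnesses are packed into one sequence through
  \<open>prod_encode\<close>. This is why \<open>analytic_set\<close> projects along sequence space:
  one parameter sequence serves all factors, and the unpacking maps are continuous.\<close>

lemma analytic_set_INT:
  assumes "\<And>n :: nat. analytic_set (A n)"
  shows "analytic_set (\<Inter>n. A n)"
proof -
  obtain H :: "nat \<Rightarrow> ('a \<times> (nat \<Rightarrow> nat)) set"
    where H: "\<And>n. closed (H n)" "\<And>n. A n = fst ` H n"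
    using assms unfolding analytic_set_def by metis
  let ?f = "\<lambda>n (x, s). (x, \<lambda>k. s (prod_encode (n, k)))"
  have c: "continuous_on UNIV (?f n)" for n
    unfolding split_def
    by (intro continuous_intros continuous_on_coordinatewise_then_product continuous_on_product_then_coordinatewise)
  have "closed (\<Inter>n. ?f n -` H n)"
    by (intro closed_INT ballI closed_vimage H(1) c)
  moreover have "(\<Inter>n. A n) = fst ` (\<Inter>n. ?f n -` H n)"
  proof (intro equalityI subsetI)
    fix x assume "x \<in> (\<Inter>n. A n)"
    then have "\<forall>n. x \<in> fst ` H n" by (simp add: H(2))
    then have "\<forall>n. \<exists>s. (x, s) \<in> H n" by fastforce
    then obtain s where s: "\<And>n. (x, s n) \<in> H n" by metis
    have "(x, \<lambda>j. case prod_decode j of (n, k) \<Rightarrow> s n k) \<in> (\<Inter>n. ?f n -` H n)"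
      using s by auto
    then show "x \<in> fst ` (\<Inter>n. ?f n -` H n)" by (rule image_eqI[rotated]) simp
  qed (force simp: H(2))
  ultimately show ?thesis unfolding analytic_set_def by blast
qed

text \<open>The first entry of the witness names the index n, and the shifted rest is the witness
  for \<open>A n\<close>.\<close>

lemma analytic_set_UN:
  assumes "\<And>n :: nat. analytic_set (A n)"
  shows "analytic_set (\<Union>n. A n)"
proof -
  obtain H :: "nat \<Rightarrow> ('a \<times> (nat \<Rightarrow> nat)) set"
    where H: "\<And>n. closed (H n)" "\<And>n. A n = fst ` H n"
    using assms unfolding analytic_set_def by metis
  let ?f = "\<lambda>(x, s). (x, \<lambda>k. s (Suc k))"
  \<comment> \<open>An intersection of implications
    \<open>snd z 0 = n \<longrightarrow> ?f z \<in> H n\<close>. Their premises describe open sets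
    because the first entry is discrete, so each implication is a closed condition.\<close>
  let ?G = "\<Inter>n. {z. snd z 0 \<noteq> n} \<union> ?f -` H n"
  have c: "continuous_on UNIV ?f"
    unfolding split_def
    by (intro continuous_intros continuous_on_coordinatewise_then_product continuous_on_product_then_coordinatewise)
  have c0: "continuous_on UNIV (\<lambda>z :: 'a \<times> (nat \<Rightarrow> nat). snd z 0)"
    by (intro continuous_intros continuous_on_product_then_coordinatewise)
  have cl: "closed {z :: 'a \<times> (nat \<Rightarrow> nat). snd z 0 \<noteq> n}" for n :: nat
  proof -
    have "closed ((\<lambda>z :: 'a \<times> (nat \<Rightarrow> nat). snd z 0) -` (- {n}))"
      by (rule closed_vimage[OF _ c0]) (simp add: closed_def Topological_Spaces.open_discrete)
    then show ?thesis by (simp add: vimage_def)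
  qed
  have "closed ?G"
    by (intro closed_INT ballI closed_Un cl closed_vimage H(1) c)
  moreover have "(\<Union>n. A n) = fst ` ?G"
  proof (intro equalityI subsetI)
    fix x assume "x \<in> (\<Union>n. A n)"
    then obtain n s where s: "(x, s) \<in> H n" by (auto simp: H(2))
    then have "(x, case_nat n s) \<in> ?G" by auto
    then show "x \<in> fst ` ?G" by (rule image_eqI[rotated]) simp
  qed (force simp: H(2))
  ultimately show ?thesis unfolding analytic_set_def by blast
qed

lemma analytic_set_open:
  assumes "open U"
  shows "analytic_set U"
\<comment> \<open>With an empty complement \<open>infdist\<close> is 0 everywhere and all sets
  \<open>?C n\<close> would be empty, so the whole space is set apart.\<close>
proof (cases "U = UNIV")
  case False
  let ?C = "\<lambda>n :: nat. {x. infdist x (- U) \<ge> 1 / Suc n}"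
  have "closed (?C n)" for n
    by (intro closed_Collect_le continuous_intros)
  moreover have "U = (\<Union>n. ?C n)"
  proof (intro equalityI subsetI)
    fix x assume "x \<in> U"
    then have "infdist x (- U) \<noteq> 0"
      using in_closed_iff_infdist_zero[of "- U" x] assms False by (auto simp: closed_def)
    then have "infdist x (- U) > 0" using infdist_nonneg[of x "- U"] by linarith
    then obtain n where "inverse (real (Suc n)) < infdist x (- U)" using reals_Archimedean by blast
    then show "x \<in> (\<Union>n. ?C n)" by (auto simp: inverse_eq_divide intro!: exI[of _ n])
  next
    fix x assume "x \<in> (\<Union>n. ?C n)"
    then obtain n where "infdist x (- U) \<ge> 1 / real (Suc n)" by auto
    then have "infdist x (- U) \<noteq> 0"
      by (smt (verit) divide_pos_pos of_nat_0_less_iff zero_less_Suc)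
    then show "x \<in> U" by (metis ComplI infdist_zero)
  qed
  ultimately show ?thesis by (metis analytic_set_UN[of ?C] analytic_set_closed)
qed (simp add: analytic_set_closed)

lemma analytic_set_borel:
  assumes "B \<in> sets borel"
  shows "analytic_set B"
proof -
  have "B \<in> sigma_sets UNIV {U. open U}"
    using assms by (simp add: borel_def)
  \<comment> \<open>Analytic sets are not closed under complements in general, so the induction
    carries the complement along.\<close>
  then have "analytic_set B \<and> analytic_set (- B)"
  proof induction
    case (Union A)
    then show ?case
      using analytic_set_UN[of A] analytic_set_INT[of "\<lambda>n. - A n"] by simp
  qed (auto simp: analytic_set_open analytic_set_closed Compl_eq_Diff_UNIV[symmetric] closed_def)
  then show ?thesis by simp
qed

section \<open>Compact exhaustion, compactness in sequence space and Choquet's theorem\<close>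

lemma sigma_compact_exhaustion:
  assumes "locally_compact_space (euclidean :: 'a :: {metric_space, second_countable_topology} topology)"
  obtains L :: "nat \<Rightarrow> 'a :: {metric_space, second_countable_topology} set"
      where "\<And>n. compact (L n)" "incseq L" "(\<Union>n. L n) = UNIV"
proof -
  have "\<forall>x :: 'a. \<exists>U K. open U \<and> compact K \<and> x \<in> U \<and> U \<subseteq> K"
    using assms unfolding locally_compact_space_def by simp
  then obtain U K where UK: "\<And>x :: 'a. open (U x)" "\<And>x. compact (K x)" "\<And>x. x
      \<in> U x" "\<And>x. U x \<subseteq> K x"
    by metis
  obtain \<F> where F: "\<F> \<subseteq> range U" "countable \<F>" "\<Union>\<F> = \<Union>(range U)"
    using Lindelof[of "range U"] UK(1) by auto
  then obtain S where S: "countable S" "\<F> = U ` S"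
    using countable_subset_image by metis
  have UN: "(\<Union>x\<in>S. K x) = UNIV" 
  proof -
    have "\<exists>y\<in>S. x \<in> K y" for x
    proof -
      have "x \<in> \<Union>\<F>" using F(3) UK(3)[of x] by blast
      then show ?thesis using S(2) UK(4) by blast
    qed
    then show ?thesis by blast
  qed
  then have "S \<noteq> {}" by auto
  then have r: "range (from_nat_into S) = S" using S by simp
  show thesis
  proof (rule that[of "\<lambda>n. \<Union>i\<le>n. K (from_nat_into S i)"])
    show "incseq (\<lambda>n. \<Union>i\<le>n. K (from_nat_into S i))" by (auto simp: incseq_def intro: order_trans)
    have "(\<Union>n. \<Union>i\<le>n. K (from_nat_into S i)) = (\<Union>x\<in>range (from_nat_into S). K x)" by auto
    then show "(\<Union>n. \<Union>i\<le>n. K (from_nat_into S i)) = UNIV" using UN r by simp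
  qed (auto intro: UK)
qed

lemma compact_bounded_sequences: "compact {s :: nat \<Rightarrow> nat. \<forall>i. s i \<le> b i}"
proof -
  have "compactin (product_topology (\<lambda>i. euclidean) UNIV) (PiE UNIV (\<lambda>i. {..b i}))"
    by (subst compactin_PiE) (auto intro: finite_imp_compact)
  moreover have "PiE UNIV (\<lambda>i. {..b i}) = {s. \<forall>i. s i \<le> b i}" by auto
  ultimately show ?thesis
    by (simp add: euclidean_product_topology)
qed

lemma tendsto_fun_iff:
  fixes f :: "'a \<Rightarrow> 'b \<Rightarrow> 'c :: topological_space"
  shows "(f \<longlongrightarrow> l) F \<longleftrightarrow> (\<forall>i. ((\<lambda>x. f x i) \<longlongrightarrow> l i) F)"
  using limitin_componentwise[of "\<lambda>_. euclidean :: 'c topology" UNIV f l F]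
  by (simp add: euclidean_product_topology limitin_canonical_iff)

text \<open>
  Choquet's argument: bound one coordinate after the other so that the capacity stays above \<open>a\<close>;
  the points whose witnesses obey all bounds form a compact set.
\<close>

theorem Borel_capacitable:
  fixes c :: "'a :: {metric_space, second_countable_topology} set \<Rightarrow> 'b :: {complete_linorder}"
  assumes lc: "locally_compact_space (euclidean :: 'a topology)"
    and mono: "\<And>A B. A \<subseteq> B \<Longrightarrow> c A \<le> c B"
    and below: "\<And>A :: nat \<Rightarrow> 'a set. incseq A \<Longrightarrow> c (\<Union>n. A n) \<le> (SUP n. c (A n))"
    and outer: "\<And>K. compact K \<Longrightarrow> (INF U\<in>{U. open U \<and> K \<subseteq> U}. c U) \<le> c K"
    and B: "B \<in> sets borel" and a: "a < c B"
  obtains K where "compact K" "K \<subseteq> B" "a \<le> c K"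
proof -
  have step: "\<exists>n. a < c (A n)" if "incseq A" "a < c (\<Union>n. A n)" for A :: "nat \<Rightarrow> 'a set"
    using order.strict_trans2[OF that(2) below[OF that(1)]] by (simp add: less_SUP_iff)
  obtain H :: "('a \<times> (nat \<Rightarrow> nat)) set" where H: "closed H" "B = fst ` H"
    using analytic_set_borel[OF B] unfolding analytic_set_def by blast
  obtain L :: "nat \<Rightarrow> 'a set" where L: "\<And>n. compact (L n)" "incseq L" "(\<Union>n. L n) = UNIV"
    using sigma_compact_exhaustion[OF lc] by blast
  \<comment> \<open>The first coordinates of \<open>H\<close> are not confined to a compact set.
    Intersecting with some \<open>L l\<close> now makes \<open>K\<close> compact later, and
    continuity from below keeps the value above \<open>a\<close>.\<close>
  obtain l where l: "a < c (B \<inter> L l)"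
    using step[of "\<lambda>n. B \<inter> L n"] L(2,3) a by (auto simp: incseq_def Int_UN_distrib[symmetric])
  define A where "A b n = {x \<in> L l. \<exists>s. (x, s) \<in> H \<and> (\<forall>i<n. s i
      \<le> b i)}" for b :: "nat \<Rightarrow> nat" and n
  have A_cong: "A b n = A b' n" if "\<And>i. i < n \<Longrightarrow> b i = b' i" for b b' n
    unfolding A_def using that by auto
  have ext: "\<exists>k. a < c (A (b(n := k)) (Suc n))" if "a < c (A b n)" for b n
  proof (rule step)
    show "incseq (\<lambda>k. A (b(n := k)) (Suc n))"
      unfolding incseq_def A_def
      by (intro allI impI Collect_mono) (fastforce simp: less_Suc_eq split: if_splits)
    have "(\<Union>k. A (b(n := k)) (Suc n)) = A b n"
    proof (intro equalityI subsetI)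
      fix x assume "x \<in> A b n"
      then obtain s where "x \<in> L l" "(x, s) \<in> H" "\<forall>i<n. s i \<le> b i" unfolding A_def by auto
      then have "x \<in> A (b(n := s n)) (Suc n)" unfolding A_def by (auto simp: less_Suc_eq)
      then show "x \<in> (\<Union>k. A (b(n := k)) (Suc n))" by blast
    qed (force simp: A_def less_Suc_eq)
    then show "a < c (\<Union>k. A (b(n := k)) (Suc n))" using that by simp
  qed
  \<comment> \<open>\<open>f n\<close> has settled the bounds for the coordinates below n; its later
    entries are still 0, and \<open>A (f n) n\<close> does not look at them.\<close>
  define f where "f = rec_nat (\<lambda>_. 0) (\<lambda>n b. b(n := SOME k. a < c (A (b(n := k)) (Suc n))))"
  have f_Suc: "f (Suc n) = (f n)(n := SOME k. a < c (A ((f n)(n := k)) (Suc n)))" for n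
    by (simp add: f_def)
  have f: "a < c (A (f n) n)" for n
  proof (induction n)
    case 0
    have "A (f 0) 0 = B \<inter> L l" unfolding A_def H(2) by force
    then show ?case using l by simp
  next
    case (Suc n)
    show ?case unfolding f_Suc using someI_ex[OF ext[OF Suc]] .
  qed
  define b where "b i = f (Suc i) i" for i
  have fb: "f n i = b i" if "i < n" for n i
    using that
  proof (induction n)
    case (Suc n)
    then show ?case by (cases "i = n") (auto simp: b_def f_Suc)
  qed simp
  have Ab: "a < c (A b n)" for n
    using f[of n] A_cong[of n "f n" b] fb by simp
  define S where "S = {s. \<forall>i. s i \<le> b i}"
  have LS: "compact (L l \<times> S)"
    unfolding S_def by (intro compact_Times L compact_bounded_sequences)
  define K where "K = fst ` ((L l \<times> S) \<inter> H)"
  show thesis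
  proof (rule that)
    show "compact K"
      unfolding K_def by (intro compact_continuous_image compact_Int_closed LS H continuous_intros)
    then have "(INF U\<in>{U. open U \<and> K \<subseteq> U}. c U) \<le> c K" by (rule outer)
    \<comment> \<open>\<open>A b n\<close> need not be closed, so its value cannot be passed to
      \<open>K\<close> directly. Instead every open set around \<open>K\<close> contains some
      \<open>A b n\<close>, and outer regularity at compact sets does the rest.\<close>
    moreover have aU: "a \<le> c U" if U: "open U" "K \<subseteq> U" for U
    proof -
      have "\<exists>n. A b n \<subseteq> U"
      proof (rule ccontr)
        assume "\<not> (\<exists>n. A b n \<subseteq> U)"
        then have "\<forall>n. \<exists>x s. x \<in> L l - U \<and> (x, s) \<in> H \<and> (\<forall>i<n. s i \<le> b i)"
          unfolding A_def by blast
        then obtain x s where xs: "\<And>n. x n \<in> L l - U" "\<And>n. (x n, s n) \<in> H" "\<And>n i. i < n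
            \<Longrightarrow> s n i \<le> b i"
          by metis
        \<comment> \<open>Cutting the witnesses at \<open>b\<close> puts them into the compact set
          \<open>S\<close>. Each fixed coordinate is altered only finitely often, so the uncut
          witnesses have the same limit and the limit point stays in the closed set
          \<open>H\<close>.\<close>
        have "\<forall>n. (x n, \<lambda>i. min (s n i) (b i)) \<in> L l \<times> S"
          using xs(1) by (auto simp: S_def)
        then obtain z \<phi> where z: "z \<in> L l \<times> S" "strict_mono \<phi>"
            "((\<lambda>n. (x n, \<lambda>i. min (s n i) (b i))) \<circ> \<phi>) \<longlonglongrightarrow> z"
          by (rule seq_compactE[OF compact_imp_seq_compact[OF LS]])
        have x: "(\<lambda>n. x (\<phi> n)) \<longlonglongrightarrow> fst z"
          using tendsto_fst[OF z(3)] by (simp add: o_def)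
        have "(\<lambda>n. s (\<phi> n) i) \<longlonglongrightarrow> snd z i" for i
        proof (rule Lim_transform_eventually)
          have "((\<lambda>n. \<lambda>i. min (s (\<phi> n) i) (b i)) \<longlongrightarrow> snd z) sequentially"
            using tendsto_snd[OF z(3)] by (simp add: o_def)
          then show "(\<lambda>n. min (s (\<phi> n) i) (b i)) \<longlonglongrightarrow> snd z i"
            by (simp add: tendsto_fun_iff)
          show "\<forall>\<^sub>F n in sequentially. min (s (\<phi> n) i) (b i) = s (\<phi> n) i"
            using eventually_gt_at_top[of i]
          proof eventually_elim
            case (elim n)
            then have "i < \<phi> n" using seq_suble[OF z(2), of n] by simp
            then show ?case using xs(3)[of i "\<phi> n"] by simp
          qed
        qed
        then have s: "(\<lambda>n. s (\<phi> n)) \<longlonglongrightarrow> snd z"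
          by (simp add: tendsto_fun_iff)
        have "(fst z, snd z) \<in> H"
          using closed_sequentially[OF H(1), of
              "\<lambda>n. (x (\<phi> n), s (\<phi> n))"] tendsto_Pair[OF x s] xs(2) by simp
        then have "fst z \<in> K" unfolding K_def using z(1) by (auto simp: image_iff mem_Times_iff intro!: bexI[of _ z])
        moreover have "fst z \<in> - U"
          using closed_sequentially[of "- U" "\<lambda>n. x (\<phi> n)"] U(1) x xs(1) by auto
        ultimately show False using U(2) by auto
      qed
      then obtain n where "c (A b n) \<le> c U" using mono by blast
      then show ?thesis using Ab[of n] by (blast intro: less_imp_le less_le_trans)
    qed
    moreover have "a \<le> (INF U\<in>{U. open U \<and> K \<subseteq> U}. c U)"
      using aU by (intro INF_greatest) auto
    ultimately show "a \<le> c K" by simp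
    show "K \<subseteq> B" unfolding K_def H(2) by auto
  qed
qed

section \<open>The Hilbert space structure of a Dirichlet form\<close>

lemma L2_functionsI:
  "u \<in> borel_measurable m \<Longrightarrow> integrable m (\<lambda>x. (u x)\<^sup>2)
      \<Longrightarrow> u \<in> L2_functions m"
  by (simp add: L2_functions_def)

lemma L2_functionsD:
  assumes "u \<in> L2_functions m"
  shows "u \<in> borel_measurable m" "integrable m (\<lambda>x. (u x)\<^sup>2)"
  using assms by (auto simp: L2_functions_def)

lemma L2_mult_integrable:
  assumes "u \<in> L2_functions m" "v \<in> L2_functions m"
  shows "integrable m (\<lambda>x. u x * v x)"
proof (rule Bochner_Integration.integrable_bound)
  note [measurable] = assms[THEN L2_functionsD(1)]
  show "integrable m (\<lambda>x. (u x)\<^sup>2 + (v x)\<^sup>2)" using assms[THEN L2_functionsD(2)] by simp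
  show "(\<lambda>x. u x * v x) \<in> borel_measurable m" by measurable
  have "\<bar>a * b\<bar> \<le> a\<^sup>2 + b\<^sup>2" for a b :: real
  proof -
    have "0 \<le> (\<bar>a\<bar> - \<bar>b\<bar>)\<^sup>2" by simp
    then have "2 * (\<bar>a\<bar> * \<bar>b\<bar>) \<le> a\<^sup>2 + b\<^sup>2" by (simp add: power2_diff mult.assoc)
    moreover have "0 \<le> \<bar>a\<bar> * \<bar>b\<bar>" by simp
    ultimately show ?thesis unfolding abs_mult by linarith
  qed
  then show "AE x in m. norm (u x * v x) \<le> norm ((u x)\<^sup>2 + (v x)\<^sup>2)" by simp
qed

lemma L2_scale: "u \<in> L2_functions m \<Longrightarrow> (\<lambda>x. c * u x) \<in> L2_functions m"
  by (auto simp: L2_functions_def power_mult_distrib)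

lemma L2_add:
  assumes "u \<in> L2_functions m" "v \<in> L2_functions m"
  shows "(\<lambda>x. u x + v x) \<in> L2_functions m"
proof (rule L2_functionsI)
  have "integrable m (\<lambda>x. (u x)\<^sup>2 + (v x)\<^sup>2 + 2 * (u x * v x))"
    using L2_mult_integrable[OF assms] assms[THEN L2_functionsD(2)] by simp
  then show "integrable m (\<lambda>x. (u x + v x)\<^sup>2)"
    by (simp add: power2_sum algebra_simps)
qed (use assms in \<open>auto simp: L2_functions_def\<close>)

lemma L2_diff:
  "u \<in> L2_functions m \<Longrightarrow> v \<in> L2_functions m
      \<Longrightarrow> (\<lambda>x. u x - v x) \<in> L2_functions m"
  using L2_add[of u m "\<lambda>x. - 1 * v x"] L2_scale[of v m "-1"] by simp

lemma L2_dominated: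
  assumes "v \<in> L2_functions m" "u \<in> borel_measurable m" "AE x in m. \<bar>u x\<bar> \<le> \<bar>v x\<bar>"
  shows "u \<in> L2_functions m"
proof (rule L2_functionsI)
  show "integrable m (\<lambda>x. (u x)\<^sup>2)"
    by (rule Bochner_Integration.integrable_bound[OF L2_functionsD(2)[OF assms(1)]])
      (use assms in \<open>auto simp: abs_le_square_iff\<close>)
qed fact

abbreviation L2_sq :: "'a measure \<Rightarrow> ('a \<Rightarrow> real) \<Rightarrow> real" where
  "L2_sq m u \<equiv> L2_inner m u u"

lemma L2_inner_sym: "L2_inner m u v = L2_inner m v u"
  by (simp add: L2_inner_def mult.commute)

lemma L2_inner_add_left:
  "u \<in> L2_functions m \<Longrightarrow> v \<in> L2_functions m \<Longrightarrow> w \<in> L2_functions m \<Longrightarrow>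
   L2_inner m (\<lambda>x. u x + v x) w = L2_inner m u w + L2_inner m v w"
  by (simp add: L2_inner_def distrib_right L2_mult_integrable)

lemma L2_inner_scale_left: "L2_inner m (\<lambda>x. c * u x) w = c * L2_inner m u w"
  by (simp add: L2_inner_def mult.assoc)

lemma L2_inner_diff_left:
  "u \<in> L2_functions m \<Longrightarrow> v \<in> L2_functions m \<Longrightarrow> w \<in> L2_functions m \<Longrightarrow>
   L2_inner m (\<lambda>x. u x - v x) w = L2_inner m u w - L2_inner m v w"
  by (simp add: L2_inner_def left_diff_distrib L2_mult_integrable)

lemma L2_inner_nonneg: "0 \<le> L2_sq m u"
  by (simp add: L2_inner_def)

lemma L2_inner_mono:
  assumes "u \<in> L2_functions m" "v \<in> L2_functions m" "AE x in m. \<bar>u x\<bar> \<le> \<bar>v x\<bar>"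
  shows "L2_sq m u \<le> L2_sq m v"
  unfolding L2_inner_def
  using assms by (intro integral_mono_AE) (auto intro: L2_functionsD(2) simp: abs_le_square_iff simp flip: power2_eq_square)

lemma L2_inner_cong_AE:
  assumes "u \<in> borel_measurable m" "u' \<in> borel_measurable m" "v \<in> borel_measurable m"
    "AE x in m. u x = u' x"
  shows "L2_inner m u v = L2_inner m u' v"
  unfolding L2_inner_def using assms by (intro integral_cong_AE) auto

lemma L2_AE_subseq:
  assumes u: "\<And>n. u n \<in> L2_functions m" and v: "v \<in> L2_functions m"
    and lim: "(\<lambda>n. L2_sq m (\<lambda>x. u n x - v x)) \<longlonglongrightarrow> 0"
  obtains s :: "nat \<Rightarrow> nat"
      where "strict_mono s" "AE x in m. (\<lambda>n. u (s n) x) \<longlonglongrightarrow> v x"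
proof -
  have i: "integrable m (\<lambda>x. (u n x - v x) * (u n x - v x))" for n
    by (intro L2_mult_integrable L2_diff u v)
  obtain s where s: "strict_mono s" "AE x in m. (\<lambda>n. (u (s n) x - v x) * (u (s n) x - v x))
      \<longlonglongrightarrow> 0"
    using tendsto_L1_AE_subseq[of m "\<lambda>n x. (u n x - v x) * (u n x - v x)"] i lim
    unfolding L2_inner_def by auto
  have "AE x in m. (\<lambda>n. u (s n) x) \<longlonglongrightarrow> v x"
    using s(2)
  proof eventually_elim
    case (elim x)
    then have "(\<lambda>n. sqrt ((u (s n) x - v x) * (u (s n) x - v x))) \<longlonglongrightarrow> sqrt 0"
      by (rule tendsto_real_sqrt)
    then have "(\<lambda>n. \<bar>u (s n) x - v x\<bar>) \<longlonglongrightarrow> 0" by simp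
    then have "(\<lambda>n. u (s n) x - v x) \<longlonglongrightarrow> 0"
      by (rule tendsto_rabs_zero_cancel)
    then show ?case by (rule LIM_zero_cancel)
  qed
  with s(1) show thesis by (rule that)
qed

lemma L2_limit_unique:
  assumes u: "\<And>n. u n \<in> L2_functions m" and v: "v \<in> L2_functions m" and w: "w \<in> L2_functions m"
    and "(\<lambda>n. L2_sq m (\<lambda>x. u n x - v x)) \<longlonglongrightarrow> 0"
    and "(\<lambda>n. L2_sq m (\<lambda>x. u n x - w x)) \<longlonglongrightarrow> 0"
  shows "AE x in m. v x = w x"
proof -
  obtain s where s: "strict_mono s" "AE x in m. (\<lambda>n. u (s n) x) \<longlonglongrightarrow> v x"
    using L2_AE_subseq[OF u v assms(4)] by blast
  obtain t where t: "strict_mono t" "AE x in m. (\<lambda>n. u (s (t n)) x) \<longlonglongrightarrow> w x"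
    using L2_AE_subseq[OF u w LIMSEQ_subseq_LIMSEQ[OF assms(5) s(1), unfolded o_def]] by blast
  show ?thesis
    using s(2) t(2)
  proof eventually_elim
    case (elim x)
    then show ?case
      using LIMSEQ_subseq_LIMSEQ[OF elim(1) t(1)] LIMSEQ_unique by (auto simp: o_def)
  qed
qed

section \<open>Inner product calculus, completeness and truncation for the form\<close>

context symmetric_dirichlet_form
begin

abbreviation B :: "real \<Rightarrow> ('a \<Rightarrow> real) \<Rightarrow> ('a \<Rightarrow> real) \<Rightarrow> real" where
  "B \<equiv> form_shift m \<E>"

abbreviation Q :: "real \<Rightarrow> ('a \<Rightarrow> real) \<Rightarrow> real" where
  "Q \<alpha> u \<equiv> B \<alpha> u u"

lemma D_L2: "u \<in> D \<Longrightarrow> u \<in> L2_functions m"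
  using domain_L2 by auto

lemma D_measurable: "u \<in> D \<Longrightarrow> u \<in> borel_measurable m"
  using D_L2 L2_functionsD by blast

lemma domain_diff: "u \<in> D \<Longrightarrow> v \<in> D \<Longrightarrow> (\<lambda>x. u x - v x) \<in> D"
  using domain_add[of u "\<lambda>x. - 1 * v x"] domain_scale[of v "-1"] by simp

lemma domain_mid: "u \<in> D \<Longrightarrow> v \<in> D \<Longrightarrow> (\<lambda>x. (u x + v x) / 2) \<in> D"
  using domain_scale[OF domain_add, of u v "1/2"] by simp

lemma B_sym: "u \<in> D \<Longrightarrow> v \<in> D \<Longrightarrow> B \<alpha> u v = B \<alpha> v u"
  by (simp add: form_shift_def form_sym L2_inner_sym)

lemma B_add_left:
  "u \<in> D \<Longrightarrow> v \<in> D \<Longrightarrow> w \<in> D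
      \<Longrightarrow> B \<alpha> (\<lambda>x. u x + v x) w = B \<alpha> u w + B \<alpha> v w"
  by (simp add: form_shift_def form_add L2_inner_add_left D_L2 algebra_simps)

lemma B_scale_left: "u \<in> D \<Longrightarrow> w \<in> D
    \<Longrightarrow> B \<alpha> (\<lambda>x. c * u x) w = c * B \<alpha> u w"
  by (simp add: form_shift_def form_scale L2_inner_scale_left algebra_simps)

lemma B_diff_left:
  "u \<in> D \<Longrightarrow> v \<in> D \<Longrightarrow> w \<in> D
      \<Longrightarrow> B \<alpha> (\<lambda>x. u x - v x) w = B \<alpha> u w - B \<alpha> v w"
  using B_add_left[of u "\<lambda>x. - 1 * v x" w] B_scale_left[of v w \<alpha> "-1"] domain_scale[of v "-1"] by simp

lemma B_add_right:
  "u \<in> D \<Longrightarrow> v \<in> D \<Longrightarrow> w \<in> D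
      \<Longrightarrow> B \<alpha> w (\<lambda>x. u x + v x) = B \<alpha> w u + B \<alpha> w v"
  by (simp add: B_sym[of w] B_add_left domain_add)

lemma B_scale_right: "u \<in> D \<Longrightarrow> w \<in> D
    \<Longrightarrow> B \<alpha> w (\<lambda>x. c * u x) = c * B \<alpha> w u"
  by (simp add: B_sym[of w] B_scale_left domain_scale)

lemma B_diff_right:
  "u \<in> D \<Longrightarrow> v \<in> D \<Longrightarrow> w \<in> D
      \<Longrightarrow> B \<alpha> w (\<lambda>x. u x - v x) = B \<alpha> w u - B \<alpha> w v"
  by (simp add: B_sym[of w] B_diff_left domain_diff)

lemma B_nonneg: "u \<in> D \<Longrightarrow> 0 \<le> \<alpha> \<Longrightarrow> 0 \<le> Q \<alpha> u"
  by (simp add: form_shift_def form_nonneg L2_inner_nonneg)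

lemma form_le_B: "u \<in> D \<Longrightarrow> 0 \<le> \<alpha> \<Longrightarrow> \<E> u u \<le> Q \<alpha> u"
  by (simp add: form_shift_def L2_inner_nonneg)

lemma L2_le_B: "u \<in> D \<Longrightarrow> L2_sq m u \<le> Q 1 u"
  by (simp add: form_shift_def form_nonneg)

lemma B_cong_AE:
  assumes "u \<in> D" "v \<in> D" "w \<in> D" "AE x in m. u x = v x"
  shows "B \<alpha> u w = B \<alpha> v w"
  using assms form_AE[OF assms] L2_inner_cong_AE[of u m v w] D_measurable by (simp add: form_shift_def)

lemma B_cong_AE2:
  assumes "u \<in> D" "v \<in> D" "AE x in m. u x = v x"
  shows "Q \<alpha> u = Q \<alpha> v"
  using B_cong_AE[OF assms(1,2,1,3), of \<alpha>] B_cong_AE[OF assms(1,2,2,3), of \<alpha>] B_sym assms by metis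

lemma B_quad_add:
  assumes "u \<in> D" "v \<in> D"
  shows "Q \<alpha> (\<lambda>x. u x + c * v x)
      = Q \<alpha> u + 2 * c * B \<alpha> u v + c\<^sup>2 * Q \<alpha> v"
  using assms B_sym[OF assms, of \<alpha>]
  by (simp add: B_add_left B_add_right B_scale_left B_scale_right domain_add domain_scale algebra_simps power2_eq_square)

lemma B_quad_diff:
  assumes "u \<in> D" "v \<in> D"
  shows "Q \<alpha> (\<lambda>x. u x - v x) = Q \<alpha> u - 2 * B \<alpha> u v + Q \<alpha> v"
  using B_quad_add[OF assms, of \<alpha> "-1"] by simp

lemma B_parallelogram:
  assumes "u \<in> D" "v \<in> D"
  shows "Q \<alpha> (\<lambda>x. u x - v x) =
    2 * Q \<alpha> u + 2 * Q \<alpha> v - 4 * Q \<alpha> (\<lambda>x. (u x + v x) / 2)"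
proof -
  have "Q \<alpha> (\<lambda>x. 1/2 * (u x + v x)) =
      1/4 * Q \<alpha> (\<lambda>x. u x + 1 * v x)"
    using assms by (simp only: B_scale_left B_scale_right domain_scale domain_add mult_1)
  then show ?thesis
    using B_quad_add[OF assms, of \<alpha> 1] B_quad_diff[OF assms, of \<alpha>] by simp
qed

text \<open>Sublevel sets of the energy are closed under midpoints, the only form of convexity that
  \<open>minimizing_sequence\<close> asks for.\<close>

lemma B_mid_le:
  assumes "u \<in> D" "v \<in> D" "0 \<le> \<alpha>" "Q \<alpha> u \<le> K" "Q \<alpha> v \<le> K"
  shows "Q \<alpha> (\<lambda>x. (u x + v x) / 2) \<le> K"
  using B_parallelogram[OF assms(1,2), of \<alpha>] B_nonneg[OF domain_diff[OF assms(1,2)] assms(3)] assms(4,5)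
  by simp

lemma B_Cauchy_Schwarz:
  assumes "u \<in> D" "v \<in> D" "0 \<le> \<alpha>"
  shows "\<bar>B \<alpha> u v\<bar> \<le> sqrt (Q \<alpha> u) * sqrt (Q \<alpha> v)"
proof -
  have q: "0 \<le> Q \<alpha> u + 2 * c * B \<alpha> u v + c\<^sup>2 * Q \<alpha> v" for c
    using B_nonneg[OF domain_add[OF assms(1) domain_scale[OF assms(2), of c]] assms(3)]
    by (simp add: B_quad_add assms)
  have "(B \<alpha> u v)\<^sup>2 \<le> Q \<alpha> u * Q \<alpha> v"
  proof (cases "Q \<alpha> v = 0")
    case True
    have "B \<alpha> u v = 0"
    proof (rule ccontr)
      assume "B \<alpha> u v \<noteq> 0"
      \<comment> \<open>For \<open>Q \<alpha> v = 0\<close> the quadratic in c is linear, and this c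
        gives it the value -1.\<close>
      then show False
        using q[of "- (Q \<alpha> u + 1) / (2 * B \<alpha> u v)"] True by (simp add: field_simps)
    qed
    then show ?thesis using True by simp
  next
    case False
    then have pos: "Q \<alpha> v > 0" using B_nonneg[OF assms(2,3)] by simp
    have "0 \<le> Q \<alpha> u - (B \<alpha> u v)\<^sup>2 / Q \<alpha> v"
      using q[of "- B \<alpha> u v / Q \<alpha> v"] pos by (simp add: field_simps power2_eq_square)
    then show ?thesis using pos by (simp add: field_simps)
  qed
  then show ?thesis
    by (metis real_sqrt_abs real_sqrt_le_mono real_sqrt_mult)
qed

lemma B_triangle:
  assumes "u \<in> D" "v \<in> D" "0 \<le> \<alpha>"
  shows "sqrt (Q \<alpha> (\<lambda>x. u x + v x))
      \<le> sqrt (Q \<alpha> u) + sqrt (Q \<alpha> v)"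
proof (rule real_le_lsqrt)
  have "Q \<alpha> (\<lambda>x. u x + v x) = Q \<alpha> u + 2 * B \<alpha> u v + Q \<alpha> v"
    using B_quad_add[OF assms(1,2), of \<alpha> 1] by simp
  also have "\<dots> \<le> Q \<alpha> u + 2 * (sqrt (Q \<alpha> u) * sqrt (Q \<alpha> v)) + Q \<alpha> v"
    using B_Cauchy_Schwarz[OF assms] by linarith
  also have "\<dots> = (sqrt (Q \<alpha> u) + sqrt (Q \<alpha> v))\<^sup>2"
    using B_nonneg assms by (simp add: power2_sum)
  finally show "Q \<alpha> (\<lambda>x. u x + v x)
      \<le> (sqrt (Q \<alpha> u) + sqrt (Q \<alpha> v))\<^sup>2" .
qed (use B_nonneg assms in auto)

lemma B_triangle_diff:
  assumes "u \<in> D" "v \<in> D" "0 \<le> \<alpha>"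
  shows "\<bar>sqrt (Q \<alpha> u) - sqrt (Q \<alpha> v)\<bar>
      \<le> sqrt (Q \<alpha> (\<lambda>x. u x - v x))"
proof -
  have d: "(\<lambda>x. u x - v x) \<in> D" "(\<lambda>x. v x - u x) \<in> D" using assms by (auto intro: domain_diff)
  have "Q \<alpha> (\<lambda>x. u x - v x)
      = Q \<alpha> (\<lambda>x. v x - u x)"
    using assms by (simp add: B_quad_diff B_sym)
  then show ?thesis
    using B_triangle[OF d(1) assms(2,3)] B_triangle[OF d(2) assms(1,3)] by simp
qed

lemma B_tendsto:
  assumes u: "\<And>n :: nat. u n \<in> D" and v: "v \<in> D"
    and lim: "(\<lambda>n. Q 1 (\<lambda>x. u n x - v x)) \<longlonglongrightarrow> 0"
  shows "(\<lambda>n. Q 1 (u n)) \<longlonglongrightarrow> Q 1 v"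
    and "w \<in> D \<Longrightarrow> (\<lambda>n. B 1 (u n) w) \<longlonglongrightarrow> B 1 v w"
    and "(\<lambda>n. L2_sq m (\<lambda>x. u n x - v x)) \<longlonglongrightarrow> 0"
proof -
  have s: "(\<lambda>n. sqrt (Q 1 (\<lambda>x. u n x - v x))) \<longlonglongrightarrow> 0"
    using tendsto_real_sqrt[OF lim] by simp
  have "(\<lambda>n. sqrt (Q 1 (u n)) - sqrt (Q 1 v)) \<longlonglongrightarrow> 0"
    by (rule Lim_null_comparison[OF _ s]) (simp add: B_triangle_diff u v)
  then have "(\<lambda>n. sqrt (Q 1 (u n))) \<longlonglongrightarrow> sqrt (Q 1 v)"
    by (rule LIM_zero_cancel)
  then have "(\<lambda>n. (sqrt (Q 1 (u n)))\<^sup>2) \<longlonglongrightarrow> (sqrt (Q 1 v))\<^sup>2"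
    by (rule tendsto_power)
  then show "(\<lambda>n. Q 1 (u n)) \<longlonglongrightarrow> Q 1 v"
    using B_nonneg[OF u] B_nonneg[OF v] by simp
  show "(\<lambda>n. B 1 (u n) w) \<longlonglongrightarrow> B 1 v w" if w: "w \<in> D"
  proof (rule LIM_zero_cancel, rule Lim_null_comparison)
    show "(\<lambda>n. sqrt (Q 1 (\<lambda>x. u n x - v x)) * sqrt (Q 1 w)) \<longlonglongrightarrow> 0"
      using tendsto_mult_right[OF s, of "sqrt (Q 1 w)"] by simp
    show "\<forall>\<^sub>F n in sequentially. norm (B 1 (u n) w - B 1 v w)
        \<le> sqrt (Q 1 (\<lambda>x. u n x - v x)) * sqrt (Q 1 w)"
      using B_Cauchy_Schwarz[OF domain_diff[OF u v] w, of 1] by (simp add: B_diff_left u v w)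
  qed
  show "(\<lambda>n. L2_sq m (\<lambda>x. u n x - v x)) \<longlonglongrightarrow> 0"
    by (rule Lim_null_comparison[OF _ lim])
      (simp add: abs_of_nonneg L2_inner_nonneg L2_le_B[OF domain_diff[OF u v]])
qed

text \<open>
  The parallelogram law makes near-minimal elements of a decreasing sequence of convex sets a
  Cauchy sequence.  This takes the place of weak compactness.
\<close>

lemma minimizing_sequence:
  fixes C :: "nat \<Rightarrow> ('a \<Rightarrow> real) set"
  assumes sub: "\<And>n. C n \<subseteq> D" and dec: "decseq C"
    and mid: "\<And>n u v. u \<in> C n \<Longrightarrow> v \<in> C n
        \<Longrightarrow> (\<lambda>x. (u x + v x) / 2) \<in> C n"
    and bdd: "\<And>n. \<exists>u\<in>C n. Q 1 u \<le> K"
  obtains u v where "\<And>n. u n \<in> C n" "v \<in> D"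
    "(\<lambda>n. Q 1 (\<lambda>x. u n x - v x)) \<longlonglongrightarrow> 0"
    "\<And>n w. w \<in> C n \<Longrightarrow> Q 1 (u n) \<le> Q 1 w + 1 / Suc n"
proof -
  define c where "c n = (INF u\<in>C n. Q 1 u)" for n
  have bb: "bdd_below ((\<lambda>u. Q 1 u) ` C n)" for n
    using sub[of n] by (intro bdd_belowI[of _ 0]) (auto intro: B_nonneg)
  have lower: "c n \<le> Q 1 u" if "u \<in> C n" for u n
    unfolding c_def using that by (intro cINF_lower bb)
  have "\<exists>u\<in>C n. Q 1 u < c n + 1 / Suc n" for n
    using cINF_less_iff[OF _ bb[of n], of "c n + 1 / Suc n"] bdd[of n] unfolding c_def by fastforce
  then obtain u where u: "\<And>n. u n \<in> C n" "\<And>n. Q 1 (u n) < c n + 1 / Suc n" by metis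
  have uD: "u n \<in> D" for n using u(1) sub by blast
  have "c n \<le> c k" if "n \<le> k" for n k
    unfolding c_def using decseqD[OF dec that] u(1)[of k] by (intro cINF_superset_mono bb) auto
  then have inc: "incseq c" by (simp add: incseq_def)
  have "c n \<le> K" for n using bdd[of n] lower[of _ n] by force
  then obtain l where l: "c \<longlonglongrightarrow> l" using incseq_convergent[OF inc] by metis
  have cauchy: "Q 1 (\<lambda>x. u n x - u k x) \<le> 2 * (c k - c n) + 2 / Suc n + 2 / Suc k"
    if "n \<le> k" for n k
  proof -
    have "u k \<in> C n" using u(1) decseqD[OF dec that] by blast
    \<comment> \<open>The midpoint lies in \<open>C n\<close> as well, so its energy is at least
      \<open>c n\<close>. With the parallelogram law the distance of \<open>u n\<close> and
      \<open>u k\<close> is controlled by the gap between the infima.\<close>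
    then have "c n \<le> Q 1 (\<lambda>x. (u n x + u k x) / 2)"
      by (intro lower mid u(1))
    then show ?thesis
      using B_parallelogram[OF uD uD, of 1 n k] u(2)[of n] u(2)[of k] by simp
  qed
  have "\<exists>N. \<forall>i\<ge>N. \<forall>j\<ge>N. Q 1 (\<lambda>x. u i x - u j x) < e" if e: "0 < e" for e
  proof -
    have "(\<lambda>n. 2 * (l - c n) + 4 * inverse (real (Suc n))) \<longlonglongrightarrow> 2 * (l - l) + 4 * 0"
      by (intro tendsto_intros l LIMSEQ_inverse_real_of_nat)
    then have "\<forall>\<^sub>F n in sequentially. 2 * (l - c n) + 4 * inverse (real (Suc n)) < e"
      using e by (intro order_tendstoD(2)[where a = e]) auto
    then obtain N where N: "2 * (l - c N) + 4 * inverse (real (Suc N)) < e"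
      by (auto simp: eventually_sequentially)
    have less: "Q 1 (\<lambda>x. u i x - u j x) < e" if "N \<le> i" "i \<le> j" for i j
    proof -
      have "c N \<le> c i" "c j \<le> l" using inc that(1) incseq_le[OF inc l] by (auto simp: incseq_def)
      moreover have "inverse (real (Suc i)) \<le> inverse (real (Suc N))" "inverse (real (Suc j))
          \<le> inverse (real (Suc N))"
        using that by (auto intro!: le_imp_inverse_le)
      ultimately have "2 * (c j - c i) + 2 * inverse (real (Suc i)) + 2 * inverse (real (Suc j))
          \<le> 2 * (l - c N) + 4 * inverse (real (Suc N))" by argo
      then show ?thesis
        using le_less_trans[OF order_trans[OF cauchy[OF that(2)], unfolded divide_inverse] N] by simp
    qed
    have "Q 1 (\<lambda>x. u i x - u j x) < e" if "N \<le> i" "N \<le> j" for i j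
    proof (cases "i \<le> j")
      case False
      then have "Q 1 (\<lambda>x. u j x - u i x) < e" using less that by simp
      then show ?thesis using uD by (simp add: B_quad_diff B_sym)
    qed (use less that in simp)
    then show ?thesis by blast
  qed
  then obtain v where v: "v \<in> D" "(\<lambda>n. Q 1 (\<lambda>x. u n x - v x)) \<longlonglongrightarrow> 0"
    using form_closed[of u] uD by blast
  show thesis
  proof (rule that[OF u(1) v])
    show "Q 1 (u n) \<le> Q 1 w + 1 / Suc n" if "w \<in> C n" for n w
      using u(2)[of n] lower[OF that] by simp
  qed
qed

lemma L2_mid_le:
  assumes "u \<in> L2_functions m" "v \<in> L2_functions m" "L2_sq m u \<le> K" "L2_sq m v \<le> K"
  shows "L2_sq m (\<lambda>x. (u x + v x) / 2) \<le> K"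
proof -
  have "L2_sq m (\<lambda>x. (u x + v x) / 2) \<le> (\<integral>x. (u x * u x + v x * v x) / 2 \<partial>m)"
    unfolding L2_inner_def
  proof (rule integral_mono)
    show "integrable m (\<lambda>x. (u x + v x) / 2 * ((u x + v x) / 2))"
      using L2_mult_integrable[OF L2_scale[OF L2_add[OF assms(1,2)], of "1/2"] L2_scale[OF L2_add[OF assms(1,2)], of "1/2"]]
      by simp
    show "integrable m (\<lambda>x. (u x * u x + v x * v x) / 2)"
      using assms by (simp add: L2_mult_integrable)
    fix x
    have "0 \<le> (u x - v x)\<^sup>2" by simp
    then show "(u x + v x) / 2 * ((u x + v x) / 2) \<le> (u x * u x + v x * v x) / 2"
      by (simp add: power2_eq_square algebra_simps)
  qed
  also have "\<dots> = (L2_sq m u + L2_sq m v) / 2"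
    using assms by (simp add: L2_inner_def L2_mult_integrable)
  finally show ?thesis using assms by simp
qed

text \<open>Approximants of energy at most K that come closer and closer to p form decreasing convex
  sets. Near-minimizers converge in \<open>Q 1\<close>, hence also in L2, so their limit equals p
  almost everywhere. This is lower semicontinuity of the energy in L2.\<close>

lemma domain_Fatou:
  assumes p: "p \<in> L2_functions m"
    and appr: "\<And>e. 0 < e \<Longrightarrow> \<exists>u\<in>D. Q 1 u
        \<le> K \<and> L2_sq m (\<lambda>x. u x - p x) \<le> e"
  shows "p \<in> D \<and> Q 1 p \<le> K"
proof -
  define C where "C n = {u \<in> D. Q 1 u \<le> K \<and> L2_sq m (\<lambda>x. u x - p x) \<le> 1 / Suc n}" for n :: nat
  have sub: "C n \<subseteq> D" for n by (auto simp: C_def)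
  have "1 / (1 + real k) \<le> 1 / (1 + real n)" if "n \<le> k" for n k
    using that by (simp add: frac_le)
  then have dec: "decseq C" unfolding decseq_def C_def by (auto intro: order_trans)
  have mid: "(\<lambda>x. (u x + v x) / 2) \<in> C n" if "u \<in> C n" "v \<in> C n" for u v n
  proof -
    have "L2_sq m (\<lambda>x. ((u x - p x) + (v x - p x)) / 2) \<le> 1 / Suc n"
      using that by (intro L2_mid_le L2_diff p D_L2) (auto simp: C_def)
    moreover have "(\<lambda>x. ((u x - p x) + (v x - p x)) / 2) = (\<lambda>x. (u x + v x) / 2 - p x)"
      by (simp add: fun_eq_iff field_simps)
    ultimately have "L2_sq m (\<lambda>x. (u x + v x) / 2 - p x) \<le> 1 / Suc n"
      by simp
    then show ?thesis
      using that unfolding C_def by (simp add: domain_mid B_mid_le)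
  qed
  have bdd: "\<exists>u\<in>C n. Q 1 u \<le> K" for n
    using appr[of "1 / Suc n"] by (auto simp: C_def)
  obtain u v where uv: "\<And>n. u n \<in> C n" "v \<in> D"
    "(\<lambda>n. Q 1 (\<lambda>x. u n x - v x)) \<longlonglongrightarrow> 0"
    by (rule minimizing_sequence[of C K, OF sub dec mid bdd]) blast+
  have uD: "u n \<in> D" for n using uv(1) sub by blast
  have "Q 1 v \<le> K"
    by (rule LIMSEQ_le_const2[OF B_tendsto(1)[OF uD uv(2,3)]]) (use uv(1) in \<open>auto simp: C_def\<close>)
  moreover have "AE x in m. v x = p x"
  proof (rule L2_limit_unique[of u])
    show "(\<lambda>n. L2_sq m (\<lambda>x. u n x - p x)) \<longlonglongrightarrow> 0"
      by (rule Lim_null_comparison[OF _ LIMSEQ_inverse_real_of_nat])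
        (use uv(1) in \<open>simp add: abs_of_nonneg L2_inner_nonneg C_def divide_inverse\<close>)
  qed (use uD uv D_L2 p B_tendsto(3) in auto)
  ultimately show ?thesis
    using domain_AE[OF uv(2)] L2_functionsD(1)[OF p] B_cong_AE2[OF uv(2), of p 1] by auto
qed

text \<open>Otherwise the functions violating the bound would form decreasing convex sets, and
  near-minimizers would converge in \<open>Q 1\<close> to a function that is 0 almost everywhere,
  while \<open>B 1 _ e\<close> stays at least c. So, on sets of bounded energy, a small L2 norm
  means weak smallness for \<open>B 1\<close>.\<close>

lemma B_small:
  assumes e: "e \<in> D" and c: "0 < c"
  obtains \<epsilon> where "0 < \<epsilon>"
    "\<And>u. u \<in> D \<Longrightarrow> Q 1 u \<le> K \<Longrightarrow> L2_sq m u \<le> \<epsilon>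
        \<Longrightarrow> B 1 u e < c"
proof (rule ccontr)
  assume neg: "\<not> thesis"
  define C where "C n = {u \<in> D. Q 1 u \<le> K \<and> L2_sq m u \<le> 1 / Suc n \<and> c \<le> B 1 u e}" for n :: nat
  have sub: "C n \<subseteq> D" for n by (auto simp: C_def)
  have "1 / (1 + real k) \<le> 1 / (1 + real n)" if "n \<le> k" for n k
    using that by (simp add: frac_le)
  then have dec: "decseq C" unfolding decseq_def C_def by (auto intro: order_trans)
  have mid: "(\<lambda>x. (u x + v x) / 2) \<in> C n" if "u \<in> C n" "v \<in> C n" for u v n
  proof -
    have "B 1 (\<lambda>x. 1/2 * (u x + v x)) e = 1/2 * (B 1 u e + B 1 v e)"
      using that e by (simp only: C_def mem_Collect_eq B_scale_left B_add_left domain_add)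
    then show ?thesis
      using that by (auto simp: C_def intro!: domain_mid B_mid_le L2_mid_le D_L2)
  qed
  have bdd: "\<exists>u\<in>C n. Q 1 u \<le> K" for n
  proof -
    have "\<not> (\<forall>u. u \<in> D \<longrightarrow> Q 1 u \<le> K \<longrightarrow> L2_sq m u
        \<le> 1 / Suc n \<longrightarrow> B 1 u e < c)"
      using neg that[of "1 / Suc n"] by auto
    then show ?thesis by (auto simp: C_def not_less)
  qed
  obtain u v where uv: "\<And>n. u n \<in> C n" "v \<in> D"
    "(\<lambda>n. Q 1 (\<lambda>x. u n x - v x)) \<longlonglongrightarrow> 0"
    by (rule minimizing_sequence[of C K, OF sub dec mid bdd]) blast+
  have uD: "u n \<in> D" for n using uv(1) sub by blast
  have "AE x in m. v x = 0"
  proof (rule L2_limit_unique[of u])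
    show "(\<lambda>n. L2_sq m (\<lambda>x. u n x - 0)) \<longlonglongrightarrow> 0"
      by (rule Lim_null_comparison[OF _ LIMSEQ_inverse_real_of_nat])
        (use uv(1) in \<open>simp add: abs_of_nonneg L2_inner_nonneg C_def divide_inverse\<close>)
  qed (use uD uv D_L2 domain_zero B_tendsto(3) in auto)
  then have "B 1 v e = B 1 (\<lambda>x. 0) e" by (intro B_cong_AE uv(2) domain_zero e)
  also have "\<dots> = 0" using B_scale_left[OF domain_zero e, of 1 0] by simp
  finally have "(\<lambda>n. B 1 (u n) e) \<longlonglongrightarrow> 0" using B_tendsto(2)[OF uD uv(2,3) e] by simp
  then have "\<forall>\<^sub>F n in sequentially. B 1 (u n) e < c" using c by (rule order_tendstoD(2))
  then obtain n where "B 1 (u n) e < c" by (auto simp: eventually_sequentially)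
  then show False using uv(1)[of n] by (simp add: C_def)
qed

lemma domain_truncate:
  assumes u: "u \<in> D"
  shows "(\<lambda>x. min (max (u x) 0) 1) \<in> D"
    and "0 \<le> \<alpha> \<Longrightarrow> B \<alpha> (\<lambda>x. min (max (u x) 0) 1) (\<lambda>x. min (max
        (u x) 0) 1) \<le> Q \<alpha> u"
proof -
  show t: "(\<lambda>x. min (max (u x) 0) 1) \<in> D" using form_markovian[OF u] by simp
  show "0 \<le> \<alpha> \<Longrightarrow> B \<alpha> (\<lambda>x. min (max (u x) 0) 1) (\<lambda>x. min (max
      (u x) 0) 1) \<le> Q \<alpha> u"
    unfolding form_shift_def
    using form_markovian[OF u] L2_inner_mono[OF D_L2[OF t] D_L2[OF u]]
    by (intro add_mono mult_left_mono) (auto simp: abs_real_def)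
qed

text \<open>First-order condition at a one-sided minimum: for small t the linear term decides the
  sign.\<close>

lemma linear_part_nonneg:
  fixes a b :: real
  assumes q: "\<And>t. 0 < t \<Longrightarrow> 0 \<le> 2 * t * a + t\<^sup>2 * b" and b: "0 \<le> b"
  shows "0 \<le> a"
proof (rule ccontr)
  assume neg: "\<not> 0 \<le> a"
  \<comment> \<open>Chosen so that \<open>t * (b + 1) = - a\<close>; the summand 1 covers b =
    0.\<close>
  define t where "t = - a / (b + 1)"
  have t: "0 < t" using neg b by (simp add: t_def field_simps)
  have "0 \<le> t * (2 * a + t * b)" using q[OF t] by (simp add: algebra_simps power2_eq_square)
  then have "0 \<le> 2 * a + t * b" using t by (simp add: zero_le_mult_iff)
  moreover have "t * b \<le> t * (b + 1)" using t by simp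
  moreover have "t * (b + 1) = - a" using b by (simp add: t_def)
  ultimately show False using neg by linarith
qed

lemma domain_truncate_at:
  assumes u: "u \<in> D" and k: "0 < k"
  shows "(\<lambda>x. min (max (u x) 0) k) \<in> D"
    and "0 \<le> \<alpha> \<Longrightarrow> B \<alpha> (\<lambda>x. min (max (u x) 0) k) (\<lambda>x. min (max
        (u x) 0) k) \<le> Q \<alpha> u"
proof -
  let ?v = "\<lambda>x. min (max (1 / k * u x) 0) 1"
  have eq: "(\<lambda>x. min (max (u x) 0) k) = (\<lambda>x. k * ?v x)"
    using k by (auto simp: fun_eq_iff min_def max_def field_simps)
  have uk: "(\<lambda>x. 1 / k * u x) \<in> D" by (rule domain_scale[OF u])
  have v: "?v \<in> D" by (rule domain_truncate[OF uk])
  then show "(\<lambda>x. min (max (u x) 0) k) \<in> D" unfolding eq by (rule domain_scale)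
  assume \<alpha>: "0 \<le> \<alpha>"
  have "Q \<alpha> (\<lambda>x. k * ?v x) = k\<^sup>2 * Q \<alpha> ?v"
    by (simp only: B_scale_left B_scale_right v domain_scale power2_eq_square mult.assoc)
  also have "\<dots> \<le> k\<^sup>2 * Q \<alpha> (\<lambda>x. 1 / k * u x)"
    by (intro mult_left_mono domain_truncate(2)[OF uk \<alpha>]) simp
  also have "\<dots> = k\<^sup>2 * (1 / k * (1 / k * Q \<alpha> u))"
    by (simp only: B_scale_left B_scale_right u domain_scale)
  also have "\<dots> = Q \<alpha> u" using k by (simp add: power2_eq_square)
  finally show "Q \<alpha> (\<lambda>x. min (max (u x) 0) k)
      \<le> Q \<alpha> u" unfolding eq .
qed

text \<open>Moving from \<open>min u k\<close> in the direction \<open>u - min u k\<close> does not change the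
    truncation at \<open>k\<close>.\<close>

lemma B_truncate_diff_nonneg:
  assumes u: "u \<in> D" "\<And>x. 0 \<le> u x" and k: "0 < k" and \<alpha>: "0 \<le> \<alpha>"
  shows "0 \<le> B \<alpha> (\<lambda>x. min (u x) k) (\<lambda>x. u x - min (u x) k)"
proof -
  let ?w = "\<lambda>x. min (u x) k" and ?\<phi> = "\<lambda>x. u x - min (u x) k"
  have "?w = (\<lambda>x. min (max (u x) 0) k)" using u(2) by (simp add: max_absorb1)
  then have w: "?w \<in> D" using domain_truncate_at(1)[OF u(1) k] by simp
  have \<phi>: "?\<phi> \<in> D" by (intro domain_diff u w)
  show ?thesis
  proof (rule linear_part_nonneg)
    fix t :: real assume t: "0 < t"
    have "(\<lambda>x. min (max (?w x + t * ?\<phi> x) 0) k) = ?w"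
    proof
      fix x
      show "min (max (?w x + t * ?\<phi> x) 0) k = ?w x"
      proof (cases "u x \<le> k")
        case False
        then have "0 < t * (u x - k)" using t by simp
        then show ?thesis using False k by (simp add: min_def max_def)
      qed (use u(2)[of x] in simp)
    qed
    then have "Q \<alpha> ?w \<le> Q \<alpha> (\<lambda>x. ?w x + t * ?\<phi> x)"
      using domain_truncate_at(2)[OF domain_add[OF w domain_scale[OF \<phi>, of t]] k \<alpha>] by simp
    then show "0 \<le> 2 * t * B \<alpha> ?w ?\<phi> + t\<^sup>2 * Q \<alpha> ?\<phi>"
      by (simp add: B_quad_add[OF w \<phi>])
  qed (rule B_nonneg[OF \<phi> \<alpha>])
qed

text \<open>A minimizer of \<open>Q 1\<close> exists in the convex class of functions that are at
  least 1 almost everywhere on U. Truncation to [0,1] does not raise its energy, and adding a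
  positive multiple of a nonnegative \<phi> stays in the class, so the first variation in direction
  \<phi> is nonnegative.\<close>

lemma equilibrium_potential:
  assumes "u \<in> D" "AE x in m. x \<in> U \<longrightarrow> 1 \<le> u x"
  obtains e where "e \<in> D" "\<And>x. 0 \<le> e x" "\<And>x. e x \<le> 1" "AE x in m. x \<in> U \<longrightarrow> e x = 1"
    "\<And>\<phi>. \<phi> \<in> D \<Longrightarrow> AE x in m. 0 \<le> \<phi> x \<Longrightarrow> 0 \<le> B 1 e \<phi>"
proof -
  define C where "C = {u \<in> D. AE x in m. x \<in> U \<longrightarrow> 1 \<le> u x}"
  have uC: "u \<in> C" using assms by (simp add: C_def)
  have mid: "(\<lambda>x. (u x + v x) / 2) \<in> C" if "u \<in> C" "v \<in> C" for u v
  proof -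
    have "AE x in m. x \<in> U \<longrightarrow> 1 \<le> u x" "AE x in m. x \<in> U \<longrightarrow> 1 \<le> v x"
      using that by (auto simp: C_def)
    then have "AE x in m. x \<in> U \<longrightarrow> 1 \<le> (u x + v x) / 2" by eventually_elim auto
    then show ?thesis using that by (auto simp: C_def intro!: domain_mid)
  qed
  obtain w v where w: "\<And>n. w n \<in> C" "v \<in> D"
    "(\<lambda>n. Q 1 (\<lambda>x. w n x - v x)) \<longlonglongrightarrow> 0"
    "\<And>n z. z \<in> C \<Longrightarrow> Q 1 (w n) \<le> Q 1 z + 1 / Suc n"
  proof (rule minimizing_sequence[of "\<lambda>n. C" "Q 1 u"])
    show "C \<subseteq> D" by (auto simp: C_def)
    show "\<exists>z\<in>C. Q 1 z \<le> Q 1 u" using uC by auto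
  qed (use mid in \<open>auto simp: decseq_def\<close>)
  have wD: "w n \<in> D" for n using w(1)[of n] by (simp add: C_def)
  have min: "Q 1 v \<le> Q 1 z" if "z \<in> C" for z
  proof (rule LIMSEQ_le[OF B_tendsto(1)[OF wD w(2,3)]])
    show "(\<lambda>n. Q 1 z + 1 / Suc n) \<longlonglongrightarrow> Q 1 z"
      using tendsto_add[OF tendsto_const LIMSEQ_inverse_real_of_nat, of "Q 1 z"] by (simp add: divide_inverse)
  qed (use w(4)[OF that] in auto)
  obtain s where s: "AE x in m. (\<lambda>n. w (s n) x) \<longlonglongrightarrow> v x"
    using L2_AE_subseq[OF D_L2[OF wD] D_L2[OF w(2)] B_tendsto(3)[OF wD w(2,3)]] by metis
  have "AE x in m. \<forall>n. x \<in> U \<longrightarrow> 1 \<le> w (s n) x"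
    unfolding AE_all_countable using w(1) by (simp add: C_def)
  with s have v1: "AE x in m. x \<in> U \<longrightarrow> 1 \<le> v x"
    by eventually_elim (auto intro: LIMSEQ_le_const)
  define e where "e x = min (max (v x) 0) 1" for x
  have e: "e \<in> D" "Q 1 e \<le> Q 1 v"
    using domain_truncate[OF w(2)] unfolding e_def by auto
  have e1: "AE x in m. x \<in> U \<longrightarrow> e x = 1"
    using v1 by eventually_elim (auto simp: e_def)
  show thesis
  proof (rule that[OF e(1) _ _ e1])
    fix \<phi> assume \<phi>: "\<phi> \<in> D" "AE x in m. 0 \<le> \<phi> x"
    have q: "0 \<le> 2 * t * B 1 e \<phi> + t\<^sup>2 * Q 1 \<phi>" if "0 < t" for t
    proof -
      have "AE x in m. x \<in> U \<longrightarrow> 1 \<le> e x + t * \<phi> x"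
        using e1 \<phi>(2) by eventually_elim (use that in auto)
      then have "(\<lambda>x. e x + t * \<phi> x) \<in> C"
        unfolding C_def using e(1) \<phi>(1) by (auto intro!: domain_add domain_scale)
      then have "Q 1 e \<le> Q 1 (\<lambda>x. e x + t * \<phi> x)"
        using min e(2) by fastforce
      then show ?thesis by (simp add: B_quad_add e(1) \<phi>(1))
    qed
    show "0 \<le> B 1 e \<phi>"
      by (rule linear_part_nonneg[OF q]) (use B_nonneg \<phi>(1) in auto)
  qed (auto simp: e_def)
qed

end

context symmetric_dirichlet_form
begin

lemma domain_sum: "finite S \<Longrightarrow> (\<And>i. i \<in> S \<Longrightarrow> f i \<in> D)
    \<Longrightarrow> (\<lambda>x. \<Sum>i\<in>S. f i x) \<in> D"
  by (induction S rule: finite_induct) (auto intro: domain_zero domain_add)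

lemma B_sum_le:
  assumes "finite S" "\<And>i. i \<in> S \<Longrightarrow> f i \<in> D" "0 \<le> \<alpha>"
  shows "sqrt (Q \<alpha> (\<lambda>x. \<Sum>i\<in>S. f i x))
      \<le> (\<Sum>i\<in>S. sqrt (Q \<alpha> (f i)))"
  using assms(1,2)
proof (induction S rule: finite_induct)
  case empty
  show ?case using B_scale_left[OF domain_zero domain_zero, of \<alpha> 0] by simp
next
  case (insert i S)
  have "sqrt (Q \<alpha> (\<lambda>x. f i x + (\<Sum>i\<in>S. f i x)))
      \<le> sqrt (Q \<alpha> (f i))
          + sqrt (Q \<alpha> (\<lambda>x. \<Sum>i\<in>S. f i x))"
    using insert by (intro B_triangle domain_sum assms(3)) auto
  also have "\<dots> \<le> sqrt (Q \<alpha> (f i)) + (\<Sum>i\<in>S. sqrt (Q \<alpha> (f i)))"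
    using insert by (intro add_left_mono) auto
  finally show ?case using insert by simp
qed

end

section \<open>The capacity of the form \<open>\<E>\<^sub>1\<close>\<close>

context potential_setting
begin

lemma sets_m [measurable_cong, simp]: "sets m = sets borel"
  using radon by (simp add: radon_full_support_def)

lemma space_m [simp]: "space m = UNIV"
  using sets_eq_imp_space_eq[OF sets_m] by simp

text \<open>The open neighbourhood and the bounds 0 and 1 are built into the test functions. Thus
  \<open>cap1\<close> is defined for all sets in one step, is outer regular by construction, and is
  bounded from above by exhibiting a single function.\<close>

definition admissible :: "'a set \<Rightarrow> ('a \<Rightarrow> real) set" where
  "admissible A = {u \<in> D. (\<forall>x. 0 \<le> u x \<and> u x \<le> 1) \<and>
     (\<exists>U. open U \<and> A \<subseteq> U \<and> (AE x in m. x \<in> U \<longrightarrow> u x = 1))}"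

definition cap1 :: "'a set \<Rightarrow> ennreal" where
  "cap1 A = (INF u\<in>admissible A. ennreal (Q 1 u))"

lemma cap1_le: "u \<in> admissible A \<Longrightarrow> cap1 A \<le> ennreal (Q 1 u)"
  unfolding cap1_def by (rule INF_lower)

lemma admissible_antimono: "A \<subseteq> A' \<Longrightarrow> admissible A' \<subseteq> admissible A"
  unfolding admissible_def by blast

lemma cap1_mono: "A \<subseteq> A' \<Longrightarrow> cap1 A \<le> cap1 A'"
  unfolding cap1_def using admissible_antimono by (intro INF_superset_mono) auto

lemma capacity_le_cap1: "capacity m D \<E> A \<le> cap1 A"
  unfolding cap1_def
proof (rule INF_greatest)
  fix u assume "u \<in> admissible A"
  then obtain U where U: "u \<in> D" "\<And>x. 0
      \<le> u x" "open U" "A \<subseteq> U" "AE x in m. x \<in> U \<longrightarrow> u x = 1"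
    by (auto simp: admissible_def)
  from U(5) have "AE x in m. indicator U x \<le> u x"
    by eventually_elim (use U(2) in \<open>auto simp: indicator_def\<close>)
  then have "open_capacity m D \<E> U \<le> ennreal (\<E> u u)"
    unfolding open_capacity_def using U(1) by (intro INF_lower) auto
  also have "\<dots> \<le> ennreal (Q 1 u)" using form_le_B[OF U(1), of 1] by (simp add: ennreal_leI)
  finally show "capacity m D \<E> A \<le> ennreal (Q 1 u)"
    unfolding capacity_def using U(3,4) by (intro INF_lower2[of U]) auto
qed

lemma cap1_outer: "(INF U\<in>{U. open U \<and> A \<subseteq> U}. cap1 U) \<le> cap1 A"
  unfolding cap1_def[of A]
proof (rule INF_greatest)
  fix u assume "u \<in> admissible A"
  then obtain U where "open U" "A \<subseteq> U" "u \<in> admissible U"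
    unfolding admissible_def by blast
  then show "(INF U\<in>{U. open U \<and> A \<subseteq> U}. cap1 U) \<le> ennreal (Q 1 u)"
    by (intro INF_lower2[of U] cap1_le) auto
qed

text \<open>
  If \<open>u j\<close> is nearly optimal for \<open>A j\<close> and converges to \<open>v\<close>, then
  \<open>u 0 + (\<Sum>j. (u (j + 1) - u j)\<^sup>+)\<close> dominates every \<open>u j\<close>, at little extra cost.
\<close>

lemma dominating_function:
  assumes u: "\<And>j :: nat. u j \<in> D" "\<And>j x. 0 \<le> u j x" "\<And>j x. u j x \<le> 1" and v: "v \<in> D"
    and close: "\<And>j. sqrt (Q 1 (\<lambda>x. u j x - v x)) \<le> \<delta> * (1/2) ^ j" and \<delta>: "0 < \<delta>"
  obtains z where "z \<in> D" "\<And>j. AE x in m. u j x \<le> z x" "sqrt (Q 1 z) \<le> sqrt (Q 1 v) + 5 * \<delta>"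
proof -
  \<comment> \<open>Differences of functions with values in [0,1] are at most 1, so this is the
    positive part of the increment, in a form whose energy \<open>form_markovian\<close>
    controls.\<close>
  define d where "d j x = min (max (u (Suc j) x - u j x) 0) 1" for j x
  have d: "d j \<in> D" for j unfolding d_def by (intro domain_truncate domain_diff u)
  have d_ge: "u (Suc j) x - u j x \<le> d j x" "0 \<le> d j x" for j x
    using u(3)[of "Suc j" x] u(2)[of j x] by (auto simp: d_def)
  have d_norm: "sqrt (Q 1 (d j)) \<le> 2 * \<delta> * (1/2) ^ j" for j
  proof -
    have "sqrt (Q 1 (d j)) \<le> sqrt (Q 1 (\<lambda>x. u (Suc j) x - u j x))"
      unfolding d_def by (intro real_sqrt_le_mono domain_truncate domain_diff u) simp
    also have "\<dots> = sqrt (Q 1 (\<lambda>x. (u (Suc j) x - v x) + (v x - u j x)))"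
      by simp
    also have "\<dots> \<le> sqrt (Q 1 (\<lambda>x. u (Suc j) x - v x)) + sqrt (Q 1 (\<lambda>x. v x - u j x))"
      by (intro B_triangle domain_diff u v) simp
    also have "Q 1 (\<lambda>x. v x - u j x) = Q 1 (\<lambda>x. u j x - v x)"
      using u v by (simp add: B_quad_diff B_sym)
    also have "sqrt (Q 1 (\<lambda>x. u (Suc j) x - v x)) + sqrt (Q 1 (\<lambda>x. u j x - v x))
        \<le> \<delta> * (1/2) ^ Suc j + \<delta> * (1/2) ^ j"
      by (intro add_mono close)
    also have "\<dots> \<le> 2 * \<delta> * (1/2) ^ j" using \<delta> by simp
    finally show ?thesis .
  qed
  define w where "w n x = u 0 x + (\<Sum>j<n. d j x)" for n x
  have w: "w n \<in> D" for n unfolding w_def by (intro domain_add u domain_sum d) auto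
  have w_ge: "u i x \<le> w n x" if "i \<le> n" for i n x
  proof -
    have "u i x = u 0 x + (\<Sum>j<i. u (Suc j) x - u j x)" using sum_lessThan_telescope[of "\<lambda>j. u j x" i] by simp
    also have "\<dots> \<le> u 0 x + (\<Sum>j<i. d j x)" by (intro add_left_mono sum_mono d_ge)
    also have "\<dots> \<le> w n x" unfolding w_def using that d_ge(2) by (intro add_left_mono sum_mono2) auto
    finally show ?thesis .
  qed
  \<comment> \<open>Of the factor 5, one \<delta> pays for replacing v by \<open>u 0\<close>, and
    four pay for the geometric series with terms \<open>2 * \<delta> * (1/2) ^ j\<close>.\<close>
  define R where "R = sqrt (Q 1 v) + 5 * \<delta>"
  have R: "0 \<le> R" unfolding R_def using \<delta> B_nonneg[OF v] by simp
  have w_norm: "sqrt (Q 1 (w n)) \<le> R" for n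
  proof -
    have "sqrt (Q 1 (w n)) \<le> sqrt (Q 1 (u 0)) + sqrt (Q 1 (\<lambda>x. \<Sum>j<n. d j x))"
      unfolding w_def by (intro B_triangle u domain_sum d) auto
    also have "sqrt (Q 1 (\<lambda>x. \<Sum>j<n. d j x)) \<le> (\<Sum>j<n. sqrt (Q 1 (d j)))"
      by (intro B_sum_le d) auto
    also have "\<dots> \<le> (\<Sum>j<n. 2 * \<delta> * (1/2) ^ j)" by (intro sum_mono d_norm)
    also have "\<dots> = 2 * \<delta> * (\<Sum>j<n. (1/2) ^ j)" by (simp add: sum_distrib_left)
    also have "(\<Sum>j<n. (1/2 :: real) ^ j) \<le> 2" by (simp add: sum_gp_strict)
    also have "sqrt (Q 1 (u 0)) \<le> sqrt (Q 1 v) + \<delta>"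
      using B_triangle_diff[OF u(1)[of 0] v, of 1] close[of 0] by simp
    finally show ?thesis using \<delta> by (simp add: R_def)
  qed
  \<comment> \<open>Dominators of more and more of the \<open>u i\<close> within the energy bound.
    \<open>w n\<close> shows that each of these convex sets is nonempty, and near-minimizers
    converge to a common dominator.\<close>
  define C where "C n = {z \<in> D. Q 1 z \<le> R\<^sup>2 \<and> (\<forall>i\<le>n. AE x in m. u i x \<le> z x)}" for n
  have sub: "C n \<subseteq> D" for n by (auto simp: C_def)
  have dec: "decseq C" unfolding decseq_def C_def by auto
  have mid: "(\<lambda>x. (y x + z x) / 2) \<in> C n" if "y \<in> C n" "z \<in> C n" for y z n
  proof -
    have "AE x in m. u i x \<le> (y x + z x) / 2" if "i \<le> n" for i
    proof -
      have "AE x in m. u i x \<le> y x" "AE x in m. u i x \<le> z x"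
        using \<open>y \<in> C n\<close> \<open>z \<in> C n\<close> that by (auto simp: C_def)
      then show ?thesis by eventually_elim auto
    qed
    then show ?thesis using that unfolding C_def by (auto intro: domain_mid B_mid_le)
  qed
  have "w n \<in> C n" for n
    unfolding C_def using w w_ge sqrt_le_D[OF w_norm[of n]] by auto
  then have bdd: "\<exists>z\<in>C n. Q 1 z \<le> R\<^sup>2" for n unfolding C_def by blast
  obtain y z where yz: "\<And>n. y n \<in> C n" "z \<in> D"
    "(\<lambda>n. Q 1 (\<lambda>x. y n x - z x)) \<longlonglongrightarrow> 0"
    by (rule minimizing_sequence[of C "R\<^sup>2", OF sub dec mid bdd]) blast+
  have yD: "y n \<in> D" for n using yz(1) sub by blast
  have "Q 1 z \<le> R\<^sup>2"
    by (rule LIMSEQ_le_const2[OF B_tendsto(1)[OF yD yz(2,3)]]) (use yz(1) in \<open>auto simp: C_def\<close>)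
  then have "sqrt (Q 1 z) \<le> R" using R by (simp add: real_le_lsqrt B_nonneg yz)
  moreover have "AE x in m. u i x \<le> z x" for i
  proof -
    obtain s where s: "strict_mono s" "AE x in m. (\<lambda>n. y (s n) x) \<longlonglongrightarrow> z x"
      using L2_AE_subseq[OF D_L2[OF yD] D_L2[OF yz(2)] B_tendsto(3)[OF yD yz(2,3)]] by metis
    \<comment> \<open>\<open>y (s n)\<close> dominates \<open>u i\<close> as soon as
      \<open>i \<le> n\<close>, because \<open>n \<le> s n\<close>.\<close>
    have "AE x in m. \<forall>n\<ge>i. u i x \<le> y (s n) x"
    proof -
      have "AE x in m. n \<ge> i \<longrightarrow> u i x \<le> y (s n) x" for n
        using yz(1)[of "s n"] seq_suble[OF s(1), of n] by (cases "i \<le> n") (auto simp: C_def)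
      then show ?thesis by (simp add: AE_all_countable)
    qed
    with s(2) show ?thesis
      by eventually_elim (rule LIMSEQ_le_const, auto)
  qed
  ultimately show thesis using that[OF yz(2)] by (simp add: R_def)
qed

text \<open>Near-optimal functions for the sets \<open>A n\<close> converge in \<open>Q 1\<close> to
  some v whose energy is at most the supremum. But v need not equal 1 on an open set around the
  union. Therefore a fast subsequence is dominated by a single function, which is at least 1 almost
  everywhere on all the chosen neighbourhoods; its surplus energy is governed by \<delta>.\<close>

lemma cap1_continuous_below:
  fixes A :: "nat \<Rightarrow> 'a set"
  assumes A: "incseq A"
  shows "cap1 (\<Union>n. A n) \<le> (SUP n. cap1 (A n))"
proof (cases "(SUP n. cap1 (A n)) = \<infinity>")
  case False
  define K where "K = enn2real (SUP n. cap1 (A n))"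
  have K: "(SUP n. cap1 (A n)) = ennreal K" "0 \<le> K"
    unfolding K_def using False
    by (simp_all only: infinity_ennreal_def less_top ennreal_enn2real enn2real_nonneg)
  have A_le: "cap1 (A n) \<le> ennreal K" for n unfolding K(1)[symmetric] by (rule SUP_upper) simp
  have sub: "admissible (A n) \<subseteq> D" for n by (auto simp: admissible_def)
  have dec: "decseq (\<lambda>n. admissible (A n))"
    using A admissible_antimono by (auto simp: decseq_def incseq_def)
  have mid: "(\<lambda>x. (u x + v x) / 2) \<in> admissible (A n)" if uv: "u \<in> admissible (A n)" "v
      \<in> admissible (A n)" for u v n
  proof -
    obtain U V where UV: "open U" "A n \<subseteq> U" "AE x in m. x \<in> U \<longrightarrow> u x = 1"
      "open V" "A n \<subseteq> V" "AE x in m. x \<in> V \<longrightarrow> v x = 1"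
      using uv by (auto simp: admissible_def)
    have "AE x in m. x \<in> U \<inter> V \<longrightarrow> (u x + v x) / 2 = 1"
      using UV(3,6) by eventually_elim auto
    then have "\<exists>W. open W \<and> A n \<subseteq> W \<and> (AE x in m. x \<in> W \<longrightarrow> (u x
        + v x) / 2 = 1)"
      using UV by (intro exI[of _ "U \<inter> V"]) auto
    moreover have "0 \<le> (u x + v x) / 2 \<and> (u x + v x) / 2 \<le> 1" for x
    proof -
      have "0 \<le> u x" "u x \<le> 1" "0 \<le> v x" "v x \<le> 1" using uv by (auto simp: admissible_def)
      then show ?thesis by auto
    qed
    ultimately show ?thesis
      using uv by (auto simp: admissible_def domain_mid)
  qed
  have bdd: "\<exists>u\<in>admissible (A n). Q 1 u \<le> K + 1" for n
  proof -
    have "cap1 (A n) < ennreal (K + 1)"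
      using A_le[of n] K(2) by (meson ennreal_lessI le_less_trans less_add_one add_nonneg_pos zero_less_one)
    then obtain u where "u \<in> admissible (A n)" "ennreal (Q 1 u) < ennreal (K + 1)"
      unfolding cap1_def by (auto simp: INF_less_iff)
    then show ?thesis using K(2) B_nonneg[of u 1] sub[of n]
      by (auto simp: ennreal_less_iff simp del: ennreal_plus intro!: bexI[of _ u])
  qed
  obtain u v where uv: "\<And>n. u n \<in> admissible (A n)" "v \<in> D"
    "(\<lambda>n. Q 1 (\<lambda>x. u n x - v x)) \<longlonglongrightarrow> 0"
    "\<And>n w. w \<in> admissible (A n) \<Longrightarrow> Q 1 (u n) \<le> Q 1 w + 1 / Suc n"
    by (rule minimizing_sequence[of "\<lambda>n. admissible (A n)" "K + 1", OF sub dec mid bdd]) blast+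
  have uD: "u n \<in> D" for n using uv(1) sub by blast
  have "Q 1 (u n) \<le> K + 1 / Suc n" for n
  proof -
    have "ennreal (Q 1 (u n)) \<le> ennreal (Q 1 w) + ennreal (1 / Suc n)" if "w \<in> admissible (A n)" for w
      using uv(4)[OF that] B_nonneg[of w 1] that sub[of n] by (subst ennreal_plus[symmetric]) (auto intro!: ennreal_leI)
    then have "ennreal (Q 1 (u n)) - ennreal (1 / Suc n) \<le> cap1 (A n)"
      unfolding cap1_def by (intro INF_greatest) (simp add: ennreal_minus_le_iff add.commute)
    then have "ennreal (Q 1 (u n)) \<le> ennreal (1 / Suc n) + ennreal K"
      using A_le[of n] by (simp add: ennreal_minus_le_iff add_increasing2 order_trans[OF _ add_left_mono])
    then show ?thesis using K(2) by (simp add: ennreal_plus[symmetric] del: ennreal_plus)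
  qed
  moreover have "(\<lambda>n. K + 1 / Suc n) \<longlonglongrightarrow> K"
    using tendsto_add[OF tendsto_const LIMSEQ_inverse_real_of_nat, of K] by (simp add: divide_inverse)
  ultimately have vK: "Q 1 v \<le> K"
    using LIMSEQ_le[OF B_tendsto(1)[OF uD uv(2,3)]] by blast
  have key: "cap1 (\<Union>n. A n) \<le> ennreal ((sqrt K + 5 * \<delta>)\<^sup>2)" if \<delta>: "0 < \<delta>" for \<delta>
  proof -
    have "\<exists>n\<ge>j. sqrt (Q 1 (\<lambda>x. u n x - v x)) \<le> \<delta> * (1/2) ^ j" for j :: nat
    proof -
      have "(\<lambda>n. sqrt (Q 1 (\<lambda>x. u n x - v x))) \<longlonglongrightarrow> 0"
        using tendsto_real_sqrt[OF uv(3)] by simp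
      then have "\<forall>\<^sub>F n in sequentially. sqrt (Q 1 (\<lambda>x. u n x - v x)) < \<delta> * (1/2) ^ j"
        using \<delta> by (intro order_tendstoD(2)) auto
      then have "\<forall>\<^sub>F n in sequentially. j \<le> n \<and> sqrt (Q 1 (\<lambda>x. u n x - v x))
          \<le> \<delta> * (1/2) ^ j"
        using eventually_ge_at_top[of j] by eventually_elim auto
      then show ?thesis using eventually_happens by fastforce
    qed
    \<comment> \<open>Besides being fast, s satisfies \<open>j \<le> s j\<close>, so the sets
      \<open>A (s j)\<close> still exhaust the union.\<close>
    then obtain s where s: "\<And>j. j \<le> s j"
      "\<And>j. sqrt (Q 1 (\<lambda>x. u (s j) x - v x)) \<le> \<delta> * (1/2) ^ j" by metis
    obtain z where z: "z \<in> D" "\<And>j. AE x in m. u (s j) x \<le> z x" "sqrt (Q 1 z) \<le> sqrt (Q 1 v) + 5 * \<delta>"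
    proof (rule dominating_function[of "\<lambda>j. u (s j)" v \<delta>])
      show "0 \<le> u (s j) x" "u (s j) x \<le> 1" for j x using uv(1)[of "s j"] by (auto simp: admissible_def)
    qed (use uD uv(2) s(2) \<delta> that in auto)
    have "\<forall>j. \<exists>U. open U \<and> A (s j) \<subseteq> U \<and> (AE x in m. x
        \<in> U \<longrightarrow> u (s j) x = 1)"
      using uv(1) by (auto simp: admissible_def)
    then obtain U where U: "\<And>j. open (U j)" "\<And>j. A (s j) \<subseteq> U j" "\<And>j. AE x in m. x
        \<in> U j \<longrightarrow> u (s j) x = 1"
      by metis
    define y where "y x = min (max (z x) 0) 1" for x
    have y: "y \<in> D" "Q 1 y \<le> Q 1 z" unfolding y_def by (intro domain_truncate z(1); simp)+
    have "AE x in m. \<forall>j. x \<in> U j \<longrightarrow> u (s j) x = 1" "AE x in m. \<forall>j. u (s j) x \<le> z x"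
      unfolding AE_all_countable using U(3) z(2) by auto
    then have "AE x in m. x \<in> (\<Union>j. U j) \<longrightarrow> y x = 1"
    proof eventually_elim
      case (elim x)
      show ?case
      proof
        assume "x \<in> (\<Union>j. U j)"
        then obtain j where "u (s j) x = 1" using elim(1) by blast
        then show "y x = 1" using elim(2)[rule_format, of j] by (simp add: y_def)
      qed
    qed
    moreover have "(\<Union>n. A n) \<subseteq> (\<Union>j. U j)"
    proof -
      have "A j \<subseteq> U j" for j using A s(1)[of j] U(2)[of j] by (meson incseqD order_trans)
      then show ?thesis by blast
    qed
    ultimately have "y \<in> admissible (\<Union>n. A n)"
      unfolding admissible_def using y(1) U(1) by (auto simp: y_def intro!: exI[of _ "\<Union>j. U j"])
    then have "cap1 (\<Union>n. A n) \<le> ennreal (Q 1 y)" by (rule cap1_le)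
    also have "\<dots> \<le> ennreal ((sqrt K + 5 * \<delta>)\<^sup>2)"
    proof (rule ennreal_leI)
      have "sqrt (Q 1 y) \<le> sqrt (Q 1 z)" "sqrt (Q 1 v) \<le> sqrt K" using y vK by auto
      then have "sqrt (Q 1 y) \<le> sqrt K + 5 * \<delta>" using z(3) by linarith
      then show "Q 1 y \<le> (sqrt K + 5 * \<delta>)\<^sup>2" by (rule sqrt_le_D)
    qed
    finally show ?thesis .
  qed
  have "cap1 (\<Union>n. A n) \<le> ennreal ((sqrt K + 5 * 0)\<^sup>2)"
  proof (rule tendsto_lowerbound)
    show "((\<lambda>n. ennreal ((sqrt K
        + 5 * inverse (real (Suc n)))\<^sup>2)) \<longlongrightarrow> ennreal ((sqrt K + 5 * 0)\<^sup>2)) sequentially"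
      by (intro tendsto_ennrealI tendsto_intros LIMSEQ_inverse_real_of_nat)
  qed (auto intro!: always_eventually key)
  then show ?thesis using K by simp
next
  case True
  show ?thesis unfolding True infinity_ennreal_def by (rule top_greatest)
qed

lemma cap1_Borel_null:
  assumes "A \<in> sets borel" "\<And>K. compact K \<Longrightarrow> K \<subseteq> A \<Longrightarrow> cap1 K = 0"
  shows "cap1 A = 0"
proof (rule ccontr)
  assume "cap1 A \<noteq> 0"
  then have "0 < cap1 A" by (simp add: zero_less_iff_neq_zero)
  then obtain a where "0 < a" "a < cap1 A" using dense by blast
  then obtain K where "compact K" "K \<subseteq> A" "a \<le> cap1 K"
    using Borel_capacitable[OF locally_compact cap1_mono cap1_continuous_below cap1_outer assms(1)] by metis
  then show False using assms(2)[of K] \<open>0 < a\<close> by simp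
qed

text \<open>Regularity provides a function of the domain uniformly close to a bump around each
  point. Finitely many of them, truncated so as to be nonnegative, add up to a function that is at
  least 1 near K.\<close>

lemma compact_neighbourhood_domain:
  assumes "compact K"
  obtains V u where "open V" "K \<subseteq> V" "compact (closure V)" "u \<in> D" "\<And>x. x \<in> V
      \<Longrightarrow> 1 \<le> u x"
proof -
  have "\<forall>x :: 'a. \<exists>\<rho> f. 0
      < \<rho> \<and> f \<in> D \<and> compact (cball x \<rho>) \<and> (\<forall>y. 0
      \<le> f y) \<and> (\<forall>y\<in>ball x \<rho>. 1 \<le> f y)"
  proof
    fix x :: 'a
    show "\<exists>\<rho> f. 0 < \<rho> \<and> f \<in> D \<and> compact (cball x \<rho>) \<and> (\<forall>y. 0
        \<le> f y) \<and> (\<forall>y\<in>ball x \<rho>. 1 \<le> f y)"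
  proof -
    obtain U L where UL: "open U" "compact L" "x \<in> U" "U \<subseteq> L"
      using locally_compact unfolding locally_compact_space_def by simp blast
    obtain e where e: "e > 0" "cball x e \<subseteq> U" using open_contains_cball UL(1,3) by blast
    have cpt: "compact S" if "closed S" "S \<subseteq> cball x e" for S
    proof -
      have "S = L \<inter> S" using that(2) e(2) UL(4) by blast
      then show ?thesis using compact_Int_closed[OF UL(2) that(1)] by simp
    qed
    \<comment> \<open>A tent that is at least 2 on the ball of radius \<open>e/2\<close> and
      vanishes at distance e and beyond: a uniform error below 1 leaves values above 1 on the
      smaller ball.\<close>
    define \<phi> where "\<phi> y = 2 * max 0 (2 - 2 * dist x y / e)" for y
    have "closure {y. \<phi> y \<noteq> 0} \<subseteq> cball x e"
    proof (intro closure_minimal subsetI)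
      fix y assume "y \<in> {y. \<phi> y \<noteq> 0}"
      then have "0 < 2 - 2 * dist x y / e" by (simp add: \<phi>_def max_def split: if_splits)
      then show "y \<in> cball x e" using e(1) by (simp add: field_simps)
    qed simp
    then have "compact (closure {y. \<phi> y \<noteq> 0})" by (intro cpt closed_closure)
    moreover have "continuous_on UNIV \<phi>"
      unfolding \<phi>_def using e(1) by (intro continuous_intros) auto
    ultimately have "\<phi> \<in> C_c" by (simp add: C_c_def)
    then obtain f where f: "f \<in> D" "\<And>y. \<bar>\<phi> y - f y\<bar> < 1"
      using regular unfolding regular_form_def by (metis IntD1 zero_less_one)
    have "1 \<le> min (max (f y) 0) 1" if "y \<in> ball x (e/2)" for y
    proof -
      have "2 \<le> \<phi> y" using that e(1) by (simp add: \<phi>_def field_simps)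
      then show ?thesis using f(2)[of y] by auto
    qed
    moreover have "compact (cball x (e/2))" using e(1) by (intro cpt) auto
    ultimately show ?thesis
      using e(1) domain_truncate(1)[OF f(1)]
      by (intro exI[of _ "e/2"] exI[of _ "\<lambda>y. min (max (f y) 0) 1"]) auto
    qed
  qed
  then obtain \<rho> where "\<forall>x :: 'a. \<exists>f. 0
      < \<rho> x \<and> f \<in> D \<and> compact (cball x (\<rho> x)) \<and> (\<forall>y. 0
      \<le> f y) \<and> (\<forall>y\<in>ball x (\<rho> x). 1 \<le> f y)"
    by (rule choice[THEN exE])
  then obtain f where "\<forall>x. 0
      < \<rho> x \<and> f x \<in> D \<and> compact (cball x (\<rho> x)) \<and> (\<forall>y. 0
      \<le> f x y) \<and> (\<forall>y\<in>ball x (\<rho> x). 1 \<le> f x y)"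
    by (rule choice[THEN exE])
  then have f: "\<And>x :: 'a. \<rho> x > 0" "\<And>x. f x \<in> D" "\<And>x. compact (cball x (\<rho> x))"
    "\<And>x y. 0 \<le> f x y" "\<And>x y. y \<in> ball x (\<rho> x) \<Longrightarrow> 1 \<le> f x y" by blast+
  obtain S where S: "finite S" "K \<subseteq> (\<Union>x\<in>S. ball x (\<rho> x))"
  proof (rule compactE_image[OF assms, of K "\<lambda>x. ball x (\<rho> x)"])
    show "K \<subseteq> (\<Union>x\<in>K. ball x (\<rho> x))" using f(1) by auto
  qed auto
  let ?V = "\<Union>x\<in>S. ball x (\<rho> x)"
  have c: "compact (\<Union>x\<in>S. cball x (\<rho> x))" using S(1) f(3) by (intro compact_UN) auto
  have "closure ?V \<subseteq> (\<Union>x\<in>S. cball x (\<rho> x))"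
    using compact_imp_closed[OF c] by (intro closure_minimal) auto
  then have "compact (closure ?V)"
    using compact_Int_closed[OF c closed_closure[of ?V]] by (metis inf.absorb_iff2)
  moreover have "1 \<le> (\<Sum>x\<in>S. f x y)" if y: "y \<in> ?V" for y
  proof -
    obtain x where "x \<in> S" "y \<in> ball x (\<rho> x)" using y by blast
    then show ?thesis using f(5)[of y x] member_le_sum[of x S "\<lambda>x. f x y"] f(4) S(1) by fastforce
  qed
  ultimately show thesis
    by (intro that[of ?V "\<lambda>y. \<Sum>x\<in>S. f x y"] S domain_sum f(2) open_UN) auto
qed

end

section \<open>Measurability for Hunt processes\<close>

lemma space_cemetery_borel [simp]: "space cemetery_borel = UNIV"
  by (simp add: cemetery_borel_def)

lemma sets_cemetery_borel: "sets cemetery_borel = sigma_sets UNIV ((`) Some ` sets borel)"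
  by (simp add: cemetery_borel_def)

lemma Some_image_cemetery: "A \<in> sets borel \<Longrightarrow> Some ` A \<in> sets cemetery_borel"
  by (simp add: sets_cemetery_borel)

lemma None_cemetery: "{None :: 'a :: topological_space option} \<in> sets cemetery_borel"
proof -
  have "UNIV - Some ` (UNIV :: 'a set) \<in> sets cemetery_borel"
    using sets.compl_sets[OF Some_image_cemetery[OF sets.top[of borel]]] by simp
  moreover have "UNIV - Some ` (UNIV :: 'a set) = {None}" by (auto simp: UNIV_option_conv)
  ultimately show ?thesis by simp
qed

lemma Some_measurable [measurable]: "Some \<in> borel \<rightarrow>\<^sub>M cemetery_borel"
  unfolding cemetery_borel_def
  by (rule measurable_measure_of) (auto simp: inj_vimage_image_eq)

lemma measurable_from_cemetery:
  assumes "(\<lambda>x. g (Some x)) \<in> borel \<rightarrow>\<^sub>M N" "g None \<in> space N"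
  shows "g \<in> cemetery_borel \<rightarrow>\<^sub>M N"
proof (rule measurableI)
  fix z show "g z \<in> space N"
    using assms(2) measurable_space[OF assms(1)] by (cases z) auto
next
  fix A assume A: "A \<in> sets N"
  have "g -` A \<inter> space cemetery_borel
      = Some ` ((\<lambda>x. g (Some x)) -` A) \<union> (if g None \<in> A then {None} else {})"
  proof (rule set_eqI)
    fix z show "z \<in> g -` A \<inter> space cemetery_borel \<longleftrightarrow>
        z \<in> Some ` ((\<lambda>x. g (Some x)) -` A) \<union> (if g None \<in> A then {None} else {})"
      by (cases z) auto
  qed
  then show "g -` A \<inter> space cemetery_borel \<in> sets cemetery_borel"
    using measurable_sets[OF assms(1) A]
    by (auto intro!: sets.Un None_cemetery Some_image_cemetery simp del: Un_insert_right)
qed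

lemma case_option_measurable [measurable]:
  fixes f :: "'a :: topological_space \<Rightarrow> ennreal"
  assumes "f \<in> borel_measurable borel"
  shows "case_option 0 f \<in> borel_measurable cemetery_borel"
  using assms by (intro measurable_from_cemetery) auto

lemma measurable_to_cemetery:
  fixes g :: "'b \<Rightarrow> 'a :: topological_space option"
  assumes "\<And>U. open U \<Longrightarrow> {x \<in> space N. g x \<in> Some ` U} \<in> sets N"
  shows "g \<in> N \<rightarrow>\<^sub>M cemetery_borel"
  unfolding cemetery_borel_def
proof (rule measurable_measure_of)
  fix S assume "S \<in> (`) Some ` sets (borel :: 'a measure)"
  then obtain B where B: "B \<in> sigma_sets UNIV {U :: 'a set. open U}" "S = Some ` B"
    by (auto simp: borel_def)
  from B(1) have "{x \<in> space N. g x \<in> Some ` B} \<in> sets N"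
  proof induction
    case (Basic U)
    then show ?case using assms by simp
  next
    case (Compl A)
    have "{x \<in> space N. g x \<in> Some ` (UNIV - A)} =
        {x \<in> space N. g x \<in> Some ` UNIV} - {x \<in> space N. g x \<in> Some ` A}" by auto
    then show ?case using Compl assms[OF open_UNIV] by simp
  next
    case (Union A)
    have "{x \<in> space N. g x \<in> Some ` (\<Union>i. A i)}
        = (\<Union>i. {x \<in> space N. g x \<in> Some ` A i})" by auto
    then show ?case using Union by simp
  qed simp
  moreover have "g -` S \<inter> space N = {x \<in> space N. g x \<in> Some ` B}" using B(2) by auto
  ultimately show "g -` S \<inter> space N \<in> sets N" by simp
qed auto

text \<open>The value exceeds t strictly, as limits along \<open>at_right\<close> require, and for
  fixed k it ranges over a countable set, as \<open>measurable_compose_countable\<close>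
  requires.\<close>

definition dyadic_above :: "nat \<Rightarrow> real \<Rightarrow> real" where
  "dyadic_above k t = (of_int \<lfloor>t * 2 ^ k\<rfloor> + 1) / 2 ^ k"

lemma dyadic_above_bounds: "t < dyadic_above k t" "dyadic_above k t \<le> t + (1/2) ^ k"
proof -
  have "t * 2 ^ k < of_int \<lfloor>t * 2 ^ k\<rfloor> + 1" "of_int \<lfloor>t * 2 ^ k\<rfloor> \<le> t * 2 ^ k" by linarith+
  then show "t < dyadic_above k t" "dyadic_above k t \<le> t + (1/2) ^ k"
    by (auto simp: dyadic_above_def field_simps)
qed

lemma dyadic_above_tendsto: "(\<lambda>k. dyadic_above k t) \<longlonglongrightarrow> t"
proof (rule tendsto_sandwich[where f = "\<lambda>_. t" and h = "\<lambda>k. t + (1/2) ^ k"])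
  have "(\<lambda>k. t + (1/2) ^ k) \<longlonglongrightarrow> t + 0"
    by (intro tendsto_intros LIMSEQ_realpow_zero) auto
  then show "(\<lambda>k. t + (1/2) ^ k) \<longlonglongrightarrow> t" by simp
qed (auto intro!: always_eventually less_imp_le dyadic_above_bounds)

lemma dyadic_above_at_right:
  assumes "0 \<le> t"
  shows "filterlim (\<lambda>k. ennreal (dyadic_above k t)) (at_right (ennreal t)) sequentially"
proof (rule tendsto_imp_filterlim_at_right)
  show "(\<lambda>k. ennreal (dyadic_above k t)) \<longlonglongrightarrow> ennreal t"
    by (intro tendsto_ennrealI dyadic_above_tendsto)
  show "\<forall>\<^sub>F k in sequentially. ennreal t < ennreal (dyadic_above k t)"
    using assms dyadic_above_bounds(1)[of t]
    by (intro always_eventually allI) (simp add: ennreal_less_iff)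
qed

text \<open>The approximations reach the value 1 on U after finitely many steps instead of merely
  converging to it, so that membership in U can be read off from \<open>f n x = 1\<close> for some
  n.\<close>

lemma open_exhaustion_continuous:
  fixes U :: "'a :: metric_space set"
  assumes "open U"
  obtains f :: "nat \<Rightarrow> 'a \<Rightarrow> real"
      where "\<And>n. continuous_on UNIV (f n)" "\<And>n x. 0 \<le> f n x" "\<And>n x. f n x \<le> 1"
    "incseq f" "\<And>n x. x \<notin> U \<Longrightarrow> f n x = 0" "\<And>x. x \<in> U
        \<Longrightarrow> \<forall>\<^sub>F n in sequentially. f n x = 1"
proof (cases "U = UNIV")
  case True
  show thesis by (rule that[of "\<lambda>_ _. 1"]) (use True in \<open>auto simp: incseq_def\<close>)
next
  case False
  show thesis
  proof (rule that[of "\<lambda>n x. min 1 (real n * infdist x (- U))"])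
    show "incseq (\<lambda>n x. min 1 (real n * infdist x (- U)))"
      by (auto simp: incseq_def le_fun_def infdist_nonneg intro!: min.coboundedI2 mult_right_mono)
    fix x assume "x \<in> U"
    then have "infdist x (- U) > 0"
      using in_closed_iff_infdist_zero[of "- U" x] assms False infdist_nonneg[of x "- U"]
      by (auto simp: closed_def order_less_le)
    then obtain N where N: "1 < real N * infdist x (- U)"
      using reals_Archimedean3 by blast
    have "min 1 (real n * infdist x (- U)) = 1" if "N \<le> n" for n
      using N mult_right_mono[of "real N" "real n" "infdist x (- U)"] that infdist_nonneg[of x "- U"] by auto
    then show "\<forall>\<^sub>F n in sequentially. min 1 (real n * infdist x (- U)) = 1"
      by (auto simp: eventually_sequentially)
  qed (auto intro!: continuous_intros simp: infdist_nonneg)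
qed

context hunt_process
begin

lemma right_cont_open:
  assumes "\<omega> \<in> space M" "t < \<infinity>" "X t \<omega> = Some x" "open U" "x \<in> U"
  shows "\<forall>\<^sub>F s in at_right t. X s \<omega> \<in> Some ` U"
proof -
  have "openin cemetery_topology (Some ` U)"
    using assms(4) unfolding cemetery_topology_def openin_Alexandroff_compactification by auto
  then show ?thesis
    using path_right_cont[OF assms(1,2)] assms(3,5) unfolding limitin_def by auto
qed

text \<open>Extended by 0, f may be discontinuous at the cemetery, since it need not vanish at
  infinity. This does no harm: the path is constant after reaching the cemetery.\<close>

lemma right_cont_function:
  fixes f :: "'a \<Rightarrow> real"
  assumes \<omega>: "\<omega> \<in> space M" and t: "t < \<infinity>" and f: "continuous_on UNIV f"
  shows "((\<lambda>s. case_option 0 f (X s \<omega>)) \<longlongrightarrow> case_option 0 f (X t \<omega>)) (at_right t)"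
proof (cases "X t \<omega>")
  case None
  then have "\<forall>\<^sub>F s in at_right t. case_option 0 f (X s \<omega>) = 0"
    using stays_dead[OF \<omega>] by (auto simp: eventually_at_filter intro!: always_eventually)
  then show ?thesis using None by (simp add: tendsto_eventually)
next
  case (Some x)
  show ?thesis
  proof (rule topological_tendstoI)
    fix S assume S: "open S" "case_option 0 f (X t \<omega>) \<in> S"
    have "\<forall>\<^sub>F s in at_right t. X s \<omega> \<in> Some ` (f -` S)"
      using S Some by (intro right_cont_open[OF \<omega> t Some] open_vimage f) auto
    then show "\<forall>\<^sub>F s in at_right t. case_option 0 f (X s \<omega>) \<in> S"
      by eventually_elim auto
  qed
qed

lemma X_measurable [measurable]: "X t \<in> M \<rightarrow>\<^sub>M cemetery_borel"
proof (rule measurableI)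
  fix A assume "A \<in> sets (cemetery_borel :: 'a option measure)"
  then have "X t -` A \<inter> space M \<in> sets (F t)" using measurable_sets[OF adapted] by (metis space_F)
  then show "X t -` A \<inter> space M \<in> sets M" using filtration_sub by blast
qed simp

lemma measurable_law: "measurable (P z) N = measurable M N"
  by (rule measurable_cong_sets[OF law_sets refl])

lemma space_law [simp]: "space (P z) = space M"
  using sets_eq_imp_space_eq[OF law_sets] .

text \<open>By right continuity a path alive at t stays alive for some time after t, so the infimum
  that defines the life time is strictly larger than t.\<close>

lemma alive_iff_life_time:
  assumes \<omega>: "\<omega> \<in> space M" and t: "t < \<infinity>"
  shows "t < life_time X \<omega> \<longleftrightarrow> X t \<omega> \<noteq> None"
proof
  assume "t < life_time X \<omega>"
  then show "X t \<omega> \<noteq> None"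
    unfolding life_time_def using Inf_lower[of t "{t. X t \<omega> = None}"] by (auto simp: not_le[symmetric])
next
  assume "X t \<omega> \<noteq> None"
  then obtain x where x: "X t \<omega> = Some x" by auto
  have "\<forall>\<^sub>F s in at_right t. X s \<omega> \<in> Some ` UNIV"
    using right_cont_open[OF \<omega> t x open_UNIV] by simp
  then obtain b where b: "t < b" "\<And>s. t < s \<Longrightarrow> s < b \<Longrightarrow> X s \<omega> \<in> Some ` UNIV"
    using t unfolding eventually_at_right[OF t] by blast
  obtain s where s: "t < s" "s < b" using dense[OF b(1)] by blast
  then have alive: "X s \<omega> \<noteq> None" using b(2)[of s] by auto
  have "s \<le> life_time X \<omega>"
    unfolding life_time_def
  proof (rule Inf_greatest)
    fix r assume "r \<in> {t. X t \<omega> = None}"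
    then have "\<not> r \<le> s" using stays_dead[OF \<omega>, of r s] alive by blast
    then show "s \<le> r" by simp
  qed
  then show "t < life_time X \<omega>" using s(1) by simp
qed

text \<open>For a continuous function of the position, right continuity exhibits the value at time t
  as a limit over dyadic times above t, and at each level only countably many times occur. Open sets
  follow through continuous approximations of their indicators.\<close>

lemma X_joint_measurable [measurable]:
  "(\<lambda>(t, \<omega>). X (ennreal t) \<omega>) \<in> borel \<Otimes>\<^sub>M M \<rightarrow>\<^sub>M cemetery_borel"
proof (rule measurable_to_cemetery)
  fix U :: "'a set" assume "open U"
  then obtain f :: "nat \<Rightarrow> 'a \<Rightarrow> real"
      where f: "\<And>n. continuous_on UNIV (f n)" "\<And>n x. 0 \<le> f n x" "\<And>n x. f n x \<le> 1"
    "incseq f" "\<And>n x. x \<notin> U \<Longrightarrow> f n x = 0" "\<And>x. x \<in> U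
        \<Longrightarrow> \<forall>\<^sub>F n in sequentially. f n x = 1"
    by (rule open_exhaustion_continuous) (rule that)
  have [measurable]: "f n \<in> borel_measurable borel" for n
    using f(1) by (rule borel_measurable_continuous_onI)
  define g where "g n = case_option 0 (f n)" for n
  have [measurable]: "g n \<in> borel_measurable cemetery_borel" for n
    unfolding g_def by (intro measurable_from_cemetery) auto
  have meas: "(\<lambda>(t, \<omega>). g n (X (ennreal t) \<omega>))
      \<in> borel_measurable (borel \<Otimes>\<^sub>M M)" for n
  proof (rule borel_measurable_LIMSEQ_real)
    \<comment> \<open>\<open>ennreal\<close> maps negative reals to 0, so replacing t by
      \<open>max 0 t\<close> changes nothing and brings \<open>dyadic_above_at_right\<close>, which
      is about nonnegative t, into reach.\<close>
    show "(\<lambda>k. case z of (t, \<omega>) \<Rightarrow> g n (X (ennreal (dyadic_above k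
        (max 0 t))) \<omega>)) \<longlonglongrightarrow> (case z of (t, \<omega>) \<Rightarrow> g n (X
        (ennreal t) \<omega>))"
      if "z \<in> space (borel \<Otimes>\<^sub>M M)" for z
    proof -
      obtain t \<omega> where z: "z = (t, \<omega>)" "\<omega> \<in> space M"
        using \<open>z \<in> _\<close> by (cases z) (auto simp: space_pair_measure)
      have "((\<lambda>k. g n (X (ennreal (dyadic_above k (max 0 t))) \<omega>)) \<longlongrightarrow> g n (X
          (ennreal (max 0 t)) \<omega>)) sequentially"
        unfolding g_def
        by (rule filterlim_compose[OF right_cont_function[OF z(2) _ f(1)] dyadic_above_at_right]) auto
      moreover have "ennreal (max 0 t) = ennreal t" by (simp add: max_def ennreal_neg)
      ultimately show ?thesis using z by simp
    qed
    fix k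
    have "(\<lambda>z. (\<lambda>i z. g n (X (ennreal ((of_int i
        + 1) / 2 ^ k)) (snd z))) ((\<lambda>z. \<lfloor>max 0 (fst z :: real) * 2 ^ k\<rfloor>) z) z)
        \<in> borel_measurable (borel \<Otimes>\<^sub>M M)"
      by (rule measurable_compose_countable[where g
          = "\<lambda>z. \<lfloor>max 0 (fst z :: real) * 2 ^ k\<rfloor>"]) measurable
    then show "(\<lambda>(t, \<omega>). g n (X (ennreal (dyadic_above k (max 0 t))) \<omega>))
        \<in> borel_measurable (borel \<Otimes>\<^sub>M M)"
      by (simp add: dyadic_above_def split_def)
  qed
  have "{z \<in> space (borel \<Otimes>\<^sub>M M). (case z of (t, \<omega>) \<Rightarrow> X (ennreal t) \<omega>)
      \<in> Some ` U} =
      (\<Union>n. {z \<in> space (borel \<Otimes>\<^sub>M M). (case z of (t, \<omega>) \<Rightarrow> g n (X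
          (ennreal t) \<omega>)) = 1})"
  proof -
    have "y \<in> Some ` U \<longleftrightarrow> (\<exists>n. g n y = 1)" for y
    proof
      assume "y \<in> Some ` U"
      then obtain x where "y = Some x" "x \<in> U" by auto
      then show "\<exists>n. g n y = 1" using eventually_happens[OF f(6)[of x]] by (auto simp: g_def)
    next
      assume "\<exists>n. g n y = 1"
      then show "y \<in> Some ` U" using f(5) by (cases y) (auto simp: g_def, metis image_eqI zero_neq_one)
    qed
    then show ?thesis by (auto simp: split_def)
  qed
  also have "\<dots> \<in> sets (borel \<Otimes>\<^sub>M M)"
    using meas by measurable
  finally show "{z \<in> space (borel \<Otimes>\<^sub>M M). (case z of (t, \<omega>) \<Rightarrow> X
      (ennreal t) \<omega>) \<in> Some ` U} \<in> sets (borel \<Otimes>\<^sub>M M)" .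
qed

lemma X_random_time_measurable:
  assumes [measurable]: "T \<in> borel_measurable M"
  shows "(\<lambda>\<omega>. X (T \<omega>) \<omega>) \<in> M \<rightarrow>\<^sub>M cemetery_borel"
proof -
  have [measurable]: "(\<lambda>\<omega>. X (ennreal (enn2real (T \<omega>))) \<omega>)
      \<in> M \<rightarrow>\<^sub>M cemetery_borel"
    using measurable_compose[OF _ X_joint_measurable, of "\<lambda>\<omega>. (enn2real (T \<omega>), \<omega>)" M] by simp
  have "(\<lambda>\<omega>. X (T \<omega>) \<omega>) \<in> M \<rightarrow>\<^sub>M cemetery_borel \<longleftrightarrow>
      (\<lambda>\<omega>. if T \<omega>
          < \<infinity> then X (ennreal (enn2real (T \<omega>))) \<omega> else None)
          \<in> M \<rightarrow>\<^sub>M cemetery_borel"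
    by (rule measurable_cong) (auto simp: less_top[symmetric] at_infinity_dead[unfolded infinity_ennreal_def])
  also have "\<dots>" by measurable
  finally show ?thesis .
qed

lemma law_function_measurable [measurable]:
  fixes f :: "'a option \<Rightarrow> ennreal"
  assumes f: "f \<in> borel_measurable cemetery_borel"
  shows "(\<lambda>z. \<integral>\<^sup>+\<omega>. f (X t \<omega>) \<partial>P z) \<in> borel_measurable cemetery_borel"
proof (rule measurable_from_cemetery)
  show "(\<lambda>x. \<integral>\<^sup>+\<omega>. f (X t \<omega>) \<partial>P (Some x)) \<in> borel_measurable borel"
    using f
  proof (induction rule: borel_measurable_induct)
    case (cong f g)
    then show ?case by (simp add: fun_eq_iff)
  next
    case (set A)
    have "(\<integral>\<^sup>+\<omega>. indicator A (X t \<omega>) \<partial>P (Some x))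
        = emeasure (P (Some x)) {\<omega> \<in> space M. X t \<omega> \<in> A}" for x
    proof -
      have "(\<integral>\<^sup>+\<omega>. indicator A (X t \<omega>) \<partial>P (Some x))
          = (\<integral>\<^sup>+\<omega>. indicator {\<omega> \<in> space M. X t \<omega>
          \<in> A} \<omega> \<partial>P (Some x))"
        by (intro nn_integral_cong) (auto simp: indicator_def)
      also have "\<dots> = emeasure (P (Some x)) {\<omega> \<in> space M. X t \<omega> \<in> A}"
        using set by (intro nn_integral_indicator) (simp add: law_sets)
      finally show ?thesis .
    qed
    then show ?case using law_measurable[OF set] by simp
  next
    case (mult f c)
    then have "(\<integral>\<^sup>+\<omega>. c * f (X t \<omega>) \<partial>P (Some x))
        = c * (\<integral>\<^sup>+\<omega>. f (X t \<omega>) \<partial>P (Some x))" for x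
      by (intro nn_integral_cmult) (simp add: measurable_law)
    then show ?case using mult by simp
  next
    case (add f g)
    then have "(\<integral>\<^sup>+\<omega>. g (X t \<omega>) + f (X t \<omega>) \<partial>P (Some x)) =
        (\<integral>\<^sup>+\<omega>. g (X t \<omega>) \<partial>P (Some x))
            + (\<integral>\<^sup>+\<omega>. f (X t \<omega>) \<partial>P (Some x))" for x
      by (intro nn_integral_add) (simp_all add: measurable_law)
    then show ?case using add by simp
  next
    case (seq u)
    have "(\<integral>\<^sup>+\<omega>. (SUP i. u i) (X t \<omega>) \<partial>P (Some x))
        = (SUP i. \<integral>\<^sup>+\<omega>. u i (X t \<omega>) \<partial>P (Some x))" for x
      unfolding SUP_apply using seq
      by (intro nn_integral_monotone_convergence_SUP) (auto simp: measurable_law incseq_def le_fun_def)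
    then show ?case using seq by simp
  qed
qed simp

lemma strong_markov_function:
  fixes f :: "'a option \<Rightarrow> ennreal"
  assumes T: "stopping_time F T" and A: "A \<in> sets (pre_sigma T)"
    and f: "f \<in> borel_measurable cemetery_borel"
  shows "(\<integral>\<^sup>+\<omega>. indicator A \<omega> * f (X (T \<omega> + s) \<omega>) \<partial>P z) =
    (\<integral>\<^sup>+\<omega>. indicator A \<omega> * (\<integral>\<^sup>+\<omega>'. f
        (X s \<omega>') \<partial>P (X (T \<omega>) \<omega>)) \<partial>P z)"
proof -
  have TM [measurable]: "T \<in> borel_measurable M"
    by (rule measurable_stopping_time[OF T filtration_sub space_F])
  have "{\<omega> \<in> A. T \<omega> \<le> \<infinity>} \<in> sets (F \<infinity>)" using sets_pre_sigmaD[OF T A] .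
  then have [measurable]: "A \<in> sets M" using filtration_sub by auto
  then have AM: "A \<subseteq> space M" by (rule sets.sets_into_space)
  have [measurable]: "(\<lambda>\<omega>. X (T \<omega> + s) \<omega>)
      \<in> M \<rightarrow>\<^sub>M cemetery_borel" "(\<lambda>\<omega>. X (T \<omega>) \<omega>)
      \<in> M \<rightarrow>\<^sub>M cemetery_borel"
    by (intro X_random_time_measurable, simp)+
  note [simp] = measurable_law law_sets
  have [measurable]: "(\<lambda>\<omega>. \<integral>\<^sup>+\<omega>'. g (X s \<omega>') \<partial>P (X
      (T \<omega>) \<omega>)) \<in> borel_measurable M"
    if "g \<in> borel_measurable cemetery_borel" for g :: "'a option \<Rightarrow> ennreal"
    by (rule measurable_compose[OF _ law_function_measurable[OF that]]) simp
  show ?thesis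
    using f
  proof (induction rule: borel_measurable_induct)
    case (cong f g)
    then show ?case by (simp add: fun_eq_iff)
  next
    case (set B)
    have "(\<integral>\<^sup>+\<omega>. indicator A \<omega> * indicator B (X (T \<omega> + s) \<omega>) \<partial>P z) =
        (\<integral>\<^sup>+\<omega>. indicator {\<omega> \<in> A. X (T \<omega> + s) \<omega>
            \<in> B} \<omega> \<partial>P z)"
      by (intro nn_integral_cong) (auto simp: indicator_def)
    also have "\<dots> = emeasure (P z) {\<omega> \<in> A. X (T \<omega> + s) \<omega> \<in> B}"
    proof (rule nn_integral_indicator)
      have "{\<omega> \<in> A. X (T \<omega> + s) \<omega> \<in> B}
          = A \<inter> {\<omega> \<in> space M. X (T \<omega> + s) \<omega> \<in> B}" using AM by auto
      also have "\<dots> \<in> sets M" using set by measurable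
      finally show "{\<omega> \<in> A. X (T \<omega> + s) \<omega> \<in> B} \<in> sets (P z)" by simp
    qed
    also have "\<dots> = (\<integral>\<^sup>+\<omega>\<in>A. emeasure (P (X (T \<omega>) \<omega>)) {\<omega>'
        \<in> space M. X s \<omega>' \<in> B} \<partial>P z)"
      by (rule strong_markov[OF T A set])
    also have "\<dots> = (\<integral>\<^sup>+\<omega>. indicator A \<omega> *
        (\<integral>\<^sup>+\<omega>'. indicator B (X s \<omega>') \<partial>P (X (T \<omega>) \<omega>)) \<partial>P z)"
    proof (intro nn_integral_cong)
      fix \<omega>
      have "(\<integral>\<^sup>+\<omega>'. indicator B (X s \<omega>') \<partial>P (X (T \<omega>) \<omega>)) =
          (\<integral>\<^sup>+\<omega>'. indicator {\<omega>' \<in> space M. X s \<omega>'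
              \<in> B} \<omega>' \<partial>P (X (T \<omega>) \<omega>))"
        by (intro nn_integral_cong) (auto simp: indicator_def)
      also have "\<dots> = emeasure (P (X (T \<omega>) \<omega>)) {\<omega>' \<in> space M. X s \<omega>' \<in> B}"
        using set by (intro nn_integral_indicator) simp
      finally show "emeasure (P (X (T \<omega>) \<omega>)) {\<omega>' \<in> space M. X s \<omega>'
          \<in> B} * indicator A \<omega> =
          indicator A \<omega> * (\<integral>\<^sup>+\<omega>'. indicator B (X s \<omega>') \<partial>P (X
              (T \<omega>) \<omega>))"
        by (simp add: mult.commute)
    qed
    finally show ?case .
  next
    case (mult f c)
    note [measurable] = mult(2)
    have "(\<integral>\<^sup>+\<omega>. indicator A \<omega> * (c * f (X (T \<omega>
        + s) \<omega>)) \<partial>P z)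
        = c * (\<integral>\<^sup>+\<omega>. indicator A \<omega> * f (X (T \<omega> + s) \<omega>) \<partial>P z)"
      by (subst nn_integral_cmult[symmetric]) (auto simp: mult.left_commute)
    moreover have "(\<integral>\<^sup>+\<omega>. indicator A \<omega> * (\<integral>\<^sup>+\<omega>'. c * f
        (X s \<omega>') \<partial>P (X (T \<omega>) \<omega>)) \<partial>P z) =
        c * (\<integral>\<^sup>+\<omega>. indicator A \<omega> * (\<integral>\<^sup>+\<omega>'. f
            (X s \<omega>') \<partial>P (X (T \<omega>) \<omega>)) \<partial>P z)"
      by (subst nn_integral_cmult[symmetric]) (auto simp: nn_integral_cmult mult.left_commute)
    ultimately show ?case using mult by simp
  next
    case (add f g)
    note [measurable] = add(1,3)
    show ?case
      using add by (simp add: nn_integral_add distrib_left)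
  next
    case (seq u)
    note [measurable] = seq(1)
    have inc: "incseq (\<lambda>i \<omega>. indicator A \<omega> * u i (X (T \<omega> + s) \<omega>))"
      "incseq (\<lambda>i \<omega>. u i (X s \<omega>))"
      "incseq (\<lambda>i \<omega>. indicator A \<omega> * (\<integral>\<^sup>+\<omega>'. u i
          (X s \<omega>') \<partial>P (X (T \<omega>) \<omega>)))"
      using seq(3) by (auto simp: incseq_def le_fun_def intro!: mult_left_mono nn_integral_mono)
    have "(\<integral>\<^sup>+\<omega>. indicator A \<omega> * (SUP i. u i) (X (T \<omega> + s) \<omega>) \<partial>P z) =
        (SUP i. \<integral>\<^sup>+\<omega>. indicator A \<omega> * u i (X (T \<omega> + s) \<omega>) \<partial>P z)"
      unfolding SUP_apply SUP_mult_left_ennreal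
      by (rule nn_integral_monotone_convergence_SUP[OF inc(1)]) simp
    also have "\<dots> = (SUP i. \<integral>\<^sup>+\<omega>. indicator A \<omega> *
        (\<integral>\<^sup>+\<omega>'. u i (X s \<omega>') \<partial>P (X (T \<omega>) \<omega>)) \<partial>P z)"
      using seq by simp
    also have "\<dots> = (\<integral>\<^sup>+\<omega>. (SUP i. indicator A \<omega> *
        (\<integral>\<^sup>+\<omega>'. u i (X s \<omega>') \<partial>P (X (T \<omega>) \<omega>))) \<partial>P z)"
      by (rule nn_integral_monotone_convergence_SUP[OF inc(3), symmetric]) simp
    also have "\<dots> = (\<integral>\<^sup>+\<omega>. indicator A \<omega> * (\<integral>\<^sup>+\<omega>'.
        (SUP i. u i) (X s \<omega>') \<partial>P (X (T \<omega>) \<omega>)) \<partial>P z)"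
      unfolding SUP_apply
      by (subst nn_integral_monotone_convergence_SUP[OF inc(2)]) (simp_all add: SUP_mult_left_ennreal)
    finally show ?case .
  qed
qed

end

section \<open>The transition semigroup and its resolvent\<close>

context hunt_process
begin

abbreviation p :: "real \<Rightarrow> ('a \<Rightarrow> ennreal) \<Rightarrow> 'a \<Rightarrow> ennreal" where
  "p \<equiv> transition P X"

abbreviation R :: "real \<Rightarrow> ('a \<Rightarrow> ennreal) \<Rightarrow> 'a \<Rightarrow> ennreal" where
  "R \<equiv> resolvent P X"

lemma emeasure_law_space [simp]: "emeasure (P z) (space M) = 1"
  using prob_space.emeasure_space_1[OF law_prob[of z]] by simp

lemma case_option_X_measurable [measurable]:
  assumes "f \<in> borel_measurable borel"
  shows "(\<lambda>\<omega>. case_option 0 f (X t \<omega>) :: ennreal) \<in> borel_measurable M"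
    "(\<lambda>\<omega>. case_option 0 f (X t \<omega>) :: ennreal) \<in> borel_measurable (P z)"
  unfolding measurable_law
  by (rule measurable_compose[OF X_measurable case_option_measurable[OF assms]])+

text \<open>Since \<open>case_option\<close> sends the cemetery to 0 and the cemetery is a trap, one
  formula covers all starting points. It matches the law \<open>P (X (T \<omega>) \<omega>)\<close>
  that the strong Markov property delivers.\<close>

lemma case_option_law:
  "case_option 0 (p t f) z = (\<integral>\<^sup>+\<omega>. case_option 0 f (X (ennreal t) \<omega>) \<partial>P z)"
proof (cases z)
  case None
  have "(\<integral>\<^sup>+\<omega>. case_option 0 f (X (ennreal t) \<omega>) \<partial>P None)
      = (\<integral>\<^sup>+\<omega>. 0 \<partial>P None)"
    by (intro nn_integral_cong_AE) (use trap[of "ennreal t"] in eventually_elim, simp)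
  then show ?thesis using None by simp
qed (simp add: transition_def)

lemma transition_measurable [measurable]:
  assumes "f \<in> borel_measurable borel"
  shows "p t f \<in> borel_measurable borel"
proof -
  have "(\<lambda>x. \<integral>\<^sup>+\<omega>. case_option 0 f (X (ennreal t) \<omega>) \<partial>P (Some x))
      \<in> borel_measurable borel"
    by (rule measurable_compose[OF Some_measurable law_function_measurable]) (use assms in measurable)
  then show ?thesis unfolding transition_def[abs_def] .
qed

lemma transition_mono:
  assumes "\<And>y. f y \<le> g y"
  shows "p t f x \<le> p t g x"
  unfolding transition_def using assms by (intro nn_integral_mono) (auto split: option.split)

lemma transition_add:
  assumes "f \<in> borel_measurable borel" "g \<in> borel_measurable borel"
  shows "p t (\<lambda>y. f y + g y) x = p t f x + p t g x"
proof -
  have "p t (\<lambda>y. f y + g y) x =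
      (\<integral>\<^sup>+\<omega>. case_option 0 f (X (ennreal t) \<omega>)
          + case_option 0 g (X (ennreal t) \<omega>) \<partial>P (Some x))"
    unfolding transition_def by (intro nn_integral_cong) (auto split: option.split)
  then show ?thesis using assms by (simp add: nn_integral_add transition_def)
qed

lemma transition_cmult:
  assumes "f \<in> borel_measurable borel"
  shows "p t (\<lambda>y. c * f y) x = c * p t f x"
proof -
  have "p t (\<lambda>y. c * f y) x
      = (\<integral>\<^sup>+\<omega>. c * case_option 0 f (X (ennreal t) \<omega>) \<partial>P (Some x))"
    unfolding transition_def by (intro nn_integral_cong) (auto split: option.split)
  then show ?thesis using assms by (simp add: nn_integral_cmult transition_def)
qed

lemma transition_SUP:
  assumes "\<And>n. f n \<in> borel_measurable borel" "incseq f"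
  shows "p t (\<lambda>y. SUP n. f n y) x = (SUP n. p t (f n) x)"
proof -
  have "p t (\<lambda>y. SUP n. f n y) x
      = (\<integral>\<^sup>+\<omega>. (SUP n. case_option 0 (f n) (X (ennreal t) \<omega>)) \<partial>P (Some x))"
    unfolding transition_def by (intro nn_integral_cong) (auto split: option.split)
  also have "\<dots> = (SUP n. p t (f n) x)"
    unfolding transition_def using assms
    by (intro nn_integral_monotone_convergence_SUP)
      (auto simp: incseq_def le_fun_def split: option.split)
  finally show ?thesis .
qed

lemma transition_liminf_le:
  assumes [measurable]: "\<And>n. f n \<in> borel_measurable borel"
  shows "p t (\<lambda>y. liminf (\<lambda>n. f n y)) x \<le> liminf (\<lambda>n. p t (f n) x)"
proof -
  have "p t (\<lambda>y. liminf (\<lambda>n. f n y)) x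
      = (\<integral>\<^sup>+\<omega>. liminf (\<lambda>n. case_option 0 (f n) (X
      (ennreal t) \<omega>)) \<partial>P (Some x))"
    unfolding transition_def by (intro nn_integral_cong) (auto split: option.split simp: Liminf_const)
  also have "\<dots> \<le> liminf (\<lambda>n. p t (f n) x)"
    unfolding transition_def by (rule nn_integral_liminf) measurable
  finally show ?thesis .
qed

lemma transition_le_1: "(\<And>y. f y \<le> 1) \<Longrightarrow> p t f x \<le> 1"
proof -
  assume f: "\<And>y. f y \<le> 1"
  have "p t f x \<le> (\<integral>\<^sup>+\<omega>. 1 \<partial>P (Some x))"
    unfolding transition_def using f by (intro nn_integral_mono) (auto split: option.split)
  then show ?thesis by simp
qed

lemma transition_0: "p 0 f x = f x"
proof -
  have "p 0 f x = (\<integral>\<^sup>+\<omega>. f x \<partial>P (Some x))"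
    unfolding transition_def
    by (intro nn_integral_cong_AE) (use normal[of "Some x"] in eventually_elim, simp)
  also have "\<dots> = f x * (\<integral>\<^sup>+\<omega>. 1 \<partial>P (Some x))"
    by simp
  finally show ?thesis by simp
qed

lemma markov:
  assumes T: "stopping_time F T" and A: "A \<in> sets (pre_sigma T)"
    and f: "f \<in> borel_measurable borel"
  shows "(\<integral>\<^sup>+\<omega>. indicator A \<omega> * case_option 0 f (X (T \<omega>
      + ennreal s) \<omega>) \<partial>P z) =
    (\<integral>\<^sup>+\<omega>. indicator A \<omega> * case_option 0 (p s f) (X (T \<omega>) \<omega>) \<partial>P z)"
  unfolding case_option_law by (rule strong_markov_function[OF T A case_option_measurable[OF f]])

lemma space_in_pre_sigma: "space M \<in> sets (pre_sigma T)"
  using sets.top[of "pre_sigma T"] by (simp add: space_pre_sigma)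

lemma transition_semigroup:
  assumes "f \<in> borel_measurable borel" "0 \<le> s" "0 \<le> t"
  shows "p s (p t f) x = p (s + t) f x"
proof -
  have ind: "(\<integral>\<^sup>+\<omega>. indicator (space M) \<omega> * g \<omega> \<partial>P (Some x))
      = (\<integral>\<^sup>+\<omega>. g \<omega> \<partial>P (Some x))" for g
    by (intro nn_integral_cong) simp
  show ?thesis
    using markov[OF stopping_time_const[of _ "ennreal s"] space_in_pre_sigma assms(1),
        where s = t and z = "Some x"] assms(2,3)
    by (simp add: ind transition_def ennreal_plus)
qed

text \<open>Measurability in t comes from the paths: for continuous functions right continuity
  yields dyadic limits. Open sets follow by monotone limits, Borel sets by a Dynkin system argument,
  and nonnegative functions by monotone approximation.\<close>

lemma law_joint_measurable:
  assumes "h \<in> borel_measurable borel"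
  shows "(\<lambda>(t, z). \<integral>\<^sup>+\<omega>. case_option 0 h (X (ennreal t) \<omega>) \<partial>P z)
      \<in> borel_measurable (borel \<Otimes>\<^sub>M cemetery_borel)"
proof -
  define G where "G h = (\<lambda>(t, z). \<integral>\<^sup>+\<omega>. case_option 0 h (X
      (ennreal t) \<omega>) \<partial>P z)" for h :: "'a \<Rightarrow> ennreal"
  have open_case: "G (indicator U) \<in> borel_measurable (borel \<Otimes>\<^sub>M cemetery_borel)" if "open U" for U
  proof -
    obtain f :: "nat \<Rightarrow> 'a \<Rightarrow> real"
        where f: "\<And>n. continuous_on UNIV (f n)" "\<And>n x. 0 \<le> f n x" "\<And>n x. f n x \<le> 1"
      "incseq f" "\<And>n x. x \<notin> U \<Longrightarrow> f n x = 0" "\<And>x. x \<in> U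
          \<Longrightarrow> \<forall>\<^sub>F n in sequentially. f n x = 1"
      using \<open>open U\<close> by (rule open_exhaustion_continuous) (rule that)
    have fm [measurable]: "f n \<in> borel_measurable borel" for n
      using f(1) by (rule borel_measurable_continuous_onI)
    have co: "case_option 0 (\<lambda>x. ennreal (f n x)) z = ennreal (case_option 0 (f n) z)" for n z
      by (cases z) auto
    have G_f: "G (\<lambda>x. ennreal (f n x)) \<in> borel_measurable (borel \<Otimes>\<^sub>M cemetery_borel)" for n
    proof (rule borel_measurable_LIMSEQ_order)
      fix k
      have "(\<lambda>y. (\<lambda>i y. \<integral>\<^sup>+\<omega>. case_option 0 (\<lambda>x. ennreal (f n x))
          (X (ennreal ((of_int i + 1) / 2 ^ k)) \<omega>) \<partial>P (snd y))
          ((\<lambda>y. \<lfloor>max 0 (fst y :: real) * 2 ^ k\<rfloor>) y) y)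
              \<in> borel_measurable (borel \<Otimes>\<^sub>M cemetery_borel)"
      proof (rule measurable_compose_countable[where g = "\<lambda>y. \<lfloor>max 0 (fst y :: real) * 2 ^ k\<rfloor>"])
        fix i :: int
        have "(\<lambda>z. \<integral>\<^sup>+\<omega>. case_option 0 (\<lambda>x. ennreal (f n x)) (X (ennreal
            ((of_int i + 1) / 2 ^ k)) \<omega>) \<partial>P z)
            \<in> borel_measurable cemetery_borel"
          by (rule law_function_measurable) measurable
        then show "(\<lambda>y. \<integral>\<^sup>+\<omega>. case_option 0 (\<lambda>x. ennreal (f n x)) (X
            (ennreal ((of_int i + 1) / 2 ^ k)) \<omega>) \<partial>P (snd y))
            \<in> borel_measurable (borel \<Otimes>\<^sub>M cemetery_borel)"
          by (rule measurable_compose[OF measurable_snd])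
      qed measurable
      then show "(\<lambda>(t, z). \<integral>\<^sup>+\<omega>. case_option 0 (\<lambda>x. ennreal (f n x)) (X
          (ennreal (dyadic_above k (max 0 t))) \<omega>) \<partial>P z)
          \<in> borel_measurable (borel \<Otimes>\<^sub>M cemetery_borel)"
        by (simp add: dyadic_above_def split_def)
    next
      fix y :: "real \<times> 'a option"
      obtain t z where y: "y = (t, z)" by (cases y)
      have "(\<lambda>k. \<integral>\<^sup>+\<omega>. case_option 0 (\<lambda>x. ennreal (f n x)) (X (ennreal
          (dyadic_above k (max 0 t))) \<omega>) \<partial>P z)
          \<longlonglongrightarrow> (\<integral>\<^sup>+\<omega>. case_option 0 (\<lambda>x. ennreal (f n x)) (X
              (ennreal (max 0 t)) \<omega>) \<partial>P z)"
      proof (rule nn_integral_dominated_convergence[where w = "\<lambda>_. 1"])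
        show "AE \<omega> in P z. (\<lambda>k. case_option 0 (\<lambda>x. ennreal (f n x)) (X (ennreal
            (dyadic_above k (max 0 t))) \<omega>))
            \<longlonglongrightarrow> case_option 0 (\<lambda>x. ennreal (f n x)) (X (ennreal (max 0 t)) \<omega>)"
        proof (rule AE_I2)
          fix \<omega> assume "\<omega> \<in> space (P z)"
          then have "\<omega> \<in> space M" by simp
          from right_cont_function[OF this _ f(1)[of n], of "ennreal (max 0 t)"]
          show "(\<lambda>k. case_option 0 (\<lambda>x. ennreal (f n x)) (X (ennreal (dyadic_above k (max 0 t))) \<omega>))
            \<longlonglongrightarrow> case_option 0 (\<lambda>x. ennreal (f n x)) (X (ennreal (max 0 t)) \<omega>)"
            unfolding co
            by (intro tendsto_ennrealI filterlim_compose[OF _ dyadic_above_at_right]) auto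
        qed
      qed (use f(3) in \<open>auto split: option.split\<close>)
      moreover have "ennreal (max 0 t) = ennreal t" by (simp add: max_def ennreal_neg)
      ultimately show "(\<lambda>k. case y of (t, z) \<Rightarrow> \<integral>\<^sup>+\<omega>. case_option 0
          (\<lambda>x. ennreal (f n x)) (X (ennreal (dyadic_above k (max 0 t))) \<omega>) \<partial>P z)
          \<longlonglongrightarrow> G (\<lambda>x. ennreal (f n x)) y"
        by (simp add: G_def y)
    qed
    have "(\<lambda>x. SUP n. ennreal (f n x)) = indicator U"
    proof
      fix x
      show "(SUP n. ennreal (f n x)) = indicator U x"
      proof (cases "x \<in> U")
        case True
        then obtain n where "f n x = 1" using eventually_happens[OF f(6)] by auto
        then show ?thesis
          using True f(3) by (intro antisym SUP_least SUP_upper2[of n]) (auto simp: ennreal_le_1)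
      qed (use f(5) in simp)
    qed
    moreover have "G (\<lambda>x. SUP n. ennreal (f n x)) = (\<lambda>y. SUP n. G (\<lambda>x. ennreal (f n x)) y)"
    proof
      fix y :: "real \<times> 'a option"
      obtain t z where y: "y = (t, z)" by (cases y)
      have "(\<integral>\<^sup>+\<omega>. case_option 0 (\<lambda>x. SUP n. ennreal (f n x)) (X
          (ennreal t) \<omega>) \<partial>P z) =
          (\<integral>\<^sup>+\<omega>. (SUP n. case_option 0 (\<lambda>x. ennreal (f n x)) (X
              (ennreal t) \<omega>)) \<partial>P z)"
        by (intro nn_integral_cong) (auto split: option.split)
      also have "\<dots> = (SUP n. \<integral>\<^sup>+\<omega>. case_option 0 (\<lambda>x. ennreal (f n x)) (X
          (ennreal t) \<omega>) \<partial>P z)"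
        using f(4) by (intro nn_integral_monotone_convergence_SUP)
          (auto simp: incseq_def le_fun_def ennreal_leI split: option.split)
      finally show "G (\<lambda>x. SUP n. ennreal (f n x)) y = (SUP n. G (\<lambda>x. ennreal (f n x)) y)"
        by (simp add: G_def y)
    qed
    ultimately show ?thesis using G_f by simp
  qed
  have set_case: "G (indicator A) \<in> borel_measurable (borel \<Otimes>\<^sub>M cemetery_borel)" if "A
      \<in> sets borel" for A
  proof -
    have "Int_stable {U :: 'a set. open U}" by (auto simp: Int_stable_def)
    moreover have "{U :: 'a set. open U} \<subseteq> Pow UNIV" by simp
    moreover have "A \<in> sigma_sets UNIV {U. open U}" using that by (simp add: borel_def)
    ultimately show ?thesis
    proof (induction rule: sigma_sets_induct_disjoint)
      case (basic A)
      then show ?case using open_case by simp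
    next
      case empty
      show ?case using open_case[OF open_empty] .
    next
      case (compl A)
      then have [measurable]: "A \<in> sets borel" by (simp add: borel_def)
      have "G (indicator (UNIV - A)) = (\<lambda>y. G (indicator UNIV) y - G (indicator A) y)"
      proof
        fix y :: "real \<times> 'a option"
        obtain t z where y: "y = (t, z)" by (cases y)
        \<comment> \<open>Finiteness lets complements become differences.\<close>
        have fin: "(\<integral>\<^sup>+\<omega>. case_option 0 (indicator A) (X
            (ennreal t) \<omega>) \<partial>P z) \<noteq> \<infinity>"
        proof -
          have "(\<integral>\<^sup>+\<omega>. case_option 0 (indicator A) (X (ennreal t) \<omega>) \<partial>P z)
              \<le> (\<integral>\<^sup>+\<omega>. 1 \<partial>P z)"
            by (intro nn_integral_mono) (auto split: option.split simp: indicator_def)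
          then show ?thesis by (auto simp: top_unique)
        qed
        have "(\<integral>\<^sup>+\<omega>. case_option 0 (indicator (UNIV - A)) (X (ennreal t) \<omega>) \<partial>P z) =
            (\<integral>\<^sup>+\<omega>. case_option 0 (indicator UNIV) (X (ennreal t) \<omega>) - case_option 0
                (indicator A) (X (ennreal t) \<omega>) \<partial>P z)"
          by (intro nn_integral_cong) (auto split: option.split simp: indicator_def)
        also have "\<dots> = (\<integral>\<^sup>+\<omega>. case_option 0 (indicator UNIV) (X
            (ennreal t) \<omega>) \<partial>P z) -
            (\<integral>\<^sup>+\<omega>. case_option 0 (indicator A) (X (ennreal t) \<omega>) \<partial>P z)"
          using fin by (intro nn_integral_diff) (auto split: option.split simp: indicator_def)
        finally show "G (indicator (UNIV - A)) y = G (indicator UNIV) y - G (indicator A) y"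
          by (simp only: G_def y prod.case)
      qed
      moreover have "G (indicator UNIV) \<in> borel_measurable (borel \<Otimes>\<^sub>M cemetery_borel)"
        by (rule open_case) simp
      ultimately show ?case using compl by simp
    next
      case (union A)
      then have [measurable]: "A i \<in> sets borel" for i by (auto simp: borel_def)
      have "G (indicator (\<Union>i. A i)) = (\<lambda>y. \<Sum>i. G (indicator (A i)) y)"
      proof
        fix y :: "real \<times> 'a option"
        obtain t z where y: "y = (t, z)" by (cases y)
        have "(\<integral>\<^sup>+\<omega>. case_option 0 (indicator (\<Union>i. A i)) (X
            (ennreal t) \<omega>) \<partial>P z) =
            (\<integral>\<^sup>+\<omega>. (\<Sum>i. case_option 0 (indicator (A i)) (X (ennreal t) \<omega>)) \<partial>P z)"
          using union(1) by (intro nn_integral_cong) (auto split: option.split simp: suminf_indicator)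
        also have "\<dots> = (\<Sum>i. \<integral>\<^sup>+\<omega>. case_option 0 (indicator (A i)) (X
            (ennreal t) \<omega>) \<partial>P z)"
          by (rule nn_integral_suminf) measurable
        finally show "G (indicator (\<Union>i. A i)) y = (\<Sum>i. G (indicator (A i)) y)" by (simp add: G_def y)
      qed
      then show ?case using union by simp
    qed
  qed
  have "G h \<in> borel_measurable (borel \<Otimes>\<^sub>M cemetery_borel)"
    using assms
  proof (induction rule: borel_measurable_induct)
    case (cong f g)
    then have "f = g" by (simp add: fun_eq_iff)
    then show ?case using cong by simp
  next
    case (set A)
    then show ?case by (rule set_case)
  next
    case (mult f c)
    note [measurable] = mult(2)
    have "G (\<lambda>x. c * f x) = (\<lambda>y. c * G f y)"
    proof
      fix y :: "real \<times> 'a option"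
      obtain t z where y: "y = (t, z)" by (cases y)
      have "(\<integral>\<^sup>+\<omega>. case_option 0 (\<lambda>x. c * f x) (X (ennreal t) \<omega>) \<partial>P z) =
          (\<integral>\<^sup>+\<omega>. c * case_option 0 f (X (ennreal t) \<omega>) \<partial>P z)"
        by (intro nn_integral_cong) (auto split: option.split)
      then show "G (\<lambda>x. c * f x) y = c * G f y" by (simp add: G_def y nn_integral_cmult)
    qed
    then show ?case using mult by simp
  next
    case (add f g)
    note [measurable] = add(1,3)
    have "G (\<lambda>x. g x + f x) = (\<lambda>y. G g y + G f y)"
    proof
      fix y :: "real \<times> 'a option"
      obtain t z where y: "y = (t, z)" by (cases y)
      have "(\<integral>\<^sup>+\<omega>. case_option 0 (\<lambda>x. g x + f x) (X (ennreal t) \<omega>) \<partial>P z) =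
          (\<integral>\<^sup>+\<omega>. case_option 0 g (X (ennreal t) \<omega>)
              + case_option 0 f (X (ennreal t) \<omega>) \<partial>P z)"
        by (intro nn_integral_cong) (auto split: option.split)
      then show "G (\<lambda>x. g x + f x) y = G g y + G f y" by (simp add: G_def y nn_integral_add)
    qed
    then show ?case using add by simp
  next
    case (seq u)
    note [measurable] = seq(1)
    have eq: "G (SUP i. u i) = (\<lambda>y. SUP i. G (u i) y)"
    proof
      fix y :: "real \<times> 'a option"
      obtain t z where y: "y = (t, z)" by (cases y)
      have "(\<integral>\<^sup>+\<omega>. case_option 0 (SUP i. u i) (X (ennreal t) \<omega>) \<partial>P z) =
          (\<integral>\<^sup>+\<omega>. (SUP i. case_option 0 (u i) (X (ennreal t) \<omega>)) \<partial>P z)"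
        unfolding SUP_apply by (intro nn_integral_cong) (simp split: option.split)
      also have "\<dots> = (SUP i. \<integral>\<^sup>+\<omega>. case_option 0 (u i) (X (ennreal t) \<omega>) \<partial>P z)"
        using seq(3) by (intro nn_integral_monotone_convergence_SUP)
          (auto simp: incseq_def le_fun_def split: option.split)
      finally show "G (SUP i. u i) y = (SUP i. G (u i) y)" by (simp add: G_def y)
    qed
    show ?case unfolding eq using seq by (intro borel_measurable_SUP) auto
  qed
  then show ?thesis by (simp add: G_def)
qed

lemma transition_joint_measurable:
  assumes "h \<in> borel_measurable borel"
  shows "(\<lambda>(t, x). p t h x) \<in> borel_measurable (borel \<Otimes>\<^sub>M borel)"
  using measurable_compose[OF _ law_joint_measurable[OF assms], of "\<lambda>(t, x). (t, Some x)"
      "borel \<Otimes>\<^sub>M borel"]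
  by (simp add: split_def transition_def)

text \<open>Being alive at t is the same as \<open>t < life_time X \<omega>\<close>, so the life
  time disappears into the value 0 at the cemetery, and Fubini exchanges time and
  expectation.\<close>

lemma resolvent_eq:
  assumes [measurable]: "h \<in> borel_measurable borel"
  shows "R \<alpha> h x = (\<integral>\<^sup>+t. indicator {0..} t * (ennreal (exp
      (- \<alpha> * t)) * p t h x) \<partial>lborel)"
proof -
  interpret prob_space "P (Some x)" by (rule law_prob)
  interpret pair_sigma_finite lborel "P (Some x)" ..
  have [measurable]: "(\<lambda>(t, \<omega>). case_option 0 h (X (ennreal t) \<omega>))
      \<in> borel_measurable (lborel \<Otimes>\<^sub>M P (Some x))"
  proof -
    have "(\<lambda>(t, \<omega>). case_option 0 h (X (ennreal t) \<omega>))
        \<in> borel_measurable (borel \<Otimes>\<^sub>M M)"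
      using measurable_compose[OF X_joint_measurable case_option_measurable[OF assms]] by (simp add: split_def)
    then show ?thesis
      by (subst measurable_cong_sets[OF sets_pair_measure_cong[OF sets_lborel law_sets] refl])
  qed
  have "R \<alpha> h x = (\<integral>\<^sup>+\<omega>. \<integral>\<^sup>+t. indicator {0..} t * (ennreal (exp
      (- \<alpha> * t)) * case_option 0 h (X (ennreal t) \<omega>)) \<partial>lborel \<partial>P (Some x))"
    unfolding resolvent_def
    by (intro nn_integral_cong)
      (auto simp: alive_iff_life_time indicator_def split: option.split)
  also have "\<dots> = (\<integral>\<^sup>+t. \<integral>\<^sup>+\<omega>. indicator {0..} t * (ennreal (exp
      (- \<alpha> * t)) * case_option 0 h (X (ennreal t) \<omega>)) \<partial>P (Some x) \<partial>lborel)"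
    by (rule Fubini') measurable
  also have "\<dots> = (\<integral>\<^sup>+t. indicator {0..} t * (ennreal (exp
      (- \<alpha> * t)) * p t h x) \<partial>lborel)"
    unfolding transition_def by (simp add: nn_integral_cmult)
  finally show ?thesis .
qed

lemma resolvent_measurable [measurable]:
  assumes "h \<in> borel_measurable borel"
  shows "R \<alpha> h \<in> borel_measurable borel"
proof -
  have [measurable]: "(\<lambda>(x, t). p t h x) \<in> borel_measurable (borel \<Otimes>\<^sub>M lborel)"
    using measurable_compose[OF measurable_pair_swap' transition_joint_measurable[OF assms]]
    by (simp add: split_def)
  have "(\<lambda>x. \<integral>\<^sup>+t. indicator {0..} t * (ennreal (exp
      (- \<alpha> * t)) * p t h x) \<partial>lborel) \<in> borel_measurable borel"
    by measurable
  then show ?thesis by (simp add: resolvent_eq[OF assms, abs_def])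
qed

lemma transition_time_measurable [measurable]:
  assumes "h \<in> borel_measurable borel"
  shows "(\<lambda>t. p t h x) \<in> borel_measurable borel"
  using measurable_compose[OF _ transition_joint_measurable[OF assms], of "\<lambda>t. (t, x)" borel] by simp

lemma expectation_resolvent:
  assumes h [measurable]: "h \<in> borel_measurable borel" and Y [measurable]: "Y
      \<in> M \<rightarrow>\<^sub>M cemetery_borel"
  shows "(\<integral>\<^sup>+\<omega>. case_option 0 (R \<beta> h) (Y \<omega>) \<partial>P z) =
    (\<integral>\<^sup>+t. indicator {0..} t * (ennreal (exp (- \<beta> * t)) *
        (\<integral>\<^sup>+\<omega>. case_option 0 (p t h) (Y \<omega>) \<partial>P z)) \<partial>lborel)"
proof -
  interpret prob_space "P z" by (rule law_prob)
  interpret pair_sigma_finite lborel "P z" ..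
  have Yz [measurable]: "Y \<in> P z \<rightarrow>\<^sub>M cemetery_borel" using Y by (simp add: measurable_law)
  have [measurable]: "(\<lambda>(t, \<omega>). case_option 0 (p t h) (Y \<omega>))
      \<in> borel_measurable (lborel \<Otimes>\<^sub>M P z)"
    unfolding case_option_law
    using measurable_compose[OF _ law_joint_measurable[OF h], of "\<lambda>(t, \<omega>). (t, Y \<omega>)"
        "lborel \<Otimes>\<^sub>M P z"]
    by (simp add: split_def)
  have "(\<integral>\<^sup>+\<omega>. case_option 0 (R \<beta> h) (Y \<omega>) \<partial>P z) =
      (\<integral>\<^sup>+\<omega>. \<integral>\<^sup>+t. indicator {0..} t * (ennreal (exp
          (- \<beta> * t)) * case_option 0 (p t h) (Y \<omega>)) \<partial>lborel \<partial>P z)"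
    by (intro nn_integral_cong) (auto simp: resolvent_eq[OF h] split: option.split)
  also have "\<dots> = (\<integral>\<^sup>+t. \<integral>\<^sup>+\<omega>. indicator {0..} t * (ennreal (exp
      (- \<beta> * t)) * case_option 0 (p t h) (Y \<omega>)) \<partial>P z \<partial>lborel)"
    by (rule Fubini') measurable
  also have "\<dots> = (\<integral>\<^sup>+t. indicator {0..} t * (ennreal (exp (- \<beta> * t)) *
      (\<integral>\<^sup>+\<omega>. case_option 0 (p t h) (Y \<omega>) \<partial>P z)) \<partial>lborel)"
  proof (intro nn_integral_cong)
    fix t :: real
    have "(\<lambda>\<omega>. case_option 0 (p t h) (Y \<omega>)) \<in> borel_measurable (P z)"
      by (rule measurable_compose[OF Yz case_option_measurable]) measurable
    then show "(\<integral>\<^sup>+\<omega>. indicator {0..} t * (ennreal (exp (- \<beta> * t)) * case_option 0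
        (p t h) (Y \<omega>)) \<partial>P z) =
        indicator {0..} t * (ennreal (exp (- \<beta> * t)) * (\<integral>\<^sup>+\<omega>. case_option 0 (p t h)
            (Y \<omega>) \<partial>P z))"
      by (simp add: nn_integral_cmult)
  qed
  finally show ?thesis .
qed

lemma transition_resolvent:
  assumes h [measurable]: "h \<in> borel_measurable borel" and s: "0 \<le> s"
  shows "p s (R \<beta> h) x = (\<integral>\<^sup>+t. indicator {0..} t * (ennreal (exp (- \<beta> * t)) * p (s
      + t) h x) \<partial>lborel)"
proof -
  have "p s (R \<beta> h) x = (\<integral>\<^sup>+\<omega>. case_option 0 (R \<beta> h) (X
      (ennreal s) \<omega>) \<partial>P (Some x))"
    by (simp add: transition_def)
  also have "\<dots> = (\<integral>\<^sup>+t. indicator {0..} t * (ennreal (exp (- \<beta> * t)) * p s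
      (p t h) x) \<partial>lborel)"
    by (subst expectation_resolvent[OF h X_measurable]) (simp add: transition_def)
  also have "\<dots> = (\<integral>\<^sup>+t. indicator {0..} t * (ennreal (exp (- \<beta> * t)) * p (s
      + t) h x) \<partial>lborel)"
    by (intro nn_integral_cong) (auto simp: indicator_def transition_semigroup[OF h s])
  finally show ?thesis .
qed

end

section \<open>Laplace transforms in time and identities for the resolvent\<close>

lemma nn_integral_exp_atLeast:
  assumes "0 < \<beta>"
  shows "(\<integral>\<^sup>+t. indicator {0..} t * ennreal (exp (- \<beta> * t)) \<partial>lborel) = ennreal (1 / \<beta>)"
proof -
  have "(\<integral>\<^sup>+t. ennreal (exp (- \<beta> * t)) * indicator {0..} t \<partial>lborel)
      = ennreal (0 - (- exp (- \<beta> * 0) / \<beta>))"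
  proof (rule nn_integral_FTC_atLeast)
    show "((\<lambda>t. - exp (- \<beta> * t) / \<beta>) \<longlongrightarrow> 0) at_top"
      using assms by real_asymp
  qed (use assms in \<open>auto intro!: derivative_eq_intros\<close>)
  then show ?thesis by (simp add: mult.commute)
qed

lemma nn_integral_exp_Icc:
  assumes "0 \<le> u" "c \<noteq> (0 :: real)"
  shows "(\<integral>\<^sup>+t. indicator {0..u} t * ennreal (exp (c * t)) \<partial>lborel)
      = ennreal ((exp (c * u) - 1) / c)"
proof -
  have "(\<integral>\<^sup>+t. ennreal (exp (c * t)) * indicator {0..u} t \<partial>lborel)
      = ennreal (exp (c * u) / c - exp (c * 0) / c)"
    by (rule nn_integral_FTC_Icc) (use assms in \<open>auto intro!: derivative_eq_intros\<close>)
  then show ?thesis by (simp add: mult.commute diff_divide_distrib)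
qed

lemma nn_integral_shift:
  fixes f :: "real \<Rightarrow> ennreal"
  assumes "f \<in> borel_measurable borel"
  shows "(\<integral>\<^sup>+t. f (s + t) \<partial>lborel) = (\<integral>\<^sup>+t. f t \<partial>lborel)"
  using nn_integral_real_affine[OF assms, of 1 s] by simp

context hunt_process
begin

lemma resolvent_mono: "(\<And>y. f y \<le> g y) \<Longrightarrow> R \<alpha> f x \<le> R \<alpha> g x"
  unfolding resolvent_def by (intro nn_integral_mono mult_right_mono mult_left_mono) auto

lemma resolvent_add:
  assumes [measurable]: "f \<in> borel_measurable borel" "g \<in> borel_measurable borel"
  shows "R \<alpha> (\<lambda>y. f y + g y) x = R \<alpha> f x + R \<alpha> g x"
  by (simp add: resolvent_eq transition_add distrib_left nn_integral_add)

lemma resolvent_cmult: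
  assumes [measurable]: "f \<in> borel_measurable borel"
  shows "R \<alpha> (\<lambda>y. c * f y) x = c * R \<alpha> f x"
proof -
  have "R \<alpha> (\<lambda>y. c * f y) x
      = (\<integral>\<^sup>+t. c * (indicator {0..} t * (ennreal (exp (- \<alpha> * t)) * p t f x)) \<partial>lborel)"
    by (simp add: resolvent_eq transition_cmult ac_simps)
  then show ?thesis by (simp add: resolvent_eq nn_integral_cmult)
qed

lemma resolvent_exp_antimono:
  assumes "\<alpha> \<le> \<beta>"
  shows "R \<beta> f x \<le> R \<alpha> f x"
  unfolding resolvent_def
proof (intro nn_integral_mono)
  fix \<omega> and t :: real
  show "ennreal (exp (- \<beta> * t)) * f (the (X (ennreal t) \<omega>)) * indicator {t. 0
      \<le> t \<and> ennreal t < life_time X \<omega>} t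
      \<le> ennreal (exp (- \<alpha> * t)) * f (the (X (ennreal t) \<omega>)) * indicator {t. 0
          \<le> t \<and> ennreal t < life_time X \<omega>} t"
    using assms by (cases "0 \<le> t") (auto intro!: mult_right_mono ennreal_leI)
qed

text \<open>A shift of time by s turns the left side into the part of the integral for
  \<open>R \<alpha> h x\<close> that belongs to times after s.\<close>

lemma transition_resolvent_le:
  assumes h [measurable]: "h \<in> borel_measurable borel" and s: "0 \<le> s" and \<alpha>: "0 \<le> \<alpha>"
  shows "ennreal (exp (- \<alpha> * s)) * p s (R \<alpha> h) x \<le> R \<alpha> h x"
proof -
  have "ennreal (exp (- \<alpha> * s)) * p s (R \<alpha> h) x =
      (\<integral>\<^sup>+t. ennreal (exp (- \<alpha> * s)) * (indicator {0..} t * (ennreal (exp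
          (- \<alpha> * t)) * p (s + t) h x)) \<partial>lborel)"
    by (simp add: transition_resolvent[OF h s] nn_integral_cmult)
  also have "\<dots> \<le> (\<integral>\<^sup>+t. indicator {0..} (s + t) * (ennreal (exp (- \<alpha> * (s
      + t))) * p (s + t) h x) \<partial>lborel)"
    using s by (intro nn_integral_mono)
      (auto simp: indicator_def distrib_left exp_add ennreal_mult mult.assoc exp_diff exp_minus divide_inverse)
  also have "\<dots> = (\<integral>\<^sup>+t. indicator {0..} t * (ennreal (exp
      (- \<alpha> * t)) * p t h x) \<partial>lborel)"
    by (rule nn_integral_shift[where f
        = "\<lambda>t. indicator {0..} t * (ennreal (exp (- \<alpha> * t)) * p t h x)"]) measurable
  also have "\<dots> = R \<alpha> h x" by (simp add: resolvent_eq)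
  finally show ?thesis .
qed

text \<open>With u = s + t the semigroup depends on u alone, and the exponentials collect into a
  scalar convolution weight. \<open>resolvent_commute\<close> and \<open>resolvent_identity\<close>
  become statements about this weight.\<close>

lemma resolvent_compose:
  assumes h [measurable]: "h \<in> borel_measurable borel"
  shows "R \<alpha> (R \<beta> h) x
      = (\<integral>\<^sup>+u. (\<integral>\<^sup>+s. indicator {0..u} s * ennreal (exp (- \<alpha> * s) * exp
      (- \<beta> * (u - s))) \<partial>lborel) * p u h x \<partial>lborel)"
proof -
  have "R \<alpha> (R \<beta> h) x = (\<integral>\<^sup>+s. indicator {0..} s * (ennreal (exp (- \<alpha> * s)) *
      (\<integral>\<^sup>+t. indicator {0..} t * (ennreal (exp (- \<beta> * t)) * p (s
          + t) h x) \<partial>lborel)) \<partial>lborel)"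
    by (simp add: resolvent_eq, intro nn_integral_cong) (auto simp: indicator_def transition_resolvent)
  also have "\<dots> = (\<integral>\<^sup>+s. \<integral>\<^sup>+u. indicator {0..u} s * ennreal (exp
      (- \<alpha> * s) * exp (- \<beta> * (u - s))) * p u h x \<partial>lborel \<partial>lborel)"
  proof (intro nn_integral_cong)
    fix s :: real
    let ?f = "\<lambda>u. indicator {0..} (u - s) * (ennreal (exp (- \<beta> * (u - s))) * p u h x)"
    have "(\<integral>\<^sup>+t. indicator {0..} t * (ennreal (exp (- \<beta> * t)) * p (s
        + t) h x) \<partial>lborel) = (\<integral>\<^sup>+t. ?f (s + t) \<partial>lborel)"
      by simp
    also have "\<dots> = (\<integral>\<^sup>+u. ?f u \<partial>lborel)" by (rule nn_integral_shift) measurable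
    finally have "indicator {0..} s * (ennreal (exp (- \<alpha> * s)) *
        (\<integral>\<^sup>+t. indicator {0..} t * (ennreal (exp (- \<beta> * t)) * p (s + t) h x) \<partial>lborel)) =
        (\<integral>\<^sup>+u. indicator {0..} s * ennreal (exp (- \<alpha> * s)) * ?f u \<partial>lborel)"
      by (simp add: nn_integral_cmult mult.assoc)
    also have "\<dots> = (\<integral>\<^sup>+u. indicator {0..u} s * ennreal (exp (- \<alpha> * s) * exp
        (- \<beta> * (u - s))) * p u h x \<partial>lborel)"
      by (intro nn_integral_cong) (auto simp: indicator_def ennreal_mult mult.assoc)
    finally show "indicator {0..} s * (ennreal (exp (- \<alpha> * s)) *
        (\<integral>\<^sup>+t. indicator {0..} t * (ennreal (exp (- \<beta> * t)) * p (s + t) h x) \<partial>lborel)) =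
        (\<integral>\<^sup>+u. indicator {0..u} s * ennreal (exp (- \<alpha> * s) * exp (- \<beta> *
            (u - s))) * p u h x \<partial>lborel)" .
  qed
  also have "\<dots> = (\<integral>\<^sup>+u. \<integral>\<^sup>+s. indicator {0..u} s * ennreal (exp
      (- \<alpha> * s) * exp (- \<beta> * (u - s))) * p u h x \<partial>lborel \<partial>lborel)"
  proof (rule lborel_pair.Fubini')
    have [measurable]: "Measurable.pred (borel \<Otimes>\<^sub>M borel) (\<lambda>z :: real \<times> real. 0
        \<le> snd z \<and> snd z \<le> fst z)"
      by measurable
    have "(\<lambda>z :: real \<times> real. (if 0 \<le> snd z \<and> snd z
        \<le> fst z then 1 else 0) * ennreal (exp (- \<alpha> * snd z) * exp (- \<beta> * (fst z - snd z))) * p (fst z) h x)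
        \<in> borel_measurable (borel \<Otimes>\<^sub>M borel)"
      by measurable
    then show "(\<lambda>(u, s). indicator {0..u} s * ennreal (exp (- \<alpha> * s) * exp (- \<beta> *
        (u - s))) * p u h x) \<in> borel_measurable (lborel \<Otimes>\<^sub>M lborel)"
      by (simp add: split_def indicator_def cong: measurable_cong_sets sets_pair_measure_cong)
  qed
  also have "\<dots> = (\<integral>\<^sup>+u. (\<integral>\<^sup>+s. indicator {0..u} s * ennreal (exp
      (- \<alpha> * s) * exp (- \<beta> * (u - s))) \<partial>lborel) * p u h x \<partial>lborel)"
    by (simp add: nn_integral_multc)
  finally show ?thesis .
qed

text \<open>The reflection of s to u - s interchanges the two exponents in the weight of
  \<open>resolvent_compose\<close>.\<close>

lemma resolvent_commute:
  assumes h: "h \<in> borel_measurable borel"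
  shows "R \<alpha> (R \<beta> h) x = R \<beta> (R \<alpha> h) x"
proof -
  have "(\<integral>\<^sup>+s. indicator {0..u} s * ennreal (exp (- \<alpha> * s) * exp (- \<beta> *
      (u - s))) \<partial>lborel) =
      (\<integral>\<^sup>+s. indicator {0..u} s * ennreal (exp (- \<beta> * s) * exp (- \<alpha> *
          (u - s))) \<partial>lborel)" for u
  proof -
    have "(\<integral>\<^sup>+s. indicator {0..u} s * ennreal (exp (- \<alpha> * s) * exp (- \<beta> *
        (u - s))) \<partial>lborel) =
        ennreal \<bar>-1\<bar> * (\<integral>\<^sup>+s. indicator {0..u} (u
            + -1 * s) * ennreal (exp (- \<alpha> * (u + -1 * s)) * exp (- \<beta> * (u - (u + -1 * s)))) \<partial>lborel)"
      by (rule nn_integral_real_affine) auto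
    also have "\<dots> = (\<integral>\<^sup>+s. indicator {0..u} s * ennreal (exp (- \<beta> * s) * exp
        (- \<alpha> * (u - s))) \<partial>lborel)"
      by (simp, intro nn_integral_cong) (auto simp: indicator_def mult.commute)
    finally show ?thesis .
  qed
  then show ?thesis by (simp add: resolvent_compose[OF h])
qed

text \<open>For u at least 0 the weight of \<open>resolvent_compose\<close> is \<open>(exp (-
  \<alpha> * u) - exp (- \<beta> * u)) / (\<beta> - \<alpha>)\<close>. The additive form avoids
  differences of resolvents, which are meaningless where both are infinite.\<close>

lemma resolvent_identity:
  assumes h [measurable]: "h \<in> borel_measurable borel" and "\<alpha> < \<beta>"
  shows "R \<alpha> h x = R \<beta> h x + ennreal (\<beta> - \<alpha>) * R \<alpha> (R \<beta> h) x"
proof -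
  have inner: "ennreal (\<beta> - \<alpha>) * (\<integral>\<^sup>+s. indicator {0..u} s * ennreal (exp
      (- \<alpha> * s) * exp (- \<beta> * (u - s))) \<partial>lborel) =
      indicator {0..} u * ennreal (exp (- \<alpha> * u) - exp (- \<beta> * u))" for u :: real
  proof (cases "0 \<le> u")
    case True
    have "(\<integral>\<^sup>+s. indicator {0..u} s * ennreal (exp (- \<alpha> * s) * exp (- \<beta> *
        (u - s))) \<partial>lborel) =
        (\<integral>\<^sup>+s. ennreal (exp (- \<beta> * u)) * (indicator {0..u} s * ennreal (exp
            ((\<beta> - \<alpha>) * s))) \<partial>lborel)"
    proof (intro nn_integral_cong)
      fix s :: real
      have "exp (- \<alpha> * s) * exp (- \<beta> * (u - s)) = exp (- \<beta> * u) * exp ((\<beta> - \<alpha>) * s)"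
        unfolding exp_add[symmetric] by (simp add: algebra_simps)
      then show "indicator {0..u} s * ennreal (exp (- \<alpha> * s) * exp (- \<beta> * (u - s))) =
          ennreal (exp (- \<beta> * u)) * (indicator {0..u} s * ennreal (exp ((\<beta> - \<alpha>) * s)))"
        by (simp add: ennreal_mult mult.left_commute)
    qed
    also have "\<dots> = ennreal (exp (- \<beta> * u)) * ennreal ((exp ((\<beta> - \<alpha>) * u) - 1) /
        (\<beta> - \<alpha>))"
      using assms(2) True by (simp add: nn_integral_cmult nn_integral_exp_Icc)
    also have "ennreal (\<beta> - \<alpha>) * \<dots>
        = ennreal ((\<beta> - \<alpha>) * (exp (- \<beta> * u) * ((exp ((\<beta> - \<alpha>) * u) - 1) /
        (\<beta> - \<alpha>))))"
      using assms(2) True by (simp add: ennreal_mult[symmetric])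
    also have "(\<beta> - \<alpha>) * (exp (- \<beta> * u) * ((exp ((\<beta> - \<alpha>) * u) - 1) /
        (\<beta> - \<alpha>))) = exp (- \<beta> * u) * (exp ((\<beta> - \<alpha>) * u) - 1)"
      using assms(2) by simp
    also have "\<dots> = exp (- \<beta> * u + (\<beta> - \<alpha>) * u) - exp (- \<beta> * u)"
      by (simp only: exp_add right_diff_distrib mult_1_right)
    also have "- \<beta> * u + (\<beta> - \<alpha>) * u = - \<alpha> * u" by (simp add: algebra_simps)
    finally show ?thesis using True by simp
  qed simp
  have "R \<beta> h x + ennreal (\<beta> - \<alpha>) * R \<alpha> (R \<beta> h) x =
      R \<beta> h x + (\<integral>\<^sup>+u. ennreal (\<beta> - \<alpha>) *
          (\<integral>\<^sup>+s. indicator {0..u} s * ennreal (exp (- \<alpha> * s) * exp (- \<beta> *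
          (u - s))) \<partial>lborel) * p u h x \<partial>lborel)"
  proof -
    have [measurable]: "(\<lambda>u :: real. (\<integral>\<^sup>+s. indicator {0..u} s * ennreal (exp
        (- \<alpha> * s) * exp (- \<beta> * (u - s))) \<partial>lborel)) \<in> borel_measurable borel"
    proof -
      have "(\<lambda>u :: real. ennreal (1 / (\<beta> - \<alpha>)) * (ennreal (\<beta> - \<alpha>) *
          (\<integral>\<^sup>+s. indicator {0..u} s * ennreal (exp (- \<alpha> * s) * exp (- \<beta> *
          (u - s))) \<partial>lborel))) \<in> borel_measurable borel"
        unfolding inner by measurable
      then show ?thesis
        using assms(2) by (simp add: mult.assoc[symmetric] ennreal_mult[symmetric])
    qed
    show ?thesis
      unfolding resolvent_compose[OF h] by (subst nn_integral_cmult[symmetric]) (measurable, simp add: mult.assoc)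
  qed
  also have "\<dots> = R \<beta> h x
      + (\<integral>\<^sup>+u. indicator {0..} u * ennreal (exp (- \<alpha> * u) - exp
      (- \<beta> * u)) * p u h x \<partial>lborel)"
    unfolding inner ..
  also have "\<dots> = (\<integral>\<^sup>+u. indicator {0..} u * (ennreal (exp (- \<beta> * u)) * p u h x)
      + indicator {0..} u * ennreal (exp (- \<alpha> * u) - exp (- \<beta> * u)) * p u h x \<partial>lborel)"
    by (simp add: resolvent_eq nn_integral_add)
  also have "\<dots> = R \<alpha> h x"
    unfolding resolvent_eq[OF h]
  proof (intro nn_integral_cong)
    fix u :: real
    show "indicator {0..} u * (ennreal (exp (- \<beta> * u)) * p u h x)
        + indicator {0..} u * ennreal (exp (- \<alpha> * u) - exp (- \<beta> * u)) * p u h x =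
        indicator {0..} u * (ennreal (exp (- \<alpha> * u)) * p u h x)"
    proof (cases "0 \<le> u")
      case True
      then have "exp (- \<beta> * u) \<le> exp (- \<alpha> * u)" using assms(2) by (simp add: mult_right_mono)
      then have "ennreal (exp (- \<beta> * u)) + ennreal (exp (- \<alpha> * u) - exp (- \<beta> * u))
          = ennreal (exp (- \<alpha> * u))"
        by (subst ennreal_plus[symmetric]) auto
      then show ?thesis using True by (simp add: distrib_right[symmetric])
    qed simp
  qed
  finally show ?thesis by simp
qed

text \<open>\<open>\<beta> * exp (- \<beta> * t)\<close> is a probability density on the half-line,
  so the left side is an average of values that are at most \<open>f x\<close>.\<close>

lemma resolvent_le:
  assumes f: "f \<in> borel_measurable borel" and "0 < \<beta>"
    and le: "\<And>t. 0 < t \<Longrightarrow> ennreal (exp (- \<alpha> * t)) * p t f x \<le> f x"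
  shows "ennreal \<beta> * R (\<beta> + \<alpha>) f x \<le> f x"
proof -
  have "R (\<beta> + \<alpha>) f x
      \<le> (\<integral>\<^sup>+t. indicator {0..} t * ennreal (exp (- \<beta> * t)) * f x \<partial>lborel)"
    unfolding resolvent_eq[OF f]
  proof (intro nn_integral_mono)
    fix t :: real
    show "indicator {0..} t * (ennreal (exp (- (\<beta> + \<alpha>) * t)) * p t f x)
        \<le> indicator {0..} t * ennreal (exp (- \<beta> * t)) * f x"
    proof (cases "0 \<le> t")
      case True
      have "ennreal (exp (- \<alpha> * t)) * p t f x \<le> f x"
        using le[of t] True by (cases "t = 0") (auto simp: transition_0)
      then have "ennreal (exp (- \<beta> * t)) * (ennreal (exp (- \<alpha> * t)) * p t f x)
          \<le> ennreal (exp (- \<beta> * t)) * f x"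
        by (rule mult_left_mono) simp
      moreover have "exp (- (\<beta> + \<alpha>) * t) = exp (- \<beta> * t) * exp (- \<alpha> * t)"
        unfolding exp_add[symmetric] by (simp add: algebra_simps)
      ultimately show ?thesis using True by (simp add: ennreal_mult mult.assoc)
    qed simp
  qed
  also have "\<dots> = ennreal (1 / \<beta>) * f x"
    using nn_integral_exp_atLeast[OF \<open>0 < \<beta>\<close>] by (simp add: nn_integral_multc)
  finally have "ennreal \<beta> * R (\<beta> + \<alpha>) f x \<le> ennreal \<beta> * (ennreal (1 / \<beta>) * f x)"
    by (rule mult_left_mono) simp
  also have "\<dots> = f x" using \<open>0 < \<beta>\<close> by (simp add: mult.assoc[symmetric] ennreal_mult[symmetric])
  finally show ?thesis .
qed

lemma resolvent_1_le: "0 < \<beta> \<Longrightarrow> ennreal \<beta> * R \<beta> (\<lambda>_. 1) x \<le> 1"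
  using resolvent_le[of "\<lambda>_. 1" \<beta> 0 x] transition_le_1[of "\<lambda>_. 1"] by simp

lemma resolvent_ge:
  assumes f: "f \<in> borel_measurable borel" and "0 < \<beta>" "0 \<le> t0"
    and ge: "\<And>t. 0 < t \<Longrightarrow> t < t0 \<Longrightarrow> c \<le> ennreal (exp (- \<alpha> * t)) * p t f x"
  shows "c * ennreal (1 - exp (- \<beta> * t0)) \<le> ennreal \<beta> * R (\<beta> + \<alpha>) f x"
proof -
  have "c * ennreal (1 - exp (- \<beta> * t0))
      = c * ennreal \<beta> * (\<integral>\<^sup>+t. indicator {0..t0} t * ennreal (exp (- \<beta> * t)) \<partial>lborel)"
  proof -
    have "(\<integral>\<^sup>+t. indicator {0..t0} t * ennreal (exp (- \<beta> * t)) \<partial>lborel)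
        = ennreal ((1 - exp (- \<beta> * t0)) / \<beta>)"
      using nn_integral_exp_Icc[OF \<open>0 \<le> t0\<close>, of "- \<beta>"] \<open>0 < \<beta>\<close>
      by (simp add: minus_divide_left)
    moreover have "ennreal \<beta> * ennreal ((1 - exp (- \<beta> * t0)) / \<beta>) = ennreal (1 - exp (- \<beta> * t0))"
      using \<open>0 < \<beta>\<close> \<open>0 \<le> t0\<close> by (subst ennreal_mult[symmetric]) auto
    ultimately show ?thesis by (simp add: mult.assoc)
  qed
  also have "\<dots> = ennreal \<beta> * (\<integral>\<^sup>+t. c * (indicator {0..t0} t * ennreal (exp
      (- \<beta> * t))) \<partial>lborel)"
    by (simp add: nn_integral_cmult mult.assoc mult.left_commute)
  also have "(\<integral>\<^sup>+t. c * (indicator {0..t0} t * ennreal (exp (- \<beta> * t))) \<partial>lborel)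
      \<le> R (\<beta> + \<alpha>) f x"
    unfolding resolvent_eq[OF f]
  proof (intro nn_integral_mono_AE)
    have "AE t in lborel. t \<noteq> 0" "AE t in lborel. t \<noteq> t0" by (rule AE_lborel_singleton)+
    then show "AE t in lborel. c * (indicator {0..t0} t * ennreal (exp (- \<beta> * t)))
        \<le> indicator {0..} t * (ennreal (exp (- (\<beta> + \<alpha>) * t)) * p t f x)"
    proof eventually_elim
      case (elim t)
      show ?case
      proof (cases "0 < t \<and> t < t0")
        case True
        have "exp (- (\<beta> + \<alpha>) * t) = exp (- \<beta> * t) * exp (- \<alpha> * t)"
          unfolding exp_add[symmetric] by (simp add: algebra_simps)
        then show ?thesis
          using mult_left_mono[OF ge[of t], of "ennreal (exp (- \<beta> * t))"] True
          by (simp add: ennreal_mult mult.assoc mult.commute[of c])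
      qed (use elim in \<open>auto simp: indicator_def\<close>)
    qed
  qed
  finally show ?thesis by (simp add: mult_left_mono)
qed

text \<open>The density \<open>n * exp (- n * t)\<close> concentrates at 0, so in the limit only
  times count at which the discounted semigroup is already above a given
  \<open>c < l\<close>.\<close>

lemma le_liminf_resolvent:
  assumes f: "f \<in> borel_measurable borel"
    and lim: "((\<lambda>t. ennreal (exp (- \<alpha> * t)) * p t f x) \<longlongrightarrow> l) (at_right 0)"
  shows "l \<le> liminf (\<lambda>n. ennreal (real n) * R (real n + \<alpha>) f x)"
proof (rule dense_le)
  fix c assume "c < l"
  then have "\<forall>\<^sub>F t in at_right 0. c < ennreal (exp (- \<alpha> * t)) * p t f x"
    using lim by (rule order_tendstoD(1)[rotated])
  then obtain t0 :: real where t0: "0 < t0" "\<And>t. 0 < t \<Longrightarrow> t < t0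
      \<Longrightarrow> c < ennreal (exp (- \<alpha> * t)) * p t f x"
    unfolding eventually_at_right_field by auto
  have "c * ennreal (1 - exp (- real n * t0)) \<le> ennreal (real n) * R (real n + \<alpha>) f x" if "0 < n" for n
    using t0 that by (intro resolvent_ge[OF f]) (auto intro: less_imp_le)
  then have "liminf (\<lambda>n. c * ennreal (1 - exp (- real n * t0)))
      \<le> liminf (\<lambda>n. ennreal (real n) * R (real n + \<alpha>) f x)"
    by (intro Liminf_mono eventually_mono[OF eventually_gt_at_top[of 0]]) auto
  moreover have "(\<lambda>n. c * ennreal (1 - exp (- real n * t0))) \<longlonglongrightarrow> c * ennreal (1 - 0)"
  proof (intro ennreal_tendsto_cmult tendsto_ennrealI tendsto_intros)
    show "c < \<top>" using \<open>c < l\<close> top_greatest by (rule order.strict_trans2)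
    show "(\<lambda>n. exp (- real n * t0)) \<longlonglongrightarrow> 0" using t0(1) by real_asymp
  qed
  ultimately show "c \<le> liminf (\<lambda>n. ennreal (real n) * R (real n + \<alpha>) f x)"
    by (simp add: lim_imp_Liminf)
qed

text \<open>By the strong Markov property the left side is the expected integral of h along the path
  from time T on, which is part of the integral over the whole path.\<close>

lemma stopped_resolvent_le:
  assumes h [measurable]: "h \<in> borel_measurable borel" and T: "stopping_time F T"
  shows "(\<integral>\<^sup>+\<omega>. case_option 0 (R 0 h) (X (T \<omega>) \<omega>) \<partial>P (Some x)) \<le> R 0 h x"
proof -
  interpret prob_space "P (Some x)" by (rule law_prob)
  interpret pair_sigma_finite lborel "P (Some x)" ..
  have TM [measurable]: "T \<in> borel_measurable M"
    by (rule measurable_stopping_time[OF T filtration_sub space_F])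
  define Z where "Z a \<omega> = case_option 0 h (X (ennreal a) \<omega>)" for a \<omega>
  have Zm: "(\<lambda>(t, \<omega>). Z t \<omega>) \<in> borel_measurable (borel \<Otimes>\<^sub>M M)"
    unfolding Z_def using measurable_compose[OF X_joint_measurable case_option_measurable[OF h]]
    by (simp add: split_def)
  have ZTm: "(\<lambda>(t, \<omega>). Z (enn2real (T \<omega>) + t) \<omega>)
      \<in> borel_measurable (borel \<Otimes>\<^sub>M M)"
    using measurable_compose[OF _ Zm, of "\<lambda>(t, \<omega>). (enn2real (T \<omega>)
        + t, \<omega>)" "borel \<Otimes>\<^sub>M M"]
    by (simp add: split_def)
  have sets_eq: "sets (lborel \<Otimes>\<^sub>M P (Some x)) = sets (borel \<Otimes>\<^sub>M M)"
    by (intro sets_pair_measure_cong sets_lborel law_sets)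
  \<comment> \<open>\<open>enn2real\<close> would turn \<open>T \<omega> = \<infinity>\<close> into
    0, so this case is given the value 0 by hand. That is the right value because the path is dead
    at \<infinity>.\<close>
  define W where "W = (\<lambda>(t, \<omega>). (if T \<omega>
      < \<infinity> then Z (enn2real (T \<omega>) + t) \<omega> else 0))"
  have Wm [measurable]: "W \<in> borel_measurable (borel \<Otimes>\<^sub>M M)"
  proof -
    have [measurable]: "Measurable.pred (borel \<Otimes>\<^sub>M M) (\<lambda>z :: real \<times> 'w. T (snd z)
        < \<infinity>)" by measurable
    show ?thesis unfolding W_def using ZTm by (simp add: split_def)
  qed
  have "(\<integral>\<^sup>+\<omega>. case_option 0 (R 0 h) (X (T \<omega>) \<omega>) \<partial>P (Some x)) =
      (\<integral>\<^sup>+t. indicator {0..} t * (\<integral>\<^sup>+\<omega>. case_option 0 (p t h) (X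
          (T \<omega>) \<omega>) \<partial>P (Some x)) \<partial>lborel)"
    by (subst expectation_resolvent[OF h X_random_time_measurable[OF TM]]) simp
  also have "\<dots> = (\<integral>\<^sup>+t. indicator {0..} t * (\<integral>\<^sup>+\<omega>. W
      (t, \<omega>) \<partial>P (Some x)) \<partial>lborel)"
  proof (intro nn_integral_cong)
    fix t :: real
    have ind: "(\<integral>\<^sup>+\<omega>. indicator (space M) \<omega> * g \<omega> \<partial>P (Some x))
        = (\<integral>\<^sup>+\<omega>. g \<omega> \<partial>P (Some x))" for g
      by (intro nn_integral_cong) simp
    have "(\<integral>\<^sup>+\<omega>. case_option 0 (p t h) (X (T \<omega>) \<omega>) \<partial>P (Some x))
        = (\<integral>\<^sup>+\<omega>. case_option 0 h (X (T \<omega> + ennreal t) \<omega>) \<partial>P (Some x))"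
      using markov[OF T space_in_pre_sigma h, where s = t and z = "Some x"] by (simp add: ind)
    moreover have "(\<integral>\<^sup>+\<omega>. case_option 0 h (X (T \<omega>
        + ennreal t) \<omega>) \<partial>P (Some x))
        = (\<integral>\<^sup>+\<omega>. W (t, \<omega>) \<partial>P (Some x))" if "0 \<le> t"
    proof (intro nn_integral_cong)
      fix \<omega> assume "\<omega> \<in> space (P (Some x))"
      then have \<omega>: "\<omega> \<in> space M" by simp
      show "case_option 0 h (X (T \<omega> + ennreal t) \<omega>) = W (t, \<omega>)"
      proof (cases "T \<omega> < \<infinity>")
        case True
        then have "T \<omega> + ennreal t = ennreal (enn2real (T \<omega>) + t)"
          using \<open>0 \<le> t\<close> by (simp add: ennreal_plus)
        then show ?thesis using True by (simp add: W_def Z_def)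
      next
        case False
        then have "T \<omega> = \<infinity>" by (simp add: less_top[symmetric])
        then show ?thesis using at_infinity_dead[OF \<omega>] by (simp add: W_def)
      qed
    qed
    ultimately show "indicator {0..} t * (\<integral>\<^sup>+\<omega>. case_option 0 (p t h) (X
        (T \<omega>) \<omega>) \<partial>P (Some x)) =
        indicator {0..} t * (\<integral>\<^sup>+\<omega>. W (t, \<omega>) \<partial>P (Some x))"
      by (cases "0 \<le> t") simp_all
  qed
  also have "\<dots> = (\<integral>\<^sup>+t. \<integral>\<^sup>+\<omega>. indicator {0..} t * W
      (t, \<omega>) \<partial>P (Some x) \<partial>lborel)"
    by (intro nn_integral_cong nn_integral_cmult[symmetric]) (simp add: measurable_law)
  also have "\<dots> = (\<integral>\<^sup>+\<omega>. \<integral>\<^sup>+t. indicator {0..} t * W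
      (t, \<omega>) \<partial>lborel \<partial>P (Some x))"
    by (rule Fubini'[symmetric]) (subst measurable_cong_sets[OF sets_eq refl], measurable)
  also have "\<dots> \<le> (\<integral>\<^sup>+\<omega>. \<integral>\<^sup>+t. indicator {0..} t * Z t \<omega>
      \<partial>lborel \<partial>P (Some x))"
  proof (rule nn_integral_mono)
    fix \<omega> assume "\<omega> \<in> space (P (Some x))"
    then have \<omega>: "\<omega> \<in> space M" by simp
    have [measurable]: "(\<lambda>t. Z t \<omega>) \<in> borel_measurable borel"
      using measurable_compose[OF _ Zm, of "\<lambda>t. (t, \<omega>)" borel] \<omega> by simp
    let ?a = "enn2real (T \<omega>)"
    have "(\<integral>\<^sup>+t. indicator {0..} t * W (t, \<omega>) \<partial>lborel)
        \<le> (\<integral>\<^sup>+t. indicator {0..} (?a + t) * Z (?a + t) \<omega> \<partial>lborel)"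
      by (intro nn_integral_mono) (auto simp: W_def indicator_def)
    also have "\<dots> = (\<integral>\<^sup>+t. indicator {0..} t * Z t \<omega> \<partial>lborel)"
      by (rule nn_integral_shift[where f = "\<lambda>t. indicator {0..} t * Z t \<omega>"]) measurable
    finally show "(\<integral>\<^sup>+t. indicator {0..} t * W (t, \<omega>) \<partial>lborel)
        \<le> (\<integral>\<^sup>+t. indicator {0..} t * Z t \<omega> \<partial>lborel)" .
  qed
  also have "\<dots> = (\<integral>\<^sup>+t. \<integral>\<^sup>+\<omega>. indicator {0..} t * Z t \<omega>
      \<partial>P (Some x) \<partial>lborel)"
  proof (rule Fubini')
    have [measurable]: "(\<lambda>z. Z (fst z) (snd z)) \<in> borel_measurable (borel \<Otimes>\<^sub>M M)"
      using Zm by (simp add: split_def)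
    show "(\<lambda>(t, \<omega>). indicator {0..} t * Z t \<omega>)
        \<in> borel_measurable (lborel \<Otimes>\<^sub>M P (Some x))"
      by (subst measurable_cong_sets[OF sets_eq refl]) measurable
  qed
  also have "\<dots> = (\<integral>\<^sup>+t. indicator {0..} t *
      (\<integral>\<^sup>+\<omega>. Z t \<omega> \<partial>P (Some x)) \<partial>lborel)"
    unfolding Z_def by (intro nn_integral_cong nn_integral_cmult) measurable
  also have "\<dots> = R 0 h x"
    by (simp add: resolvent_eq transition_def Z_def)
  finally show ?thesis .
qed

end

section \<open>Discounted hitting probabilities\<close>

context hunt_process
begin

definition visits :: "'a set \<Rightarrow> real \<Rightarrow> 'w \<Rightarrow> ennreal" where
  "visits U t \<omega> = case_option 0 (indicator U) (X (ennreal t) \<omega>)"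

text \<open>This is \<open>exp (- T)\<close> for the hitting time T of U, or 0 if U is never
  visited. Written as a supremum over visits it is, for open U, an increasing limit of grid
  versions, which the Markov property at fixed times can handle.\<close>

definition discount :: "'a set \<Rightarrow> 'w \<Rightarrow> ennreal" where
  "discount U \<omega> = (SUP t\<in>{0..}. ennreal (exp (- t)) * visits U t \<omega>)"

definition grid_discount :: "real \<Rightarrow> 'a set \<Rightarrow> 'w \<Rightarrow> ennreal" where
  "grid_discount \<delta> U \<omega>
      = (SUP j :: nat. ennreal (exp (- (real j * \<delta>))) * visits U (real j * \<delta>) \<omega>)"

definition hit :: "'a set \<Rightarrow> 'a \<Rightarrow> ennreal" where
  "hit U x = (\<integral>\<^sup>+\<omega>. discount U \<omega> \<partial>P (Some x))"

definition killed :: "real \<Rightarrow> 'a set \<Rightarrow>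
    ('a \<Rightarrow> ennreal) \<Rightarrow> 'a \<Rightarrow> ennreal" where
  "killed \<delta> U f y = indicator (- U) y * p \<delta> f y"

text \<open>The j-th iterate applied to \<open>indicator U\<close> is the probability that the first
  grid visit to U happens at time \<open>j * \<delta>\<close>. So this is the expected discount at
  the first grid visit, with the grid cut off after index J.\<close>

definition grid_hit :: "real \<Rightarrow> 'a set \<Rightarrow> nat \<Rightarrow> 'a \<Rightarrow> ennreal" where
  "grid_hit \<delta> U J x = (\<Sum>j\<le>J. ennreal (exp (- (real j * \<delta>))) * (killed \<delta> U ^^ j)
      (indicator U) x)"

lemma visits_measurable [measurable]: "U \<in> sets borel \<Longrightarrow> visits U t \<in> borel_measurable M"
  unfolding visits_def[abs_def] by (intro case_option_X_measurable) simp

lemma visits_01: "visits U t \<omega> = (if X (ennreal t) \<omega> \<in> Some ` U then 1 else 0)"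
  by (auto simp: visits_def indicator_def split: option.split)

lemma killed_measurable [measurable]:
  assumes [measurable]: "U \<in> sets borel" "f \<in> borel_measurable borel"
  shows "killed \<delta> U f \<in> borel_measurable borel"
  unfolding killed_def[abs_def] by measurable

lemma killed_iterate_measurable [measurable]:
  "U \<in> sets borel \<Longrightarrow> f \<in> borel_measurable borel
      \<Longrightarrow> (killed \<delta> U ^^ j) f \<in> borel_measurable borel"
  by (induction j) auto

lemma grid_hit_measurable [measurable]:
  assumes [measurable]: "U \<in> sets borel"
  shows "grid_hit \<delta> U J \<in> borel_measurable borel"
  unfolding grid_hit_def[abs_def] by measurable

lemma transition_sum:
  assumes "finite S" "\<And>i. i \<in> S \<Longrightarrow> f i \<in> borel_measurable borel"
  shows "p t (\<lambda>y. \<Sum>i\<in>S. f i y) x = (\<Sum>i\<in>S. p t (f i) x)"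
  using assms
proof (induction S rule: finite_induct)
  case empty
  show ?case using transition_cmult[of "\<lambda>_. 0" t 0 x] by simp
next
  case (insert i S)
  then show ?case by (simp add: transition_add)
qed

lemma grid_hit_0: "grid_hit \<delta> U 0 x = indicator U x"
  by (simp add: grid_hit_def)

text \<open>First-step analysis: a start in U counts 1, and off U one step of length \<delta> leads
  back to the problem with horizon J.\<close>

lemma grid_hit_Suc:
  assumes [measurable]: "U \<in> sets borel"
  shows "grid_hit \<delta> U (Suc J) x
      = indicator U x + indicator (- U) x * (ennreal (exp (- \<delta>)) * p \<delta> (grid_hit \<delta> U J) x)"
proof -
  have "grid_hit \<delta> U (Suc J) x = indicator U x +
      (\<Sum>j\<le>J. ennreal (exp (- (real (Suc j) * \<delta>))) * (killed \<delta> U ^^ Suc j) (indicator U) x)"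
    unfolding grid_hit_def by (subst sum.atMost_Suc_shift) simp
  also have "(\<Sum>j\<le>J. ennreal (exp (- (real (Suc j) * \<delta>))) * (killed \<delta> U ^^ Suc j) (indicator U) x) =
      (\<Sum>j\<le>J. indicator (- U) x * (ennreal (exp (- \<delta>)) * (ennreal (exp (-
          (real j * \<delta>))) * p \<delta> ((killed \<delta> U ^^ j) (indicator U)) x)))"
  proof (intro sum.cong refl)
    fix j
    have "exp (- (real (Suc j) * \<delta>)) = exp (- \<delta>) * exp (- (real j * \<delta>))"
      unfolding exp_add[symmetric] by (simp add: algebra_simps)
    then show "ennreal (exp (- (real (Suc j) * \<delta>))) * (killed \<delta> U ^^ Suc j) (indicator U) x =
        indicator (- U) x * (ennreal (exp (- \<delta>)) * (ennreal (exp (- (real j * \<delta>))) * p \<delta>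
            ((killed \<delta> U ^^ j) (indicator U)) x))"
      by (simp add: ennreal_mult killed_def mult.assoc mult.left_commute)
  qed
  also have "\<dots> = indicator (- U) x * (ennreal (exp (- \<delta>)) * p \<delta> (grid_hit \<delta> U J) x)"
    unfolding grid_hit_def[abs_def]
    by (subst transition_sum) (simp_all add: transition_cmult sum_distrib_left)
  finally show ?thesis .
qed

text \<open>The recursion \<open>grid_hit_Suc\<close> preserves the bound, so
  \<open>grid_hit\<close> lies below every discrete supersolution that is at least 1 on U. A version
  of the equilibrium potential in the role of w later dominates the hitting functions.\<close>

lemma grid_hit_le:
  assumes "U \<in> sets borel" and w: "\<And>x. x \<in> U
      \<Longrightarrow> 1 \<le> w x" "\<And>x. ennreal (exp (- \<delta>)) * p \<delta> w x \<le> w x"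
  shows "grid_hit \<delta> U J x \<le> w x"
proof (induction J arbitrary: x)
  case 0
  show ?case using w(1) by (auto simp: grid_hit_0 indicator_def)
next
  case (Suc J)
  have "ennreal (exp (- \<delta>)) * p \<delta> (grid_hit \<delta> U J) x \<le> w x"
    using mult_left_mono[OF transition_mono[OF Suc]] w(2) by (meson order_trans zero_le)
  then show ?case using w(1) by (auto simp: grid_hit_Suc[OF assms(1)] indicator_def)
qed

lemma grid_hit_le_1:
  assumes "U \<in> sets borel" "0 \<le> \<delta>"
  shows "grid_hit \<delta> U J x \<le> 1"
proof (rule grid_hit_le[OF assms(1)])
  fix x
  have "ennreal (exp (- \<delta>)) * p \<delta> (\<lambda>_. 1) x \<le> 1 * 1"
    using assms(2) by (intro mult_mono transition_le_1) auto
  then show "ennreal (exp (- \<delta>)) * p \<delta> (\<lambda>_. 1) x \<le> 1" by simp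
qed simp

lemma incseq_grid_hit: "incseq (grid_hit \<delta> U)"
  unfolding grid_hit_def[abs_def] by (auto simp: incseq_def le_fun_def intro!: sum_mono2)

text \<open>Off U, one more step is exactly the horizon J + 1; on U the value is already 1, the
  largest possible.\<close>

lemma grid_hit_superharmonic:
  assumes U [measurable]: "U \<in> sets borel" and \<delta>: "0 \<le> \<delta>"
  shows "ennreal (exp (- \<delta>)) * p \<delta> (\<lambda>y. SUP J. grid_hit \<delta> U J y) x
      \<le> (SUP J. grid_hit \<delta> U J x)"
proof -
  have "ennreal (exp (- \<delta>)) * p \<delta> (\<lambda>y. SUP J. grid_hit \<delta> U J y) x
      = (SUP J. ennreal (exp (- \<delta>)) * p \<delta> (grid_hit \<delta> U J) x)"
    by (simp add: transition_SUP incseq_grid_hit SUP_mult_left_ennreal)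
  also have "\<dots> \<le> (SUP J. grid_hit \<delta> U J x)"
  proof (rule SUP_mono)
    fix J
    have "ennreal (exp (- \<delta>)) * p \<delta> (grid_hit \<delta> U J) x \<le> 1 * 1"
      using \<delta> by (intro mult_mono transition_le_1 grid_hit_le_1 U) auto
    then have "ennreal (exp (- \<delta>)) * p \<delta> (grid_hit \<delta> U J) x \<le> grid_hit \<delta> U (Suc J) x"
      by (auto simp: grid_hit_Suc indicator_def)
    then show "\<exists>K\<in>UNIV. ennreal (exp (- \<delta>)) * p \<delta> (grid_hit \<delta> U J) x
        \<le> grid_hit \<delta> U K x" by blast
  qed
  finally show ?thesis .
qed

lemma grid_hit_superharmonic_iterate:
  assumes U [measurable]: "U \<in> sets borel" and \<delta>: "0 \<le> \<delta>"
  shows "ennreal (exp (- (real k * \<delta>))) * p (real k * \<delta>)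
      (\<lambda>y. SUP J. grid_hit \<delta> U J y) x \<le> (SUP J. grid_hit \<delta> U J x)"
proof (induction k arbitrary: x)
  case 0
  show ?case by (simp add: transition_0)
next
  case (Suc k)
  let ?s = "\<lambda>y. SUP J. grid_hit \<delta> U J y"
  have "exp (- (real (Suc k) * \<delta>)) = exp (- \<delta>) * exp (- (real k * \<delta>))"
    unfolding exp_add[symmetric] by (simp add: algebra_simps)
  moreover have "p (real (Suc k) * \<delta>) ?s x = p \<delta> (p (real k * \<delta>) ?s) x"
    using \<delta> by (subst transition_semigroup) (auto simp: algebra_simps)
  ultimately have "ennreal (exp (- (real (Suc k) * \<delta>))) * p (real (Suc k) * \<delta>) ?s x =
      ennreal (exp (- \<delta>)) * p \<delta> (\<lambda>y. ennreal (exp (- (real k * \<delta>))) * p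
          (real k * \<delta>) ?s y) x"
    by (simp add: ennreal_mult transition_cmult mult.assoc)
  also have "\<dots> \<le> ennreal (exp (- \<delta>)) * p \<delta> ?s x"
    by (intro mult_left_mono transition_mono Suc) simp
  also have "\<dots> \<le> ?s x" by (rule grid_hit_superharmonic[OF U \<delta>])
  finally show ?case .
qed

lemma killed_iterate_eq:
  assumes U [measurable]: "U \<in> sets borel" and \<delta>: "0 \<le> \<delta>" and f: "f \<in> borel_measurable borel"
  shows "(killed \<delta> U ^^ j) f x =
    (\<integral>\<^sup>+\<omega>. (\<Prod>i<j. visits (- U) (real i * \<delta>) \<omega>) * case_option 0 f (X
        (ennreal (real j * \<delta>)) \<omega>) \<partial>P (Some x))"
  using f
proof (induction j arbitrary: f)
  case 0
  have "(\<integral>\<^sup>+\<omega>. case_option 0 f (X 0 \<omega>) \<partial>P (Some x))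
      = p 0 f x" by (simp add: transition_def)
  then show ?case unfolding transition_0 by simp
next
  case (Suc j)
  note [measurable] = Suc.prems
  \<comment> \<open>The path is alive and outside U at all grid times up to and including
    \<open>j * \<delta>\<close>. This event is known at that time, so the Markov property applies on
    it.\<close>
  define A where "A = {\<omega> \<in> space M. \<forall>i\<in>{..j}. X (ennreal (real i * \<delta>)) \<omega>
      \<in> Some ` (- U)}"
  have A: "A \<in> sets (pre_sigma (\<lambda>_. ennreal (real j * \<delta>)))"
  proof (rule sets_pre_sigmaI[OF stopping_time_const])
    fix t
    show "{\<omega> \<in> A. ennreal (real j * \<delta>) \<le> t} \<in> sets (F t)"
    proof (cases "ennreal (real j * \<delta>) \<le> t")
      case True
      have "{\<omega> \<in> space (F t). X (ennreal (real i * \<delta>)) \<omega> \<in> Some ` (- U)}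
          \<in> sets (F t)" if "i \<le> j" for i
      proof -
        have "ennreal (real i * \<delta>)
            \<le> ennreal (real j * \<delta>)" using that \<delta> by (intro ennreal_leI mult_right_mono) auto
        then have "sets (F (ennreal (real i * \<delta>))) \<subseteq> sets (F t)" using True by (intro sets_F_mono) simp
        moreover have "X (ennreal (real i * \<delta>)) -` (Some ` (- U)) \<inter> space (F (ennreal
            (real i * \<delta>))) \<in> sets (F (ennreal (real i * \<delta>)))"
          by (rule measurable_sets[OF adapted Some_image_cemetery]) simp
        moreover have "X (ennreal (real i * \<delta>)) -` (Some ` (- U)) \<inter> space (F (ennreal (real i * \<delta>))) =
            {\<omega> \<in> space (F t). X (ennreal (real i * \<delta>)) \<omega> \<in> Some ` (- U)}"
          by (auto simp: space_F)
        ultimately show ?thesis by auto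
      qed
      then have "{\<omega> \<in> space (F t). \<forall>i\<in>{..j}. X (ennreal (real i * \<delta>)) \<omega>
          \<in> Some ` (- U)} \<in> sets (F t)"
        by (intro sets.sets_Collect_finite_All) auto
      then show ?thesis using True by (simp add: A_def space_F)
    qed simp
  qed
  have prod: "(\<Prod>i<Suc j. visits (- U) (real i * \<delta>) \<omega>)
      = indicator A \<omega>" if \<omega>: "\<omega> \<in> space M" for \<omega>
  proof (cases "\<omega> \<in> A")
    case True
    then show ?thesis by (simp add: A_def visits_01 lessThan_Suc_atMost)
  next
    case False
    then obtain i where "i \<le> j" "visits (- U) (real i * \<delta>) \<omega> = 0"
      using \<omega> by (auto simp: A_def visits_01)
    then show ?thesis using False by (simp add: lessThan_Suc_atMost prod_zero_iff del: prod.lessThan_Suc) blast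
  qed
  have "(killed \<delta> U ^^ Suc j) f x = (killed \<delta> U ^^ j) (killed \<delta> U f) x"
    by (simp add: funpow_swap1)
  also have "\<dots> = (\<integral>\<^sup>+\<omega>. (\<Prod>i<j. visits (- U)
      (real i * \<delta>) \<omega>) * case_option 0 (killed \<delta> U f) (X (ennreal
      (real j * \<delta>)) \<omega>) \<partial>P (Some x))"
    by (rule Suc.IH) measurable
  also have "\<dots> = (\<integral>\<^sup>+\<omega>. indicator A \<omega> * case_option 0 (p \<delta> f) (X
      (ennreal (real j * \<delta>)) \<omega>) \<partial>P (Some x))"
  proof (intro nn_integral_cong)
    fix \<omega> assume "\<omega> \<in> space (P (Some x))"
    then have "indicator A \<omega>
        = (\<Prod>i<j. visits (- U) (real i * \<delta>) \<omega>) * visits (- U) (real j * \<delta>) \<omega>"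
      using prod[of \<omega>] by simp
    then show "(\<Prod>i<j. visits (- U) (real i * \<delta>) \<omega>) * case_option 0 (killed \<delta> U f) (X
        (ennreal (real j * \<delta>)) \<omega>) =
        indicator A \<omega> * case_option 0 (p \<delta> f) (X (ennreal (real j * \<delta>)) \<omega>)"
      by (auto simp: visits_def killed_def mult.assoc split: option.split)
  qed
  also have "\<dots> = (\<integral>\<^sup>+\<omega>. indicator A \<omega> * case_option 0 f (X (ennreal
      (real j * \<delta>) + ennreal \<delta>) \<omega>) \<partial>P (Some x))"
    by (rule markov[OF stopping_time_const A Suc.prems, symmetric])
  also have "ennreal (real j * \<delta>) + ennreal \<delta> = ennreal (real (Suc j) * \<delta>)"
    using \<delta> by (simp add: ennreal_plus[symmetric] algebra_simps del: ennreal_plus)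
  also have "(\<integral>\<^sup>+\<omega>. indicator A \<omega> * case_option 0 f (X (ennreal (real
      (Suc j) * \<delta>)) \<omega>) \<partial>P (Some x)) =
      (\<integral>\<^sup>+\<omega>. (\<Prod>i<Suc j. visits (- U) (real i * \<delta>) \<omega>) * case_option 0 f
          (X (ennreal (real (Suc j) * \<delta>)) \<omega>) \<partial>P (Some x))"
    using prod by (intro nn_integral_cong) (simp del: prod.lessThan_Suc)
  finally show ?case .
qed

text \<open>Only the summand of the first grid visit is nonzero, and since the discount decreases in
  time it also attains the supremum over all grid visits.\<close>

lemma first_visit_sum:
  assumes \<omega>: "\<omega> \<in> space M" and \<delta>: "0 \<le> \<delta>"
  shows "(SUP J. \<Sum>j\<le>J. ennreal (exp (- (real j * \<delta>))) * ((\<Prod>i<j. visits (- U)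
      (real i * \<delta>) \<omega>) * visits U (real j * \<delta>) \<omega>)) =
    grid_discount \<delta> U \<omega>"
proof -
  define v where "v j \<longleftrightarrow> X (ennreal (real j * \<delta>)) \<omega> \<in> Some ` U" for j :: nat
  have first: "(\<Prod>i<j. visits (- U) (real i * \<delta>) \<omega>) * visits U (real j * \<delta>) \<omega>
      = (if v j \<and> (\<forall>i<j. \<not> v i) then 1 else 0)" for j
  proof (cases "v j")
    case True
    \<comment> \<open>\<open>visits (- U)\<close> is 0 at the cemetery too, so in general it is not
      the complement of a visit. Here a visit at the later index j excludes the cemetery, because a
      dead path stays dead.\<close>
    have "visits (- U) (real i * \<delta>) \<omega> = (if v i then 0 else 1)" if "i < j" for i
    proof -
      have "ennreal (real i * \<delta>)
          \<le> ennreal (real j * \<delta>)" using that \<delta> by (intro ennreal_leI mult_right_mono) auto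
      then have "X (ennreal (real i * \<delta>)) \<omega> \<noteq> None" using stays_dead[OF \<omega>] True
          by (fastforce simp: v_def)
      then show ?thesis by (auto simp: visits_01 v_def)
    qed
    then have "(\<Prod>i<j. visits (- U) (real i * \<delta>) \<omega>) = (\<Prod>i<j. if v i then 0 else 1)"
      by (intro prod.cong) auto
    also have "\<dots> = (if \<forall>i<j. \<not> v i then 1 else 0)" by auto
    finally show ?thesis using True by (simp add: visits_01 v_def)
  qed (simp add: visits_01 v_def)
  have "(SUP J. \<Sum>j\<le>J. ennreal (exp (- (real j * \<delta>))) * (if v j
      \<and> (\<forall>i<j. \<not> v i) then 1 else 0)) =
      (SUP j. ennreal (exp (- (real j * \<delta>))) * (if v j then 1 else 0))"
  proof (cases "\<exists>j. v j")
    case True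
    define k where "k = (LEAST j. v j)"
    have k: "v k" "\<And>i. i < k \<Longrightarrow> \<not> v i" using LeastI_ex[OF True] not_less_Least by (auto simp: k_def)
    have first_k: "v j \<and> (\<forall>i<j. \<not> v i) \<longleftrightarrow> j
        = k" for j using k by (metis linorder_neqE_nat)
    have "(SUP J. \<Sum>j\<le>J. ennreal (exp (- (real j * \<delta>))) * (if v j
        \<and> (\<forall>i<j. \<not> v i) then 1 else 0)) = ennreal (exp (- (real k * \<delta>)))"
    proof (intro antisym SUP_least)
      show "ennreal (exp (- (real k * \<delta>)))
          \<le> (SUP J. \<Sum>j\<le>J. ennreal (exp (- (real j * \<delta>))) * (if v j
          \<and> (\<forall>i<j. \<not> v i) then 1 else 0))"
        unfolding first_k by (intro SUP_upper2[of k]) (simp_all add: if_distrib sum.delta cong: if_cong)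
    qed (simp add: first_k if_distrib sum.delta cong: if_cong)
    moreover have "(SUP j. ennreal (exp (- (real j * \<delta>))) * (if v j then 1 else 0))
        = ennreal (exp (- (real k * \<delta>)))"
    proof (intro antisym SUP_least)
      fix j
      show "ennreal (exp (- (real j * \<delta>))) * (if v j then 1 else 0) \<le> ennreal (exp (- (real k * \<delta>)))"
      proof (cases "v j")
        case True
        then have "k \<le> j" using k(2) by (meson not_le)
        then show ?thesis using \<delta> by (auto intro!: ennreal_leI mult_right_mono)
      qed simp
    qed (use k(1) in \<open>intro SUP_upper2[of k], simp_all\<close>)
    ultimately show ?thesis by simp
  qed simp
  then show ?thesis
    unfolding grid_discount_def first by (simp add: visits_01 v_def)
qed

lemma SUP_grid_hit:
  assumes U [measurable]: "U \<in> sets borel" and \<delta>: "0 \<le> \<delta>"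
  shows "(SUP J. grid_hit \<delta> U J x)
      = (\<integral>\<^sup>+\<omega>. grid_discount \<delta> U \<omega> \<partial>P (Some x))"
proof -
  note [simp] = measurable_law
  have "(killed \<delta> U ^^ j) (indicator U) x =
      (\<integral>\<^sup>+\<omega>. (\<Prod>i<j. visits (- U) (real i * \<delta>) \<omega>) * visits U
          (real j * \<delta>) \<omega> \<partial>P (Some x))" for j
    unfolding visits_def[of U] by (rule killed_iterate_eq[OF U \<delta>]) simp
  then have "grid_hit \<delta> U J x
      = (\<integral>\<^sup>+\<omega>. (\<Sum>j\<le>J. ennreal (exp (- (real j * \<delta>))) * ((\<Prod>i<j. visits
      (- U) (real i * \<delta>) \<omega>) * visits U (real j * \<delta>) \<omega>)) \<partial>P (Some x))" for J
    by (simp add: grid_hit_def nn_integral_sum nn_integral_cmult)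
  then have "(SUP J. grid_hit \<delta> U J x)
      = (\<integral>\<^sup>+\<omega>. (SUP J. \<Sum>j\<le>J. ennreal (exp (- (real j * \<delta>))) *
      ((\<Prod>i<j. visits (- U) (real i * \<delta>) \<omega>) * visits U
      (real j * \<delta>) \<omega>)) \<partial>P (Some x))"
    by (subst nn_integral_monotone_convergence_SUP) (auto simp: incseq_def le_fun_def intro!: sum_mono2)
  also have "\<dots> = (\<integral>\<^sup>+\<omega>. grid_discount \<delta> U \<omega> \<partial>P (Some x))"
    by (intro nn_integral_cong first_visit_sum \<delta>) simp
  finally show ?thesis .
qed

text \<open>By right continuity a path in the open set U at time s is still in U at grid times
  shortly after s. The mesh is tied to a free t so that t can be made a grid point at every
  level.\<close>

lemma discount_eq_SUP_grid:
  assumes \<omega>: "\<omega> \<in> space M" and U: "open U" and t: "0 < t"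
  shows "discount U \<omega> = (SUP k. grid_discount (t / 2 ^ k) U \<omega>)"
proof (rule antisym)
  show "(SUP k. grid_discount (t / 2 ^ k) U \<omega>) \<le> discount U \<omega>"
    unfolding grid_discount_def discount_def using t
    by (intro SUP_least) (auto intro!: SUP_upper)
  show "discount U \<omega> \<le> (SUP k. grid_discount (t / 2 ^ k) U \<omega>)"
    unfolding discount_def
  proof (rule SUP_least)
    fix s :: real assume "s \<in> {0..}"
    then have s: "0 \<le> s" by simp
    show "ennreal (exp (- s)) * visits U s \<omega> \<le> (SUP k. grid_discount (t / 2 ^ k) U \<omega>)"
    proof (cases "X (ennreal s) \<omega> \<in> Some ` U")
      case True
      then obtain x where x: "X (ennreal s) \<omega> = Some x" "x \<in> U" by auto
      define u where "u k = t * dyadic_above k (s / t)" for k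
      have u: "u \<longlonglongrightarrow> s"
        using tendsto_mult_left[OF dyadic_above_tendsto[of "s / t"], of t] t by (simp add: u_def[abs_def])
      have u_gt: "s < u k" for k
        using dyadic_above_bounds(1)[of "s / t" k] t by (simp add: u_def field_simps)
      have "filterlim (\<lambda>k. ennreal (u k)) (at_right (ennreal s)) sequentially"
        using u_gt s by (intro tendsto_imp_filterlim_at_right tendsto_ennrealI u always_eventually)
          (auto simp: ennreal_less_iff)
      then have ev: "\<forall>\<^sub>F k in sequentially. X (ennreal (u k)) \<omega> \<in> Some ` U"
        using right_cont_open[OF \<omega> _ x(1) U x(2)] by (auto simp: filterlim_iff)
      have lim: "(\<lambda>k. ennreal (exp (- u k))) \<longlonglongrightarrow> ennreal (exp (- s))"
        by (intro tendsto_ennrealI tendsto_intros u)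
      have "ennreal (exp (- s)) \<le> (SUP k. grid_discount (t / 2 ^ k) U \<omega>)"
      proof (rule tendsto_upperbound[OF lim])
        show "\<forall>\<^sub>F k in sequentially. ennreal (exp (- u k)) \<le> (SUP k. grid_discount (t / 2 ^ k) U \<omega>)"
          using ev
        proof eventually_elim
          case (elim k)
          define j where "j = nat (\<lfloor>s / t * 2 ^ k\<rfloor> + 1)"
          have "0 \<le> \<lfloor>s / t * 2 ^ k\<rfloor>" using s t by simp
          then have "real j = of_int \<lfloor>s / t * 2 ^ k\<rfloor> + 1" unfolding j_def by simp
          then have j: "u k = real j * (t / 2 ^ k)" by (simp add: u_def dyadic_above_def)
          have "ennreal (exp (- u k)) = ennreal (exp (- (real j * (t / 2 ^ k)))) * visits U (real j * (t / 2 ^ k)) \<omega>"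
            using elim by (simp add: j visits_01)
          also have "\<dots> \<le> grid_discount (t / 2 ^ k) U \<omega>"
            unfolding grid_discount_def by (rule SUP_upper) simp
          also have "\<dots> \<le> (SUP k. grid_discount (t / 2 ^ k) U \<omega>)" by (rule SUP_upper) simp
          finally show ?case .
        qed
      qed simp
      then show ?thesis using True by (simp add: visits_01)
    qed (simp add: visits_01)
  qed
qed

lemma incseq_grid_discount:
  "incseq (\<lambda>k. grid_discount (t / 2 ^ k) U)"
proof (rule incseq_SucI, rule le_funI)
  fix k \<omega>
  show "grid_discount (t / 2 ^ k) U \<omega> \<le> grid_discount (t / 2 ^ Suc k) U \<omega>"
    unfolding grid_discount_def
  proof (rule SUP_least)
    fix j :: nat
    have "real j * (t / 2 ^ k) = real (2 * j) * (t / 2 ^ Suc k)" by simp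
    then show "ennreal (exp (- (real j * (t / 2 ^ k)))) * visits U (real j * (t / 2 ^ k)) \<omega>
        \<le> (SUP j. ennreal (exp (- (real j * (t / 2 ^ Suc k)))) * visits U (real j * (t / 2 ^ Suc k)) \<omega>)"
      by (intro SUP_upper2[of "2 * j"]) (simp_all only: UNIV_I order_refl)
  qed
qed

lemma grid_discount_measurable [measurable]:
  assumes [measurable]: "U \<in> sets borel"
  shows "grid_discount \<delta> U \<in> borel_measurable M"
  unfolding grid_discount_def[abs_def] by measurable

lemma hit_eq_SUP:
  assumes U: "open U" and t: "0 < t"
  shows "hit U x = (SUP k. SUP J. grid_hit (t / 2 ^ k) U J x)"
proof -
  have [measurable]: "U \<in> sets borel" using U by simp
  have "hit U x = (\<integral>\<^sup>+\<omega>. (SUP k. grid_discount (t / 2 ^ k) U \<omega>) \<partial>P (Some x))"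
    unfolding hit_def by (intro nn_integral_cong discount_eq_SUP_grid U t) simp
  also have "\<dots> = (SUP k. \<integral>\<^sup>+\<omega>. grid_discount (t / 2 ^ k) U \<omega> \<partial>P (Some x))"
    by (rule nn_integral_monotone_convergence_SUP[OF incseq_grid_discount]) (simp add: measurable_law)
  also have "\<dots> = (SUP k. SUP J. grid_hit (t / 2 ^ k) U J x)"
    using t by (simp add: SUP_grid_hit)
  finally show ?thesis .
qed

lemma hit_measurable [measurable]:
  assumes "open U"
  shows "hit U \<in> borel_measurable borel"
proof -
  have [measurable]: "U \<in> sets borel" using assms by simp
  have "hit U = (\<lambda>x. SUP k. SUP J. grid_hit (1 / 2 ^ k) U J x)"
    using hit_eq_SUP[OF assms zero_less_one] by (simp add: fun_eq_iff)
  then show ?thesis by simp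
qed

lemma hit_le:
  assumes "open U" "\<And>x. x \<in> U \<Longrightarrow> 1 \<le> w x" "\<And>t x. 0 < t
      \<Longrightarrow> ennreal (exp (- t)) * p t w x \<le> w x"
  shows "hit U x \<le> w x"
  unfolding hit_eq_SUP[OF assms(1) zero_less_one]
  using assms by (intro SUP_least grid_hit_le) auto

lemma hit_le_1: "open U \<Longrightarrow> hit U x \<le> 1"
  unfolding hit_eq_SUP[OF _ zero_less_one] by (intro SUP_least grid_hit_le_1) auto

lemma hit_eq_1:
  assumes "open U" "x \<in> U"
  shows "hit U x = 1"
proof (rule antisym[OF hit_le_1[OF assms(1)]])
  show "1 \<le> hit U x"
    unfolding hit_eq_SUP[OF assms(1) zero_less_one]
    by (intro SUP_upper2[of 0]) (use assms(2) in \<open>auto simp: grid_hit_0\<close>)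
qed

lemma hit_supermedian:
  assumes U: "open U" and t: "0 < t"
  shows "ennreal (exp (- t)) * p t (hit U) x \<le> hit U x"
proof -
  have [measurable]: "U \<in> sets borel" using U by simp
  let ?s = "\<lambda>k y. SUP J. grid_hit (t / 2 ^ k) U J y"
  have hit: "hit U = (\<lambda>y. SUP k. ?s k y)" using hit_eq_SUP[OF U t] by (simp add: fun_eq_iff)
  have inc: "incseq ?s"
  proof (rule incseq_SucI, rule le_funI)
    fix k y
    show "?s k y \<le> ?s (Suc k) y"
      using t incseq_SucD[OF incseq_grid_discount[of t U], of k] by (simp add: SUP_grid_hit le_fun_def nn_integral_mono)
  qed
  have "ennreal (exp (- t)) * p t (hit U) x = (SUP k. ennreal (exp (- t)) * p t (?s k) x)"
    unfolding hit using inc by (simp add: transition_SUP SUP_mult_left_ennreal)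
  also have "\<dots> \<le> (SUP k. ?s k x)"
  proof (rule SUP_mono')
    fix k
    \<comment> \<open>The time t consists of \<open>2 ^ k\<close> steps of length
      \<open>t / 2 ^ k\<close>.\<close>
    show "ennreal (exp (- t)) * p t (?s k) x \<le> ?s k x"
      using grid_hit_superharmonic_iterate[of U "t / 2 ^ k" "2 ^ k" x] t by simp
  qed
  finally show ?thesis by (simp add: hit)
qed

end

lemma mult_liminf_le:
  fixes f :: "nat \<Rightarrow> ennreal"
  shows "c * liminf f \<le> liminf (\<lambda>n. c * f n)"
  unfolding liminf_SUP_INF SUP_mult_left_ennreal
  by (intro SUP_mono' INF_greatest mult_left_mono INF_lower) auto

context hunt_process
begin

lemma transition_open_tendsto:
  assumes "open U" "x \<in> U"
  shows "((\<lambda>t. p t (indicator U) x) \<longlongrightarrow> 1) (at_right 0)"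
proof (rule tendsto_at_right_sequentially[of 0 1])
  fix S :: "nat \<Rightarrow> real" assume S: "\<And>n. 0 < S n" "S \<longlonglongrightarrow> 0"
  have [measurable]: "U \<in> sets borel" using assms by simp
  have S': "filterlim (\<lambda>n. ennreal (S n)) (at_right 0) sequentially"
    using tendsto_ennrealI[OF S(2)] S(1)
    by (intro tendsto_imp_filterlim_at_right) (auto simp: ennreal_less_zero_iff)
  have "(\<lambda>n. \<integral>\<^sup>+\<omega>. case_option 0 (indicator U) (X (ennreal
      (S n)) \<omega>) \<partial>P (Some x)) \<longlonglongrightarrow> (\<integral>\<^sup>+\<omega>. 1 \<partial>P (Some x))"
  proof (rule nn_integral_dominated_convergence[where w = "\<lambda>_. 1"])
    show "AE \<omega> in P (Some x). (\<lambda>n. case_option 0 (indicator U) (X (ennreal (S n)) \<omega>))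
        \<longlonglongrightarrow> (1 :: ennreal)"
      using normal[of "Some x"] AE_space
    proof eventually_elim
      case (elim \<omega>)
      have "\<forall>\<^sub>F s in at_right 0. X s \<omega> \<in> Some ` U"
        using elim assms by (intro right_cont_open[of \<omega> 0 x]) auto
      then have "\<forall>\<^sub>F n in sequentially. X (ennreal (S n)) \<omega> \<in> Some ` U"
        using S' by (auto simp: filterlim_iff)
      then show ?case
        by (intro tendsto_eventually) (auto elim!: eventually_mono)
    qed
  qed (auto split: option.split simp: indicator_def)
  then show "(\<lambda>n. p (S n) (indicator U) x) \<longlonglongrightarrow> 1" by (simp add: transition_def)
qed simp

end

section \<open>Sets that are hit with small probability have small capacity\<close>

context potential_setting
begin

sublocale m: sigma_finite_measure m
proof
  obtain L :: "nat \<Rightarrow> 'a set" where L: "\<And>n. compact (L n)" "incseq L" "(\<Union>n. L n) = UNIV"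
    using sigma_compact_exhaustion[OF locally_compact] by blast
  show "\<exists>A. countable A \<and> A \<subseteq> sets m \<and> \<Union>A
      = space m \<and> (\<forall>a\<in>A. emeasure m a \<noteq> \<infinity>)"
  proof (intro exI[of _ "range L"] conjI ballI)
    show "emeasure m a \<noteq> \<infinity>" if a: "a \<in> range L" for a
    proof -
      have "compact a" using a L(1) by auto
      then have "emeasure m a < \<infinity>" using radon by (simp add: radon_full_support_def)
      then show ?thesis by simp
    qed
  qed (use L in \<open>auto simp: borel_compact\<close>)
qed

lemma kernel_facts:
  assumes "0 \<le> \<alpha>"
  shows kernel_measurable: "(\<lambda>(x, y). r \<alpha> x y) \<in> borel_measurable (borel \<Otimes>\<^sub>M borel)"
    and kernel_sym: "r \<alpha> x y = r \<alpha> y x"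
    and kernel_excessive: "excessive P X \<alpha> (r \<alpha> x)"
    and resolvent_eq_kernel: "h \<in> borel_measurable borel
        \<Longrightarrow> R \<alpha> h x = (\<integral>\<^sup>+y. h y * r \<alpha> x y \<partial>m)"
  using kernel assms unfolding resolvent_kernel_def by auto

lemma kernel_measurable1 [measurable]: "0 \<le> \<alpha> \<Longrightarrow> r \<alpha> x \<in> borel_measurable borel"
  using kernel_excessive by (simp add: excessive_def)

text \<open>The kernel represents the resolvent at every x as an integral against m, so inequalities
  known only almost everywhere become inequalities of resolvents at every point.\<close>

lemma resolvent_mono_AE:
  assumes "f \<in> borel_measurable borel" "g \<in> borel_measurable borel" "0 \<le> \<alpha>" "AE x in m. f x \<le> g x"
  shows "R \<alpha> f x \<le> R \<alpha> g x"
  using assms(4) unfolding resolvent_eq_kernel[OF assms(3,1)] resolvent_eq_kernel[OF assms(3,2)]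
  by (intro nn_integral_mono_AE) (auto elim!: eventually_mono intro: mult_right_mono)

lemma resolvent_cong_AE:
  assumes "f \<in> borel_measurable borel" "g \<in> borel_measurable borel" "0 \<le> \<alpha>" "AE x in m. f x = g x"
  shows "R \<alpha> f x = R \<alpha> g x"
  using assms by (intro antisym resolvent_mono_AE) (auto elim!: eventually_mono)

text \<open>Real-valued resolvent for use in the form; \<open>enn2real\<close> puts 0 where the
  resolvent is infinite.\<close>

definition G :: "real \<Rightarrow> ('a \<Rightarrow> real) \<Rightarrow> 'a \<Rightarrow> real" where
  "G \<alpha> h x = enn2real (R \<alpha> (\<lambda>y. ennreal (h y)) x)"

lemma
  assumes "0 < \<alpha>" "h \<in> L2_functions m" "\<And>x. 0 \<le> h x"
  shows G_domain: "G \<alpha> h \<in> D"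
    and B_G: "v \<in> D \<Longrightarrow> B \<alpha> (G \<alpha> h) v = L2_inner m h v"
    and ennreal_G: "AE x in m. ennreal (G \<alpha> h x) = R \<alpha> (\<lambda>y. ennreal (h y)) x"
proof -
  have *: "(AE x in m. R \<alpha> (\<lambda>y. ennreal (h y)) x
      < \<infinity>) \<and> form_resolvent m D \<E> \<alpha> h (G \<alpha> h)"
    using associated assms unfolding associated_def G_def[abs_def] by blast
  then show "G \<alpha> h \<in> D" "v \<in> D \<Longrightarrow> B \<alpha> (G \<alpha> h) v = L2_inner m h v"
    by (auto simp: form_resolvent_def)
  from * have "AE x in m. R \<alpha> (\<lambda>y. ennreal (h y)) x < \<infinity>" by simp
  then show "AE x in m. ennreal (G \<alpha> h x) = R \<alpha> (\<lambda>y. ennreal (h y)) x"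
    by eventually_elim (simp add: G_def)
qed

lemma G_nonneg: "0 \<le> G \<alpha> h x"
  by (simp add: G_def)

lemma L2_borel: "h \<in> L2_functions m \<Longrightarrow> h \<in> borel_measurable borel"
  using L2_functionsD(1)[of h m] unfolding measurable_cong_sets[OF sets_m refl] by simp

lemma B_1_G:
  assumes "0 < \<beta>" "h \<in> L2_functions m" "\<And>x. 0 \<le> h x" "v \<in> D"
  shows "B 1 (G (\<beta> + 1) h) v = L2_inner m h v - \<beta> * L2_inner m (G (\<beta> + 1) h) v"
  using B_G[of "\<beta> + 1" h v] assms by (simp add: form_shift_def algebra_simps)

text \<open>Testing e against \<open>G (\<beta> + 1) h\<close> for nonnegative h and using symmetry
  shows that \<open>\<beta> * G (\<beta> + 1) e\<close> is at most e when both are integrated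
  against h.\<close>

lemma supermedian_AE:
  assumes e: "e \<in> D" "\<And>x. 0 \<le> e x"
    and pos: "\<And>\<phi>. \<phi> \<in> D \<Longrightarrow> AE x in m. 0 \<le> \<phi> x
        \<Longrightarrow> 0 \<le> B 1 e \<phi>" and \<beta>: "0 < \<beta>"
  shows "AE x in m. ennreal \<beta> * R (\<beta> + 1) (\<lambda>y. ennreal (e y)) x \<le> ennreal (e x)"
proof -
  have eL: "e \<in> L2_functions m" using e D_L2 by blast
  have b1: "0 < \<beta> + 1" using \<beta> by simp
  let ?Ge = "G (\<beta> + 1) e"
  have GeD: "?Ge \<in> D" by (rule G_domain[OF b1 eL e(2)])
  have GeL: "(\<lambda>x. \<beta> * ?Ge x) \<in> L2_functions m" by (intro L2_scale D_L2 GeD)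
  have main: "\<beta> * L2_inner m h ?Ge \<le> L2_inner m h e" if h: "h \<in> L2_functions m" "\<And>x. 0 \<le> h x" for h
  proof -
    let ?Gh = "G (\<beta> + 1) h"
    have GhD: "?Gh \<in> D" by (rule G_domain[OF b1 h])
    have "0 \<le> B 1 e ?Gh" by (rule pos[OF GhD]) (simp add: G_nonneg)
    also have "\<dots> = L2_inner m h e - \<beta> * L2_inner m ?Gh e"
      using B_1_G[OF \<beta> h e(1)] by (simp add: B_sym e(1) GhD)
    also have "L2_inner m ?Gh e = B (\<beta> + 1) ?Ge ?Gh"
      by (subst B_G[OF b1 eL e(2) GhD]) (rule L2_inner_sym)
    also have "\<dots> = L2_inner m h ?Ge"
      by (subst B_sym[OF GeD GhD]) (rule B_G[OF b1 h GeD])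
    finally show ?thesis by simp
  qed
  \<comment> \<open>The violation of the claim serves as test function, so that its own L2 norm
    turns out to be 0.\<close>
  define h where "h x = max 0 (\<beta> * ?Ge x - e x)" for x
  have hL: "h \<in> L2_functions m"
    unfolding h_def using L2_functionsD(1)[OF L2_diff[OF GeL eL]]
    by (intro L2_dominated[OF L2_diff[OF GeL eL]]) auto
  have "L2_inner m h (\<lambda>x. \<beta> * ?Ge x - e x) = L2_sq m h"
    unfolding L2_inner_def by (intro Bochner_Integration.integral_cong) (auto simp: h_def max_def)
  moreover have "L2_inner m h (\<lambda>x. \<beta> * ?Ge x - e x) \<le> 0"
    using main[OF hL] by (simp add: h_def L2_inner_sym[of m h] L2_inner_diff_left[OF GeL eL hL] L2_inner_scale_left)
  ultimately have "L2_sq m h = 0" using L2_inner_nonneg[of m h] by simp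
  then have "AE x in m. h x * h x = 0"
    unfolding L2_inner_def using L2_mult_integrable[OF hL hL] by (subst (asm) integral_nonneg_eq_0_iff_AE) auto
  with ennreal_G[OF b1 eL e(2)] show ?thesis
  proof eventually_elim
    case (elim x)
    then have "\<beta> * ?Ge x \<le> e x" by (auto simp: h_def max_def split: if_splits)
    then have "ennreal (\<beta> * ?Ge x) \<le> ennreal (e x)" by (rule ennreal_leI)
    then show ?case using elim(1) \<beta> by (simp add: ennreal_mult G_nonneg)
  qed
qed

text \<open>
  The resolvent identity exhibits \<open>n R\<^bsub>n+1\<^esub>e\<close> as the \<open>1\<close>-potential of
      \<open>n (e - n R\<^bsub>n+1\<^esub>e)\<close>, so the
  lower limit is an everywhere \<open>1\<close>-supermedian version of \<open>e\<close>.
\<close>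

lemma supermedian_version:
  assumes e [measurable]: "e \<in> borel_measurable borel" and le1: "\<And>x. e x \<le> 1"
    and super: "\<And>n :: nat. 0 < n \<Longrightarrow> AE x in m. ennreal (real n) * R (real n + 1) e x \<le> e x"
    and U: "open U" "AE x in m. x \<in> U \<longrightarrow> e x = 1"
  obtains w where "w \<in> borel_measurable borel" "\<And>x. x \<in> U \<Longrightarrow> 1 \<le> w x"
    "\<And>t x. 0 < t \<Longrightarrow> ennreal (exp (- t)) * p t w x \<le> w x" "AE x in m. w x \<le> e x"
proof -
  have Um [measurable]: "U \<in> sets borel" using U by simp
  define w where "w n x = ennreal (real n) * R (real n + 1) e x" for n :: nat and x
  have wm [measurable]: "w n \<in> borel_measurable borel" for n unfolding w_def[abs_def] by measurable
  have w_e: "AE x in m. w n x \<le> e x" for n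
    using super[of n] by (cases "n = 0") (auto simp: w_def)
  have w_1: "w n x \<le> 1" for n x
  proof -
    have "w n x \<le> ennreal (real n + 1) * R (real n + 1) (\<lambda>_. 1) x"
      unfolding w_def by (intro mult_mono resolvent_mono le1 ennreal_leI) auto
    also have "\<dots> \<le> 1" by (rule resolvent_1_le) simp
    finally show ?thesis .
  qed
  have w_super: "ennreal (exp (- t)) * p t (w n) x \<le> w n x" if "0 < t" for n t x
  proof -
    \<comment> \<open>Subtraction in \<open>ennreal\<close> is truncated, so adding
      \<open>w n\<close> back returns e only where \<open>w n \<le> e\<close>. This holds almost
      everywhere, which suffices because resolvents ignore m-null sets.\<close>
    define h where "h x = ennreal (real n) * (e x - w n x)" for x
    have hm [measurable]: "h \<in> borel_measurable borel" unfolding h_def[abs_def] by measurable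
    have "w n = R 1 h"
    proof
      fix x
      have "R 1 (\<lambda>y. h y + ennreal (real n) * w n y) x = R 1 (\<lambda>y. ennreal (real n) * e y) x"
      proof (rule resolvent_cong_AE)
        show "AE y in m. h y + ennreal (real n) * w n y = ennreal (real n) * e y"
          using w_e[of n]
        proof eventually_elim
          case (elim y)
          have "e y - w n y + w n y = e y" using elim by (rule diff_add_cancel_ennreal)
          then show ?case by (simp add: h_def distrib_left[symmetric])
        qed
      qed simp_all
      then have "R 1 h x + ennreal (real n) * R 1 (w n) x = ennreal (real n) * R 1 e x"
        by (simp add: resolvent_add resolvent_cmult)
      also have "ennreal (real n) * R 1 e x = w n x + ennreal (real n) * R 1 (w n) x"
      proof (cases "n = 0")
        case False
        then have "R 1 e x = R (real n + 1) e x + ennreal (real n) * R 1 (R (real n + 1) e) x"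
          using resolvent_identity[OF e, of 1 "real n + 1" x] by simp
        moreover have "R 1 (w n) x = ennreal (real n) * R 1 (R (real n + 1) e) x"
          unfolding w_def[abs_def] by (rule resolvent_cmult) measurable
        ultimately show ?thesis by (simp add: w_def distrib_left)
      qed (simp add: w_def)
      finally have eq: "R 1 h x + ennreal (real n) * R 1 (w n) x = w n x + ennreal (real n) * R 1 (w n) x" .
      have "R 1 (w n) x \<le> R 1 (\<lambda>_. 1) x" by (intro resolvent_mono w_1)
      also have "\<dots> \<le> 1" using resolvent_1_le[of 1 x] by simp
      finally have "ennreal (real n) * R 1 (w n) x \<noteq> \<infinity>"
        by (auto simp: ennreal_mult_eq_top_iff top_unique)
      then show "w n x = R 1 h x"
        using eq by (simp add: add.commute[of _ "ennreal (real n) * R 1 (w n) x"] ennreal_add_left_cancel)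
    qed
    then show ?thesis using transition_resolvent_le[OF hm, of t 1 x] that by simp
  qed
  show thesis
  proof (rule that[of "\<lambda>x. liminf (\<lambda>n. w n x)"])
    show "AE x in m. liminf (\<lambda>n. w n x) \<le> e x"
    proof -
      have "AE x in m. \<forall>n. w n x \<le> e x" using w_e by (simp add: AE_all_countable)
      then show ?thesis
      proof eventually_elim
        case (elim x)
        then have "liminf (\<lambda>n. w n x) \<le> liminf (\<lambda>_ :: nat. e x)" by (intro Liminf_mono) auto
        then show ?case by (simp add: Liminf_const)
      qed
    qed
    show "ennreal (exp (- t)) * p t (\<lambda>x. liminf (\<lambda>n. w n x)) x
        \<le> liminf (\<lambda>n. w n x)" if "0 < t" for t x
    proof -
      have "ennreal (exp (- t)) * p t (\<lambda>x. liminf (\<lambda>n. w n x)) x =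
          p t (\<lambda>x. ennreal (exp (- t)) * liminf (\<lambda>n. w n x)) x"
        by (rule transition_cmult[symmetric]) measurable
      also have "\<dots> \<le> p t (\<lambda>x. liminf (\<lambda>n. ennreal (exp (- t)) * w n x)) x"
        by (intro transition_mono mult_liminf_le)
      also have "p t (\<lambda>x. liminf (\<lambda>n. ennreal (exp (- t)) * w n x)) x
          \<le> liminf (\<lambda>n. p t (\<lambda>x. ennreal (exp (- t)) * w n x) x)"
        by (rule transition_liminf_le) measurable
      also have "\<dots> \<le> liminf (\<lambda>n. w n x)"
        using w_super[OF that] by (intro Liminf_mono always_eventually) (simp add: transition_cmult)
      finally show ?thesis .
    qed
    \<comment> \<open>The comparison is with the indicator of U, for which right continuity of the
      paths gives the lower bound 1 at points of U.\<close>
    show "1 \<le> liminf (\<lambda>n. w n x)" if x: "x \<in> U" for x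
    proof -
      have "((\<lambda>t. ennreal (exp (- 1 * t)) * p t (indicator U) x) \<longlongrightarrow> ennreal (exp
          (- 1 * 0)) * 1) (at_right 0)"
        using transition_open_tendsto[OF U(1) x]
        by (intro tendsto_mult_ennreal tendsto_ennrealI tendsto_intros) auto
      then have "1 \<le> liminf (\<lambda>n. ennreal (real n) * R (real n + 1) (indicator U) x)"
        using le_liminf_resolvent[of "indicator U" 1 x 1] by simp
      moreover have ae: "AE x in m. indicator U x \<le> e x"
        using U(2) by eventually_elim (auto simp: indicator_def)
      have "ennreal (real n) * R (real n + 1) (indicator U) x \<le> w n x" for n
        unfolding w_def by (intro mult_left_mono resolvent_mono_AE ae) auto
      then have "liminf (\<lambda>n. ennreal (real n) * R (real n + 1) (indicator U) x) \<le> liminf (\<lambda>n. w n x)"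
        by (intro Liminf_mono always_eventually allI)
      ultimately show ?thesis by (meson order_trans)
    qed
  qed measurable
qed

text \<open>By the equation that characterizes \<open>G (\<beta> + 1) f\<close>, the function v
  minimizes \<open>Q 1 v + \<beta> * L2_sq m (\<lambda>x. v x - f x)\<close> over the domain. The
  bound is the comparison with u.\<close>

lemma resolvent_approximation:
  assumes f: "f \<in> L2_functions m" "\<And>x. 0 \<le> f x" and \<beta>: "0 < \<beta>" and u: "u \<in> D"
  defines "v \<equiv> \<lambda>x. \<beta> * G (\<beta> + 1) f x"
  shows "L2_sq m (\<lambda>x. v x - f x) \<le> L2_sq m (\<lambda>x. u x - f x) + Q 1 u / \<beta>"
proof -
  have GD: "G (\<beta> + 1) f \<in> D" using f \<beta> by (intro G_domain) auto
  then have vD: "v \<in> D" unfolding v_def by (rule domain_scale)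
  define \<phi> where "\<phi> x = u x - v x" for x
  have \<phi>D: "\<phi> \<in> D" unfolding \<phi>_def by (intro domain_diff u vD)
  have vL: "(\<lambda>x. v x - f x) \<in> L2_functions m" by (intro L2_diff D_L2 vD f)
  have "B 1 v \<phi> = \<beta> * B 1 (G (\<beta> + 1) f) \<phi>" unfolding v_def by (rule B_scale_left[OF GD \<phi>D])
  also have "\<dots> = \<beta> * L2_inner m f \<phi> - \<beta> * L2_inner m v \<phi>"
    unfolding v_def L2_inner_scale_left B_1_G[OF \<beta> f \<phi>D] by (simp add: algebra_simps)
  also have "\<dots> = - \<beta> * L2_inner m (\<lambda>x. v x - f x) \<phi>"
    by (simp add: L2_inner_diff_left D_L2 vD \<phi>D f algebra_simps)
  finally have Bv: "B 1 v \<phi> = - \<beta> * L2_inner m (\<lambda>x. v x - f x) \<phi>" .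
  have "Q 1 u = Q 1 v + 2 * B 1 v \<phi> + Q 1 \<phi>"
    using B_quad_add[OF vD \<phi>D, of 1 1] by (simp add: \<phi>_def)
  moreover have "L2_sq m (\<lambda>x. u x - f x) =
      L2_sq m (\<lambda>x. v x - f x) + 2 * L2_inner m (\<lambda>x. v x - f x) \<phi> + L2_inner m \<phi> \<phi>"
  proof -
    have "L2_sq m (\<lambda>x. u x - f x) = L2_sq m (\<lambda>x. (v x - f x) + \<phi> x)"
      by (simp add: \<phi>_def)
    also have "\<dots> = L2_inner m (\<lambda>x. v x - f x) (\<lambda>x. (v x - f x) + \<phi> x)
        + L2_inner m \<phi> (\<lambda>x. (v x - f x) + \<phi> x)"
      by (intro L2_inner_add_left L2_add vL D_L2 \<phi>D)
    also have "\<dots> = L2_inner m (\<lambda>x. (v x - f x) + \<phi> x) (\<lambda>x. v x - f x)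
        + L2_inner m (\<lambda>x. (v x - f x) + \<phi> x) \<phi>"
      by (simp add: L2_inner_sym)
    also have "\<dots> = (L2_sq m (\<lambda>x. v x - f x) + L2_inner m \<phi> (\<lambda>x. v x - f x)) +
        (L2_inner m (\<lambda>x. v x - f x) \<phi> + L2_inner m \<phi> \<phi>)"
      using L2_inner_add_left[OF vL D_L2[OF \<phi>D] vL] L2_inner_add_left[OF vL D_L2[OF \<phi>D] D_L2[OF \<phi>D]] by argo
    finally show ?thesis by (simp add: L2_inner_sym[of m \<phi> "\<lambda>x. v x - f x"])
  qed
  moreover have "0 \<le> Q 1 v" "0 \<le> Q 1 \<phi>" "0 \<le> \<beta> * L2_inner m \<phi> \<phi>"
    using vD \<phi>D \<beta> by (auto intro: B_nonneg simp: L2_inner_nonneg)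
  ultimately have "\<beta> * L2_sq m (\<lambda>x. v x - f x) \<le>
      \<beta> * L2_sq m (\<lambda>x. u x - f x) + Q 1 u"
    unfolding Bv by (simp add: algebra_simps)
  then show ?thesis using \<beta> by (simp add: field_simps)
qed

text \<open>Let v be n times \<open>G (n + 1) f\<close>. Then \<open>B 1 v \<psi>\<close> is n times
  the inner product of f - v with \<psi>. Both f - v and e - v are nonnegative almost everywhere, so
  \<open>B 1 v\<close> is nonnegative at e - v, that is, \<open>Q 1 v \<le> B 1 v e\<close>.
  Cauchy-Schwarz bounds \<open>Q 1 v\<close> by \<open>Q 1 e\<close>, then \<open>B_small\<close>
  brings it below c, and \<open>domain_Fatou\<close> passes to f as n grows.\<close>

lemma supermedian_small_energy:
  assumes e: "e \<in> D" and c: "0 < c"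
  obtains \<epsilon> where "0 < \<epsilon>"
    "\<And>f. f \<in> borel_measurable borel \<Longrightarrow> (\<And>x. 0 \<le> f x)
        \<Longrightarrow> AE x in m. f x \<le> e x \<Longrightarrow>
      (\<And>n :: nat. 0 < n \<Longrightarrow> AE x in m. real n * G (real n + 1) f x \<le> f x) \<Longrightarrow>
      L2_sq m f \<le> \<epsilon> \<Longrightarrow> f \<in> D \<and> Q 1 f \<le> c"
proof -
  obtain \<epsilon> where \<epsilon>: "0 < \<epsilon>"
    "\<And>u. u \<in> D \<Longrightarrow> Q 1 u \<le> Q 1 e \<Longrightarrow> L2_sq m u \<le> \<epsilon>
        \<Longrightarrow> B 1 u e < c"
    using B_small[OF e c] by blast
  show thesis
  proof (rule that[OF \<epsilon>(1)])
    fix f :: "'a \<Rightarrow> real"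
    assume fm: "f \<in> borel_measurable borel" and f0: "\<And>x. 0 \<le> f x" and fe: "AE x in m. f x \<le> e x"
      and super: "\<And>n :: nat. 0 < n \<Longrightarrow> AE x in m. real n * G (real n + 1) f x \<le> f x"
      and small: "L2_sq m f \<le> \<epsilon>"
    have fL: "f \<in> L2_functions m"
    proof (rule L2_dominated[OF D_L2[OF e]])
      show "AE x in m. \<bar>f x\<bar>
          \<le> \<bar>e x\<bar>" using fe
          by eventually_elim (use f0 in \<open>simp add: order_trans[OF _ abs_ge_self]\<close>)
    qed (use fm in simp)
    show "f \<in> D \<and> Q 1 f \<le> c"
    proof (rule domain_Fatou[OF fL])
      fix \<delta> :: real assume \<delta>: "0 < \<delta>"
      obtain u where u: "u \<in> D" "L2_sq m (\<lambda>x. f x - u x) < \<delta> / 2"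
        using domain_dense[OF fL, of "\<delta> / 2"] \<delta> by auto
      obtain n :: nat where "Q 1 u / (\<delta> / 2) < real n" using reals_Archimedean2 by blast
      then have n: "Q 1 u / (\<delta> / 2) < real (Suc n)" by simp
      let ?n = "real (Suc n)"
      have n': "Q 1 u / ?n \<le> \<delta> / 2" using n \<delta> by (simp add: field_simps)
      define v where "v x = ?n * G (?n + 1) f x" for x
      have n0: "0 < ?n" by simp
      have GD: "G (?n + 1) f \<in> D" using fL f0 by (intro G_domain) auto
      then have vD: "v \<in> D" unfolding v_def by (rule domain_scale)
      have vf: "AE x in m. v x \<le> f x" using super[of "Suc n"] unfolding v_def by simp
      have v0: "0 \<le> v x" for x unfolding v_def by (simp add: G_nonneg)
      have "L2_sq m (\<lambda>x. v x - f x) \<le> L2_sq m (\<lambda>x. u x - f x) + Q 1 u / ?n"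
        unfolding v_def by (rule resolvent_approximation[OF fL f0 n0 u(1)])
      also have "L2_sq m (\<lambda>x. u x - f x) = L2_sq m (\<lambda>x. f x - u x)"
        unfolding L2_inner_def by (intro Bochner_Integration.integral_cong) (auto simp: algebra_simps)
      finally have close: "L2_sq m (\<lambda>x. v x - f x) \<le> \<delta>" using u(2) n' by linarith
      have Bv: "B 1 v \<phi> = ?n * L2_inner m (\<lambda>x. f x - v x) \<phi>" if "\<phi> \<in> D" for \<phi>
      proof -
        have "B 1 v \<phi> = ?n * B 1 (G (?n + 1) f) \<phi>" unfolding v_def by (rule B_scale_left[OF GD that])
        also have "\<dots> = ?n * (L2_inner m f \<phi> - L2_inner m v \<phi>)"
          unfolding v_def L2_inner_scale_left using B_1_G[OF n0 fL f0 that] by simp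
        finally show ?thesis by (simp add: L2_inner_diff_left D_L2 vD fL that)
      qed
      have "0 \<le> B 1 v (\<lambda>x. e x - v x)"
      proof -
        have "AE x in m. 0 \<le> (f x - v x) * (e x - v x)"
          using vf fe by eventually_elim auto
        then have "0 \<le> L2_inner m (\<lambda>x. f x - v x) (\<lambda>x. e x - v x)"
          unfolding L2_inner_def by (rule integral_nonneg_AE)
        then show ?thesis using n0 by (simp add: Bv domain_diff e vD del: of_nat_Suc)
      qed
      then have le: "Q 1 v \<le> B 1 v e" by (simp add: B_diff_right e vD)
      also have "B 1 v e \<le> sqrt (Q 1 v) * sqrt (Q 1 e)"
        using B_Cauchy_Schwarz[OF vD e, of 1] by simp
      finally have sq: "Q 1 v \<le> sqrt (Q 1 v) * sqrt (Q 1 e)" .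
      have "Q 1 v \<le> Q 1 e"
      proof (cases "Q 1 v = 0")
        case False
        then have "0 < sqrt (Q 1 v)" using B_nonneg[OF vD, of 1] by simp
        moreover have "sqrt (Q 1 v) * sqrt (Q 1 v) \<le> sqrt (Q 1 v) * sqrt (Q 1 e)"
          using sq B_nonneg[OF vD, of 1] by (simp only: real_sqrt_mult_self abs_of_nonneg)
        ultimately show ?thesis by (simp only: mult_le_cancel_left_pos real_sqrt_le_iff)
      qed (use B_nonneg[OF e, of 1] in simp)
      moreover have "L2_sq m v \<le> \<epsilon>"
      proof (rule order_trans[OF L2_inner_mono small])
        show "AE x in m. \<bar>v x\<bar> \<le> \<bar>f x\<bar>" using vf by eventually_elim (use v0 f0 in auto)
      qed (use D_L2 vD fL in auto)
      ultimately have "B 1 v e < c" by (intro \<epsilon>(2) vD)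
      then show "\<exists>u\<in>D. Q 1 u \<le> c \<and> L2_sq m (\<lambda>x. u x - f x) \<le> \<delta>"
        using vD le close by (intro bexI[of _ v]) auto
    qed
  qed
qed

lemma cap1_compact_null:
  assumes K: "compact K"
    and V: "\<And>n :: nat. open (V n)" "\<And>n. K \<subseteq> V n" "\<And>n. V n \<subseteq> U"
    and U: "open U" "u \<in> D" "\<And>x. x \<in> U \<Longrightarrow> 1 \<le> u x"
    and lim: "AE x in m. (\<lambda>n. hit (V n) x) \<longlonglongrightarrow> 0"
  shows "cap1 K = 0"
proof -
  have u1: "AE x in m. x \<in> U \<longrightarrow> 1 \<le> u x" using U(3) by simp
  obtain e where e: "e \<in> D" "\<And>x. 0 \<le> e x" "\<And>x. e x
      \<le> 1" "AE x in m. x \<in> U \<longrightarrow> e x = 1"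
    "\<And>\<phi>. \<phi> \<in> D \<Longrightarrow> AE x in m. 0 \<le> \<phi> x \<Longrightarrow> 0 \<le> B 1 e \<phi>"
    by (rule equilibrium_potential[OF U(2) u1]) (rule that)
  have em [measurable]: "e \<in> borel_measurable borel" using L2_borel D_L2 e(1) by blast
  obtain w where w: "w \<in> borel_measurable borel" "\<And>x. x \<in> U \<Longrightarrow> 1 \<le> w x"
    "\<And>t x. 0 < t \<Longrightarrow> ennreal (exp (- t)) * p t w x \<le> w x" "AE x in m. w x \<le> ennreal (e x)"
  \<comment> \<open>The comparison \<open>hit_le\<close> needs a majorant that is supermedian at
    every point, whereas e is known to be so only up to null sets.\<close>
  proof (rule supermedian_version[of "\<lambda>x. ennreal (e x)" U])
    show "ennreal (e x) \<le> 1" for x using e(3)[of x] by (simp add: ennreal_le_1)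
    show "AE x in m. ennreal (real n) * R (real n + 1) (\<lambda>x. ennreal (e x)) x \<le> ennreal (e x)" if "0
        < n" for n :: nat
      using that by (intro supermedian_AE e) auto
    show "AE x in m. x \<in> U \<longrightarrow> ennreal (e x) = 1" using e(4) by eventually_elim simp
  qed (use U(1) in auto)
  define f where "f n x = enn2real (hit (V n) x)" for n x
  have f: "ennreal (f n x) = hit (V n) x" for n x
    unfolding f_def using le_less_trans[OF hit_le_1[OF V(1)] ennreal_one_less_top] by (rule ennreal_enn2real)
  have fm [measurable]: "f n \<in> borel_measurable borel" for n
    unfolding f_def[abs_def] using hit_measurable[OF V(1)] by measurable
  have f01: "0 \<le> f n x" "f n x \<le> 1" for n x
    using hit_le_1[OF V(1), of n x] unfolding f[symmetric] by (auto simp: f_def ennreal_le_1)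
  have fe: "AE x in m. f n x \<le> e x" for n
    using w(4)
  proof eventually_elim
    case (elim x)
    have "hit (V n) x \<le> w x" using V(1) w V(3)[of n] by (intro hit_le) auto
    then have "ennreal (f n x) \<le> ennreal (e x)" using elim by (simp add: f)
    then show ?case using e(2) by (simp add: ennreal_le_iff)
  qed
  have fL: "f n \<in> L2_functions m" for n
  proof (rule L2_dominated[OF D_L2[OF e(1)]])
    show "AE x in m. \<bar>f n x\<bar>
        \<le> \<bar>e x\<bar>" using fe[of n]
        by eventually_elim (use f01 in \<open>simp add: order_trans[OF _ abs_ge_self]\<close>)
  qed simp
  have super: "AE x in m. real k * G (real k + 1) (f n) x \<le> f n x" if k: "0 < k" for k n :: nat
  proof (rule AE_I2)
    fix x
    have "ennreal (real k) * R (real k + 1) (hit (V n)) x \<le> hit (V n) x"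
      using k hit_supermedian[OF V(1)] hit_measurable[OF V(1)] by (intro resolvent_le) auto
    then have "enn2real (ennreal (real k) * R (real k + 1) (hit (V n)) x) \<le> f n x"
      unfolding f_def using hit_le_1[OF V(1), of n x]
      by (intro enn2real_mono) (auto simp: less_top[symmetric] top_unique)
    then show "real k * G (real k + 1) (f n) x \<le> f n x"
      by (simp add: G_def f enn2real_mult)
  qed
  have L2: "(\<lambda>n. L2_sq m (f n)) \<longlonglongrightarrow> 0"
  proof -
    have "(\<lambda>n. \<integral>x. f n x * f n x \<partial>m) \<longlonglongrightarrow> (\<integral>x. 0 \<partial>m)"
    proof (rule integral_dominated_convergence[where w = "\<lambda>x. e x * e x"])
      show "integrable m (\<lambda>x. e x * e x)" using D_L2[OF e(1)] by (rule L2_mult_integrable) (rule D_L2[OF e(1)])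
      show "AE x in m. (\<lambda>n. f n x * f n x) \<longlonglongrightarrow> 0"
        using lim
      proof eventually_elim
        case (elim x)
        then have "(\<lambda>n. ennreal (f n x)) \<longlonglongrightarrow> ennreal 0" by (simp add: f)
        then have "(\<lambda>n. f n x) \<longlonglongrightarrow> 0" using f01 by (subst (asm) tendsto_ennreal_iff) auto
        from tendsto_mult[OF this this] show ?case by simp
      qed
      show "AE x in m. norm (f n x * f n x) \<le> e x * e x" for n
        using fe[of n] by eventually_elim (use f01 e(2) in \<open>auto intro!: mult_mono\<close>)
    qed measurable
    then show ?thesis by (simp add: L2_inner_def)
  qed
  have "cap1 K \<le> ennreal c" if c: "0 < c" for c
  proof -
    obtain \<epsilon> where \<epsilon>: "0 < \<epsilon>" and small:
      "\<And>f. f \<in> borel_measurable borel \<Longrightarrow> (\<And>x. 0 \<le> f x)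
          \<Longrightarrow> AE x in m. f x \<le> e x \<Longrightarrow>
        (\<And>n :: nat. 0 < n \<Longrightarrow> AE x in m. real n * G (real n + 1) f x \<le> f x) \<Longrightarrow>
        L2_sq m f \<le> \<epsilon> \<Longrightarrow> f \<in> D \<and> Q 1 f \<le> c"
      by (rule supermedian_small_energy[OF e(1) c]) blast
    have "\<forall>\<^sub>F n in sequentially. L2_sq m (f n) < \<epsilon>" using L2 \<epsilon> by (rule order_tendstoD(2))
    then obtain n where "L2_sq m (f n) \<le> \<epsilon>" by (auto simp: eventually_sequentially intro: less_imp_le)
    then have fD: "f n \<in> D \<and> Q 1 (f n) \<le> c"
      by (intro small fm f01 fe super)
    have "f n x = 1" if "x \<in> V n" for x using hit_eq_1[OF V(1) that] by (simp add: f_def)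
    then have "f n \<in> admissible K"
      unfolding admissible_def using fD f01 V(1)[of n] V(2)[of n] by (auto intro!: exI[of _ "V n"])
    then have "cap1 K \<le> ennreal (Q 1 (f n))" by (rule cap1_le)
    also have "\<dots> \<le> ennreal c" using fD by (simp add: ennreal_leI)
    finally show ?thesis .
  qed
  then have le: "cap1 K \<le> ennreal c" if "0 < c" for c using that .
  show ?thesis
  proof (rule ccontr)
    assume "cap1 K \<noteq> 0"
    then have "0 < cap1 K" by (simp add: zero_less_iff_neq_zero)
    then obtain c where c: "0 < c" "c < cap1 K" using dense by blast
    then have "c < \<top>" using top_greatest by (metis order.strict_trans2)
    then have "c = ennreal (enn2real c)" "0 < enn2real c"
      using c(1) by (simp_all add: enn2real_positive_iff)
    then show False using le[of "enn2real c"] c(2) by simp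
  qed
qed

end

section \<open>Potentials of measures\<close>

context hunt_process
begin

lemma excessive_measurable: "excessive P X \<alpha> f \<Longrightarrow> f \<in> borel_measurable borel"
  by (simp add: excessive_def)

lemma excessive_resolvent_le:
  assumes f: "excessive P X \<alpha> f" and "\<alpha> \<le> \<beta>" "0 < k"
  shows "ennreal k * R (k + \<beta>) f x \<le> f x"
proof (rule resolvent_le[OF excessive_measurable[OF f] \<open>0 < k\<close>])
  fix t :: real assume t: "0 < t"
  have "ennreal (exp (- \<beta> * t)) * p t f x \<le> ennreal (exp (- \<alpha> * t)) * p t f x"
    using assms(2) t by (intro mult_right_mono ennreal_leI) auto
  also have "\<dots> \<le> f x" using f t by (auto simp: excessive_def)
  finally show "ennreal (exp (- \<beta> * t)) * p t f x \<le> f x" .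
qed

text \<open>The order may be raised from \<alpha> to \<beta> because the extra factor
  \<open>exp (- (\<beta> - \<alpha>) * t)\<close> tends to 1. This lets kernels of different orders
  be smoothed by one and the same resolvent.\<close>

lemma excessive_le_liminf:
  assumes f: "excessive P X \<alpha> f" and "\<alpha> \<le> \<beta>"
  shows "f x \<le> liminf (\<lambda>n. ennreal (real n) * R (real n + \<beta>) f x)"
proof (rule le_liminf_resolvent[OF excessive_measurable[OF f]])
  have "((\<lambda>t. ennreal (exp (- (\<beta> - \<alpha>) * t)) * (ennreal (exp
      (- \<alpha> * t)) * p t f x)) \<longlongrightarrow> ennreal (exp (- (\<beta> - \<alpha>) * 0)) * f x) (at_right 0)"
    using f by (intro tendsto_mult_ennreal tendsto_ennrealI tendsto_intros) (auto simp: excessive_def)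
  moreover have "ennreal (exp (- (\<beta> - \<alpha>) * t)) * (ennreal (exp (- \<alpha> * t)) * p t f x)
      = ennreal (exp (- \<beta> * t)) * p t f x" for t
  proof -
    have "exp (- (\<beta> - \<alpha>) * t) * exp (- \<alpha> * t) = exp (- \<beta> * t)"
      unfolding exp_add[symmetric] by (simp add: algebra_simps)
    then show ?thesis by (simp add: mult.assoc[symmetric] ennreal_mult[symmetric])
  qed
  ultimately show "((\<lambda>t. ennreal (exp (- \<beta> * t)) * p t f x) \<longlongrightarrow> f x) (at_right 0)" by simp
qed

text \<open>The form is linked to the resolvents of positive order; the order 0 is reached from
  there by monotone convergence.\<close>

lemma resolvent_0_SUP:
  assumes h [measurable]: "h \<in> borel_measurable borel"
  shows "R 0 h x = (SUP n. R (1 / Suc n) h x)"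
proof -
  have sup1: "(SUP n. ennreal (exp (- (1 / Suc n) * t))) = 1" if "0 \<le> t" for t
  proof (rule LIMSEQ_unique[OF LIMSEQ_SUP])
    show "incseq (\<lambda>n. ennreal (exp (- (1 / Suc n) * t)))"
      using that by (auto simp: incseq_def intro!: ennreal_leI divide_left_mono)
    have "(\<lambda>n. exp (- (1 / Suc n) * t)) \<longlonglongrightarrow> 1" by real_asymp
    then show "(\<lambda>n. ennreal (exp (- (1 / Suc n) * t))) \<longlonglongrightarrow> 1"
      using tendsto_ennrealI by fastforce
  qed
  have "R 0 h x = (\<integral>\<^sup>+t. (SUP n. indicator {0..} t * (ennreal (exp (-
      (1 / Suc n) * t)) * p t h x)) \<partial>lborel)"
    unfolding resolvent_eq[OF h]
  proof (intro nn_integral_cong)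
    fix t :: real
    show "indicator {0..} t * (ennreal (exp (- 0 * t)) * p t h x) =
        (SUP n. indicator {0..} t * (ennreal (exp (- (1 / Suc n) * t)) * p t h x))"
      using sup1[of t] by (cases "0 \<le> t") (simp_all add: SUP_mult_right_ennreal[symmetric])
  qed
  also have "\<dots> = (SUP n. R (1 / Suc n) h x)"
    unfolding resolvent_eq[OF h]
    by (intro nn_integral_monotone_convergence_SUP)
      (auto simp: incseq_def le_fun_def indicator_def intro!: mult_right_mono ennreal_leI divide_left_mono)
  finally show ?thesis .
qed

end

section \<open>Mixtures of excessive functions, convolution of kernels, approximation of
  potentials\<close>

context potential_setting
begin

lemma resolvent_mixture:
  assumes N: "sigma_finite_measure N" "sets N = sets borel"
    and g: "(\<lambda>(z, y). g z y) \<in> borel_measurable (borel \<Otimes>\<^sub>M borel)" and \<alpha>: "0 \<le> \<alpha>"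
  shows "R \<alpha> (\<lambda>y. \<integral>\<^sup>+z. g z y \<partial>N) x
      = (\<integral>\<^sup>+z. R \<alpha> (g z) x \<partial>N)"
    and "(\<lambda>z. R \<alpha> (g z) x) \<in> borel_measurable N"
    and "(\<lambda>y. \<integral>\<^sup>+z. g z y \<partial>N) \<in> borel_measurable borel"
proof -
  interpret N: sigma_finite_measure N by fact
  interpret pair_sigma_finite N m ..
  note [measurable_cong] = N(2)
  have [measurable]: "(\<lambda>z. g (fst z) (snd z)) \<in> borel_measurable (borel \<Otimes>\<^sub>M borel)"
    using g by (simp add: split_def)
  have [measurable]: "(\<lambda>z. g (snd z) (fst z)) \<in> borel_measurable (borel \<Otimes>\<^sub>M borel)"
    using measurable_compose[OF measurable_pair_swap' g] by (simp add: split_def)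
  have gz [measurable]: "g z \<in> borel_measurable borel" for z
    using measurable_compose[OF _ g, of "\<lambda>y. (z, y)" borel] by simp
  have gy [measurable]: "(\<lambda>z. g z y) \<in> borel_measurable borel" for y
    using measurable_compose[OF _ g, of "\<lambda>z. (z, y)" borel] by simp
  note [measurable] = kernel_measurable1[OF \<alpha>]
  show m1: "(\<lambda>y. \<integral>\<^sup>+z. g z y \<partial>N) \<in> borel_measurable borel" by measurable
  have eq: "R \<alpha> (g z) x = (\<integral>\<^sup>+y. g z y * r \<alpha> x y \<partial>m)" for z
    by (rule resolvent_eq_kernel[OF \<alpha> gz])
  show "(\<lambda>z. R \<alpha> (g z) x) \<in> borel_measurable N" unfolding eq by measurable
  have "R \<alpha> (\<lambda>y. \<integral>\<^sup>+z. g z y \<partial>N) x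
      = (\<integral>\<^sup>+y. \<integral>\<^sup>+z. g z y * r \<alpha> x y \<partial>N \<partial>m)"
    unfolding resolvent_eq_kernel[OF \<alpha> m1] by (simp add: nn_integral_multc)
  also have "\<dots> = (\<integral>\<^sup>+z. \<integral>\<^sup>+y. g z y * r \<alpha> x y \<partial>m \<partial>N)"
    by (rule Fubini') measurable
  finally show "R \<alpha> (\<lambda>y. \<integral>\<^sup>+z. g z y \<partial>N) x
      = (\<integral>\<^sup>+z. R \<alpha> (g z) x \<partial>N)" unfolding eq .
qed

text \<open>Fatou's lemma, in place of a proof that a mixture of excessive functions is excessive.
  Together with \<open>mixture_resolvent_le\<close> it transfers to mixtures the two inequalities
  that are used of excessivity.\<close>

lemma mixture_le_liminf:
  assumes N: "sigma_finite_measure N" "sets N = sets borel"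
    and g: "(\<lambda>(z, y). g z y) \<in> borel_measurable (borel \<Otimes>\<^sub>M borel)" and \<alpha>: "0 \<le> \<alpha>"
    and le: "\<And>z. g z x \<le> liminf (\<lambda>n. ennreal (real n) * R (real n + \<alpha>) (g z) x)"
  shows "(\<integral>\<^sup>+z. g z x \<partial>N)
      \<le> liminf (\<lambda>n. ennreal (real n) * R (real n
      + \<alpha>) (\<lambda>y. \<integral>\<^sup>+z. g z y \<partial>N) x)"
proof -
  have n\<alpha>: "0 \<le> real n + \<alpha>" for n using \<alpha> by simp
  note meas [measurable] = resolvent_mixture(2)[OF N g n\<alpha>]
  have "(\<integral>\<^sup>+z. g z x \<partial>N)
      \<le> (\<integral>\<^sup>+z. liminf (\<lambda>n. ennreal (real n) * R (real n + \<alpha>) (g z) x) \<partial>N)"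
    by (intro nn_integral_mono le)
  also have "\<dots> \<le> liminf (\<lambda>n. \<integral>\<^sup>+z. ennreal (real n) * R (real n
      + \<alpha>) (g z) x \<partial>N)"
    by (rule nn_integral_liminf) measurable
  also have "\<dots> = liminf (\<lambda>n. ennreal (real n) * R (real n
      + \<alpha>) (\<lambda>y. \<integral>\<^sup>+z. g z y \<partial>N) x)"
    by (simp add: nn_integral_cmult resolvent_mixture(1)[OF N g n\<alpha>])
  finally show ?thesis .
qed

lemma mixture_resolvent_le:
  assumes N: "sigma_finite_measure N" "sets N = sets borel"
    and g: "(\<lambda>(z, y). g z y) \<in> borel_measurable (borel \<Otimes>\<^sub>M borel)" and \<alpha>: "0 \<le> \<alpha>"
    and le: "\<And>z. ennreal c * R \<alpha> (g z) x \<le> g z x"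
  shows "ennreal c * R \<alpha> (\<lambda>y. \<integral>\<^sup>+z. g z y \<partial>N) x
      \<le> (\<integral>\<^sup>+z. g z x \<partial>N)"
  unfolding resolvent_mixture(1)[OF N g \<alpha>]
  by (subst nn_integral_cmult[symmetric, OF resolvent_mixture(2)[OF N g \<alpha>]]) (intro nn_integral_mono le)

lemma kernel_weighted_measurable:
  assumes "0 \<le> \<alpha>" "c \<in> borel_measurable borel"
  shows "(\<lambda>(z, y). r \<alpha> z y * c z) \<in> borel_measurable (borel \<Otimes>\<^sub>M borel)"
proof -
  have [measurable]: "(\<lambda>z. r \<alpha> (fst z) (snd z)) \<in> borel_measurable (borel \<Otimes>\<^sub>M borel)"
    using kernel_measurable[OF assms(1)] by (simp add: split_def)
  note [measurable] = assms(2)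
  show ?thesis unfolding split_def by measurable
qed

text \<open>
  Both sides are weighted means of excessive functions of \<open>y\<close> and have the same resolvents, because
  \<open>R\<^sub>\<alpha>\<close> and \<open>R\<^sub>\<beta>\<close> commute.
\<close>

lemma kernel_convolution_le:
  assumes ab: "0 \<le> \<alpha>" "0 \<le> \<beta>"
  shows "R \<alpha> (\<lambda>z. r \<beta> z y) x \<le> R \<beta> (\<lambda>z. r \<alpha> z y) x"
proof -
  define \<gamma> where "\<gamma> = max \<alpha> \<beta>"
  have \<gamma>: "\<alpha> \<le> \<gamma>" "\<beta> \<le> \<gamma>" "0 \<le> \<gamma>" using ab by (auto simp: \<gamma>_def)
  define f where "f \<alpha> \<beta> y
      = (\<integral>\<^sup>+z. r \<beta> z y * r \<alpha> x z \<partial>m)" for \<alpha> \<beta> y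
  have s: "sigma_finite_measure m" by unfold_locales
  have meas: "(\<lambda>(z, y). r \<beta> z y * r \<alpha> x z)
      \<in> borel_measurable (borel \<Otimes>\<^sub>M borel)" if "0 \<le> \<alpha>" "0 \<le> \<beta>" for \<alpha> \<beta>
    by (rule kernel_weighted_measurable[OF that(2) kernel_measurable1[OF that(1)]])
  have R_f: "R \<alpha> (\<lambda>z. r \<beta> z y) x = f \<alpha> \<beta> y" if "0 \<le> \<alpha>" "0
      \<le> \<beta>" for \<alpha> \<beta> y
  proof -
    have "(\<lambda>z. r \<beta> z y) = r \<beta> y" using kernel_sym[OF that(2)] by auto
    then have "(\<lambda>z. r \<beta> z y) \<in> borel_measurable borel" using kernel_measurable1[OF that(2)] by simp
    then show ?thesis unfolding f_def by (rule resolvent_eq_kernel[OF that(1)])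
  qed
  have weight: "R \<delta> (\<lambda>y. r \<beta> z y * c) y = c * R \<delta> (r \<beta> z) y" if "0
      \<le> \<beta>" for \<beta> z c \<delta> y
    using resolvent_cmult[OF kernel_measurable1[OF that], where c = c] by (simp add: mult.commute)
  \<comment> \<open>Symmetry of the kernels moves the smoothing in y into the innermost kernel. The
    smoothed functions become iterated resolvents of \<open>r \<delta> y\<close>, to which
    \<open>resolvent_commute\<close> applies.\<close>
  have R_R_f: "R \<delta> (f \<alpha> \<beta>) y = R \<alpha> (R \<beta> (r \<delta> y)) x" if "0
      \<le> \<alpha>" "0 \<le> \<beta>" "0 \<le> \<delta>" for \<alpha> \<beta> \<delta> y
  proof -
    have "R \<delta> (f \<alpha> \<beta>) y
        = (\<integral>\<^sup>+z. r \<alpha> x z * R \<delta> (r \<beta> z) y \<partial>m)"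
      unfolding f_def using resolvent_mixture(1)[OF s sets_m meas[OF that(1,2)] that(3)] by (simp add: weight that)
    also have "\<dots> = (\<integral>\<^sup>+z. R \<beta> (r \<delta> y) z * r \<alpha> x z \<partial>m)"
    proof (intro nn_integral_cong)
      fix z
      have "R \<delta> (r \<beta> z) y = R \<beta> (r \<delta> y) z"
        unfolding resolvent_eq_kernel[OF that(3) kernel_measurable1[OF that(2)]]
          resolvent_eq_kernel[OF that(2) kernel_measurable1[OF that(3)]]
        by (simp add: mult.commute)
      then show "r \<alpha> x z * R \<delta> (r \<beta> z) y
          = R \<beta> (r \<delta> y) z * r \<alpha> x z" by (simp add: mult.commute)
    qed
    also have "\<dots> = R \<alpha> (R \<beta> (r \<delta> y)) x"
      by (rule resolvent_eq_kernel[symmetric])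
          (use that in \<open>auto intro: resolvent_measurable kernel_measurable1\<close>)
    finally show ?thesis .
  qed
  have "R \<alpha> (\<lambda>z. r \<beta> z y) x = (\<integral>\<^sup>+z. r \<beta> z y * r \<alpha> x z \<partial>m)"
    by (simp add: R_f ab f_def)
  also have "\<dots> \<le> liminf (\<lambda>n. ennreal (real n) * R (real n
      + \<gamma>) (\<lambda>y. \<integral>\<^sup>+z. r \<beta> z y * r \<alpha> x z \<partial>m) y)"
  proof (rule mixture_le_liminf[OF s sets_m meas[OF ab] \<gamma>(3)])
    fix z
    have "r \<alpha> x z * r \<beta> z y
        \<le> r \<alpha> x z * liminf (\<lambda>n. ennreal (real n) * R (real n + \<gamma>) (r \<beta> z) y)"
      by (intro mult_left_mono excessive_le_liminf[OF kernel_excessive[OF ab(2)] \<gamma>(2)]) simp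
    also have "\<dots> \<le> liminf (\<lambda>n. r \<alpha> x z * (ennreal (real n) * R (real n
        + \<gamma>) (r \<beta> z) y))"
      by (rule mult_liminf_le)
    finally show "r \<beta> z y * r \<alpha> x z
        \<le> liminf (\<lambda>n. ennreal (real n) * R (real n + \<gamma>) (\<lambda>y. r \<beta> z y * r \<alpha> x z) y)"
      unfolding weight[OF ab(2)] by (simp only: mult_ac)
  qed
  also have "\<dots> = liminf (\<lambda>n. ennreal (real n) * R (real n
      + \<gamma>) (\<lambda>y. \<integral>\<^sup>+z. r \<alpha> z y * r \<beta> x z \<partial>m) y)"
  proof -
    have "R (real n + \<gamma>) (f \<alpha> \<beta>) y = R (real n + \<gamma>) (f \<beta> \<alpha>) y" for n
      using R_R_f[of \<alpha> \<beta> "real n + \<gamma>" y] R_R_f[of \<beta> \<alpha> "real n + \<gamma>" y] ab \<gamma>(3)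
        resolvent_commute[OF kernel_measurable1, of "real n + \<gamma>" \<alpha> \<beta> y x] by simp
    then show ?thesis unfolding f_def by simp
  qed
  also have "\<dots> \<le> liminf (\<lambda>n :: nat. \<integral>\<^sup>+z. r \<alpha> z y * r \<beta> x z \<partial>m)"
  proof (intro Liminf_mono eventually_mono[OF eventually_gt_at_top[of 0]])
    fix n :: nat assume n: "0 < n"
    show "ennreal (real n) * R (real n
        + \<gamma>) (\<lambda>y. \<integral>\<^sup>+z. r \<alpha> z y * r \<beta> x z \<partial>m) y
        \<le> (\<integral>\<^sup>+z. r \<alpha> z y * r \<beta> x z \<partial>m)"
    proof (rule mixture_resolvent_le[OF s sets_m meas[OF ab(2,1)]])
      show "0 \<le> real n + \<gamma>" using \<gamma>(3) by simp
      fix z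
      have "r \<beta> x z * (ennreal (real n) * R (real n + \<gamma>) (r \<alpha> z) y) \<le> r \<beta> x z * r \<alpha> z y"
        using n by (intro mult_left_mono excessive_resolvent_le[OF kernel_excessive[OF ab(1)] \<gamma>(1)]) auto
      then show "ennreal (real n) * R (real n + \<gamma>) (\<lambda>y. r \<alpha> z y * r \<beta> x z) y
          \<le> r \<alpha> z y * r \<beta> x z"
        unfolding weight[OF ab(1)] by (simp only: mult_ac)
    qed
  qed
  also have "\<dots> = f \<beta> \<alpha> y" by (simp add: Liminf_const f_def)
  also have "\<dots> = R \<beta> (\<lambda>z. r \<alpha> z y) x" by (simp add: R_f ab)
  finally show ?thesis .
qed

lemma kernel_convolution:
  "0 \<le> \<alpha> \<Longrightarrow> 0 \<le> \<beta>
      \<Longrightarrow> R \<alpha> (\<lambda>z. r \<beta> z y) x = R \<beta> (\<lambda>z. r \<alpha> z y) x"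
  by (intro antisym kernel_convolution_le)

text \<open>\<open>h n\<close> is n times the potential of order n of \<nu>, and
  \<open>kernel_convolution\<close> turns \<open>R 0 (h n)\<close> into \<open>n * R n u\<close>,
  where u is the potential of order 0. The customary density \<open>n * (u - n * R n u)\<close>
  would involve differences of possibly infinite values.\<close>

lemma potential_approximation:
  assumes \<nu>: "sigma_finite_measure \<nu>" "sets \<nu> = sets borel"
  obtains h :: "nat \<Rightarrow> 'a \<Rightarrow> ennreal" where "\<And>n. h n \<in> borel_measurable borel"
    "\<And>n x. R 0 (h n) x \<le> potential r \<nu> x"
    "\<And>x. potential r \<nu> x \<le> liminf (\<lambda>n. R 0 (h n) x)"
proof -
  have u: "potential r \<nu> = (\<lambda>x. \<integral>\<^sup>+y. r 0 y x \<partial>\<nu>)"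
    using kernel_sym[of 0] by (simp add: potential_def fun_eq_iff)
  have meas: "(\<lambda>(z, y). r \<alpha> z y) \<in> borel_measurable (borel \<Otimes>\<^sub>M borel)" if "0
      \<le> \<alpha>" for \<alpha>
    by (rule kernel_measurable[OF that])
  define h where "h n x = ennreal (real n) * (\<integral>\<^sup>+y. r (real n) y x \<partial>\<nu>)" for n x
  have m: "(\<lambda>x. \<integral>\<^sup>+y. r (real n) y x \<partial>\<nu>) \<in> borel_measurable borel" for n
    by (rule resolvent_mixture(3)[OF \<nu> meas, of _ 0]) auto
  have R_h: "R 0 (h n) x = ennreal (real n) * R (real n) (potential r \<nu>) x" for n x
  proof -
    have "R 0 (h n) x = ennreal (real n) * R 0 (\<lambda>x. \<integral>\<^sup>+y. r (real n) y x \<partial>\<nu>) x"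
      unfolding h_def by (rule resolvent_cmult[OF m])
    also have "R 0 (\<lambda>x. \<integral>\<^sup>+y. r (real n) y x \<partial>\<nu>) x
        = (\<integral>\<^sup>+y. R 0 (r (real n) y) x \<partial>\<nu>)"
      by (rule resolvent_mixture(1)[OF \<nu> meas]) auto
    also have "\<dots> = (\<integral>\<^sup>+y. R (real n) (r 0 y) x \<partial>\<nu>)"
    proof (intro nn_integral_cong)
      fix y
      have "(\<lambda>z. r (real n) z y) = r (real n) y" "(\<lambda>z. r 0 z y) = r 0 y"
        using kernel_sym[of "real n" _ y] kernel_sym[of 0 _ y] by auto
      then show "R 0 (r (real n) y) x = R (real n) (r 0 y) x"
        using kernel_convolution[of 0 "real n" y x] by simp
    qed
    also have "\<dots> = R (real n) (potential r \<nu>) x"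
      unfolding u by (rule resolvent_mixture(1)[OF \<nu> meas, symmetric]) auto
    finally show ?thesis .
  qed
  show thesis
  proof (rule that[of h])
    show "h n \<in> borel_measurable borel" for n
      using m unfolding h_def[abs_def] by measurable
    show "R 0 (h n) x \<le> potential r \<nu> x" for n x
    proof (cases "n = 0")
      case False
      then have "ennreal (real n) * R (real n) (r 0 z) x \<le> r 0 z x" for z
        using excessive_resolvent_le[OF kernel_excessive[of 0 z], of 0 "real n" x] by simp
      then show ?thesis
        unfolding R_h unfolding u by (intro mixture_resolvent_le[OF \<nu> meas]) auto
    qed (simp add: R_h)
    show "potential r \<nu> x \<le> liminf (\<lambda>n. R 0 (h n) x)" for x
      using mixture_le_liminf[OF \<nu> meas, of 0 0 x] excessive_le_liminf[OF kernel_excessive[of 0], of 0]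
      unfolding R_h unfolding u by simp
  qed
qed

section \<open>Potentials of finite measures are finite almost everywhere\<close>

text \<open>Let v be \<open>G \<alpha> f\<close> and \<phi> its excess over k. The excess vanishes
  where f is positive, so \<open>B \<alpha> v \<phi> = 0\<close>, while
  \<open>B_truncate_diff_nonneg\<close> gives a nonnegative value of \<open>B \<alpha>\<close> at
  the truncation of v and \<phi>. Hence \<open>Q \<alpha> \<phi> \<le> 0\<close> and, as \<alpha> is
  positive, \<phi> vanishes almost everywhere.\<close>

lemma maximum_principle:
  assumes f: "f \<in> L2_functions m" "\<And>x. 0 \<le> f x" and \<alpha>: "0 < \<alpha>" and k: "0 < k"
    and le: "AE x in m. 0 < f x \<longrightarrow> R \<alpha> (\<lambda>y. ennreal (f y)) x \<le> ennreal k"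
  shows "R \<alpha> (\<lambda>y. ennreal (f y)) x \<le> ennreal k"
proof -
  let ?f = "\<lambda>y. ennreal (f y)"
  have fm [measurable]: "?f \<in> borel_measurable borel" using L2_borel[OF f(1)] by simp
  define v where "v = G \<alpha> f"
  have v: "v \<in> D" "\<And>x. 0 \<le> v x" unfolding v_def by (auto intro: G_domain[OF \<alpha> f] G_nonneg)
  have vR: "AE x in m. ennreal (v x) = R \<alpha> ?f x" unfolding v_def by (rule ennreal_G[OF \<alpha> f])
  let ?w = "\<lambda>x. min (v x) k" and ?\<phi> = "\<lambda>x. v x - min (v x) k"
  have "?w = (\<lambda>x. min (max (v x) 0) k)" using v(2) by (simp add: max_absorb1)
  then have w: "?w \<in> D" using domain_truncate_at(1)[OF v(1) k] by simp
  have \<phi>: "?\<phi> \<in> D" by (intro domain_diff v w)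
  have "B \<alpha> v ?\<phi> = L2_inner m f ?\<phi>" unfolding v_def by (rule B_G[OF \<alpha> f]) (use \<phi> v_def in simp)
  also have "\<dots> = 0"
  proof -
    have "AE x in m. f x * ?\<phi> x = 0"
      using vR le
    proof eventually_elim
      case (elim x)
      show ?case
      proof (cases "0 < f x")
        case True
        then have "v x \<le> k" using elim k by (simp add: ennreal_le_iff flip: elim(1))
        then show ?thesis by simp
      qed (use f(2)[of x] in simp)
    qed
    then show ?thesis unfolding L2_inner_def by (rule integral_eq_zero_AE)
  qed
  finally have "B \<alpha> v ?\<phi> = 0" .
  moreover have "Q \<alpha> ?\<phi>
      = B \<alpha> v ?\<phi> - B \<alpha> ?w ?\<phi>" by (rule B_diff_left[OF v(1) w \<phi>])
  moreover have "0 \<le> B \<alpha> ?w ?\<phi>" by (rule B_truncate_diff_nonneg[OF v k]) (use \<alpha> in simp)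
  ultimately have "Q \<alpha> ?\<phi> \<le> 0" by simp
  then have "\<alpha> * L2_inner m ?\<phi> ?\<phi> \<le> 0"
    using form_nonneg[OF \<phi>] by (simp add: form_shift_def)
  then have "L2_inner m ?\<phi> ?\<phi> = 0" using \<alpha> L2_inner_nonneg[of m ?\<phi>] by (simp add: mult_le_0_iff)
  then have "AE x in m. ?\<phi> x * ?\<phi> x = 0"
    unfolding L2_inner_def using L2_mult_integrable[OF D_L2[OF \<phi>] D_L2[OF \<phi>]]
    by (subst (asm) integral_nonneg_eq_0_iff_AE) auto
  with vR have Rk: "AE x in m. R \<alpha> ?f x \<le> ennreal k"
  proof eventually_elim
    case (elim x)
    then have "v x \<le> k" by simp
    then show ?case using elim(1) by (metis ennreal_leI)
  qed
  \<comment> \<open>The bound has to be carried from almost every point to every point, because it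
    will be integrated against a measure that may charge m-null sets. Smoothing by resolvents of
    order \<open>n + \<alpha>\<close> achieves this.\<close>
  have s: "sigma_finite_measure m" by unfold_locales
  have Rf: "R \<alpha> ?f = (\<lambda>y. \<integral>\<^sup>+z. r \<alpha> z y * ?f z \<partial>m)"
  proof
    fix y show "R \<alpha> ?f y = (\<integral>\<^sup>+z. r \<alpha> z y * ?f z \<partial>m)"
      using resolvent_eq_kernel[OF less_imp_le[OF \<alpha>] fm, of y] kernel_sym[OF less_imp_le[OF \<alpha>], of y]
      by (simp add: mult.commute)
  qed
  have "R \<alpha> ?f x \<le> liminf (\<lambda>n. ennreal (real n) * R (real n + \<alpha>) (R \<alpha> ?f) x)"
    unfolding Rf
  proof (rule mixture_le_liminf[OF s sets_m kernel_weighted_measurable[OF _ fm]])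
    fix z
    have "?f z * r \<alpha> z x \<le> ?f z * liminf (\<lambda>n. ennreal (real n) * R (real n + \<alpha>) (r \<alpha> z) x)"
      using \<alpha> by (intro mult_left_mono excessive_le_liminf[OF kernel_excessive]) auto
    also have "\<dots> \<le> liminf (\<lambda>n. ?f z * (ennreal (real n) * R (real n + \<alpha>) (r \<alpha> z) x))"
      by (rule mult_liminf_le)
    finally show "r \<alpha> z x * ?f z
        \<le> liminf (\<lambda>n. ennreal (real n) * R (real n + \<alpha>) (\<lambda>y. r \<alpha> z y * ?f z) x)"
      using resolvent_cmult[OF kernel_measurable1[OF less_imp_le[OF \<alpha>]], where c = "?f z"]
      by (simp add: mult.commute mult.left_commute)
  qed (use \<alpha> in auto)
  also have "\<dots> \<le> liminf (\<lambda>n :: nat. ennreal k)"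
  proof (intro Liminf_mono always_eventually allI)
    fix n :: nat
    have "ennreal (real n) * R (real n + \<alpha>) (R \<alpha> ?f) x
        \<le> ennreal (real n + \<alpha>) * R (real n + \<alpha>) (\<lambda>_. ennreal k * 1) x"
      using \<alpha> Rk by (intro mult_mono resolvent_mono_AE ennreal_leI) auto
    also have "\<dots> = ennreal k * (ennreal (real n + \<alpha>) * R (real n + \<alpha>) (\<lambda>_. 1) x)"
      by (subst resolvent_cmult) (simp_all add: mult.left_commute)
    also have "\<dots> \<le> ennreal k * 1"
      using \<alpha> by (intro mult_left_mono resolvent_1_le) auto
    finally show "ennreal (real n) * R (real n + \<alpha>) (R \<alpha> ?f) x \<le> ennreal k" by simp
  qed
  finally show ?thesis by (simp add: Liminf_const)
qed

text \<open>For u = \<open>G \<alpha> g\<close> the number s = \<open>Q \<alpha> u\<close> is the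
  integral of the product of g and u. Transience bounds it by the square root of
  \<open>\<E> u u\<close>, hence by that of s, so s is at most 1 whatever the positive \<alpha>.
  Letting \<alpha> tend to 0 makes \<open>R 0 g\<close> integrable against g dm.\<close>

lemma transient_reference_function:
  obtains g where "g \<in> L2_functions m" "\<And>x. 0 < g x" "AE x in m. R 0 (\<lambda>y. ennreal (g y)) x < \<infinity>"
proof -
  obtain g0 where g0 [measurable]: "g0 \<in> borel_measurable m" and g0': "\<And>x. 0 < g0 x"
    "\<And>u. u \<in> D \<Longrightarrow> (\<integral>\<^sup>+x. ennreal (\<bar>u x\<bar> * g0 x) \<partial>m)
        \<le> ennreal (sqrt (\<E> u u))"
    using transient unfolding transient_form_def by blast
  obtain b :: "'a \<Rightarrow> real"
      where b [measurable]: "b \<in> borel_measurable m" and b': "\<And>x. 0 < b x" "\<And>x. b x \<le> 1" "integrable m b"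
    using m.obtain_positive_integrable_function by blast
  \<comment> \<open>The minimum with an integrable function bounded by 1 puts the reference function
    into L2 and keeps the bound from transience.\<close>
  define g where "g x = min (g0 x) (b x)" for x
  have gm [measurable]: "g \<in> borel_measurable m" unfolding g_def[abs_def] by measurable
  have g: "0 < g x" "g x \<le> g0 x" "g x \<le> b x" for x using g0'(1) b'(1) by (auto simp: g_def)
  have gL: "g \<in> L2_functions m"
  proof (rule L2_functionsI[OF gm])
    have "(g x)\<^sup>2 \<le> b x" for x
    proof -
      have "g x * g x \<le> b x * 1" using g[of x] b'(2)[of x] by (intro mult_mono) (auto intro: order_trans less_imp_le)
      then show ?thesis by (simp add: power2_eq_square)
    qed
    then show "integrable m (\<lambda>x. (g x)\<^sup>2)"
      using b'(1) by (intro Bochner_Integration.integrable_bound[OF b'(3)]) (auto simp: less_imp_le)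
  qed
  let ?g = "\<lambda>y. ennreal (g y)"
  have gb [measurable]: "?g \<in> borel_measurable borel" using L2_borel[OF gL] by simp
  have bound: "(\<integral>\<^sup>+x. ?g x * R \<alpha> ?g x \<partial>m) \<le> 1" if \<alpha>: "0 < \<alpha>" for \<alpha>
  proof -
    have g_nonneg: "0 \<le> g x" for x using g(1)[of x] by simp
    let ?u = "G \<alpha> g"
    have uD: "?u \<in> D" by (rule G_domain[OF \<alpha> gL g_nonneg])
    define s where "s = Q \<alpha> ?u"
    have s0: "0 \<le> s" unfolding s_def using B_nonneg[OF uD] \<alpha> by simp
    have int: "(\<integral>\<^sup>+x. ?g x * R \<alpha> ?g x \<partial>m)
        = (\<integral>\<^sup>+x. ennreal (g x * ?u x) \<partial>m)"
    proof (rule nn_integral_cong_AE)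
      show "AE x in m. ?g x * R \<alpha> ?g x = ennreal (g x * ?u x)"
        using ennreal_G[OF \<alpha> gL g_nonneg] by eventually_elim (simp add: ennreal_mult g_nonneg G_nonneg)
    qed
    also have "\<dots> = ennreal s"
    proof -
      have "s = L2_inner m g ?u" unfolding s_def by (rule B_G[OF \<alpha> gL g_nonneg uD])
      then show ?thesis
        unfolding L2_inner_def using L2_mult_integrable[OF gL D_L2[OF uD]]
        by (simp add: nn_integral_eq_integral g_nonneg G_nonneg)
    qed
    finally have eq: "(\<integral>\<^sup>+x. ?g x * R \<alpha> ?g x \<partial>m) = ennreal s" .
    have "ennreal s = (\<integral>\<^sup>+x. ennreal (g x * ?u x) \<partial>m)"
      using eq int by simp
    also have "\<dots> \<le> (\<integral>\<^sup>+x. ennreal (\<bar>?u x\<bar> * g0 x) \<partial>m)"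
      using g by (intro nn_integral_mono ennreal_leI) (auto simp: G_nonneg mult.commute[of _ "g0 _"] intro!: mult_right_mono)
    also have "\<dots> \<le> ennreal (sqrt (\<E> ?u ?u))" by (rule g0'(2)[OF uD])
    also have "\<dots> \<le> ennreal (sqrt s)"
      unfolding s_def using form_le_B[OF uD] \<alpha> by (intro ennreal_leI real_sqrt_le_mono) auto
    finally have "s \<le> sqrt s" using s0 by (simp add: ennreal_le_iff)
    then have "s\<^sup>2 \<le> s" using s0 by (metis power_mono real_sqrt_pow2)
    then have "s \<le> 1" using s0 by (cases "s = 0") (auto simp: power2_eq_square mult_le_cancel_left)
    then show ?thesis unfolding eq by (simp add: ennreal_le_1)
  qed
  have "(\<integral>\<^sup>+x. ?g x * R 0 ?g x \<partial>m)
      = (\<integral>\<^sup>+x. (SUP n. ?g x * R (1 / Suc n) ?g x) \<partial>m)"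
    by (simp add: resolvent_0_SUP SUP_mult_left_ennreal)
  also have "\<dots> = (SUP n. \<integral>\<^sup>+x. ?g x * R (1 / Suc n) ?g x \<partial>m)"
  proof (rule nn_integral_monotone_convergence_SUP)
    show "incseq (\<lambda>n x. ?g x * R (1 / Suc n) ?g x)"
      by (auto simp: incseq_def le_fun_def intro!: mult_left_mono resolvent_exp_antimono divide_left_mono)
  qed measurable
  also have "\<dots> \<le> 1" by (intro SUP_least bound) simp
  finally have "(\<integral>\<^sup>+x. ?g x * R 0 ?g x \<partial>m)
      < \<infinity>" using ennreal_one_less_top by (simp add: le_less_trans)
  then have "AE x in m. ?g x * R 0 ?g x \<noteq> \<infinity>"
    by (intro nn_integral_PInf_AE) (auto intro: measurable_cong_sets[THEN equalityD1, THEN subsetD])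
  then have "AE x in m. R 0 ?g x < \<infinity>"
  proof eventually_elim
    case (elim x)
    then show ?case using g(1)[of x] by (auto simp: ennreal_mult_eq_top_iff less_top)
  qed
  with gL g(1) show thesis by (rule that)
qed

lemma potential_measurable:
  assumes "sigma_finite_measure \<nu>" "sets \<nu> = sets borel"
  shows "potential r \<nu> \<in> borel_measurable borel"
proof -
  have "(\<lambda>(z, y). r 0 z y) \<in> borel_measurable (borel \<Otimes>\<^sub>M borel)" by (rule kernel_measurable) simp
  from resolvent_mixture(3)[OF assms this, of 0] show ?thesis
    using kernel_sym[of 0] by (simp add: potential_def[abs_def])
qed

text \<open>Integrating the potential of \<nu> against f dm is integrating \<open>R 0 f\<close>
  against \<nu>, which is finite once \<open>R 0 f\<close> is bounded. Cutting g to a level set of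
  \<open>R 0 g\<close> gives such an f: the maximum principle carries the bound from the set where f
  is positive to the whole space.\<close>

lemma potential_finite_AE:
  assumes \<nu>: "finite_measure \<nu>" "sets \<nu> = sets borel"
  shows "AE x in m. potential r \<nu> x < \<infinity>"
proof -
  interpret \<nu>: finite_measure \<nu> by fact
  have s\<nu>: "sigma_finite_measure \<nu>" by unfold_locales
  interpret pair_sigma_finite \<nu> m ..
  note [measurable_cong] = \<nu>(2)
  note [measurable] = potential_measurable[OF s\<nu> \<nu>(2)]
  obtain g where g: "g \<in> L2_functions m" "\<And>x. 0 < g x" "AE x in m. R 0 (\<lambda>y. ennreal (g y)) x < \<infinity>"
    by (rule transient_reference_function) (rule that)
  let ?g = "\<lambda>y. ennreal (g y)"
  have gb [measurable]: "g \<in> borel_measurable borel" by (rule L2_borel[OF g(1)])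
  \<comment> \<open>\<open>Suc k\<close> because the maximum principle asks for a positive
    bound.\<close>
  define A where "A k = {x. R 0 ?g x \<le> ennreal (real (Suc k))}" for k
  have Am [measurable]: "A k \<in> sets borel" for k unfolding A_def by measurable
  have fin: "AE x in m. x \<in> A k \<longrightarrow> potential r \<nu> x < \<infinity>" for k
  proof -
    define f where "f x = indicator (A k) x * g x" for x
    have f0: "0 \<le> f x" for x using g(2)[of x] by (simp add: f_def indicator_def)
    have fm [measurable]: "f \<in> borel_measurable borel" unfolding f_def[abs_def] by measurable
    have fL: "f \<in> L2_functions m"
      by (rule L2_dominated[OF g(1)]) (auto simp: f_def indicator_def)
    have bound: "R 0 (\<lambda>y. ennreal (f y)) x \<le> ennreal (real (Suc k))" for x
    proof -
      have "R (1 / Suc n) (\<lambda>y. ennreal (f y)) x \<le> ennreal (real (Suc k))" for n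
      proof (rule maximum_principle[OF fL f0])
        show "AE x in m. 0 < f x \<longrightarrow> R (1 / Suc n) (\<lambda>y. ennreal (f y)) x \<le> ennreal (real (Suc k))"
        proof (intro AE_I2 impI)
          fix x assume "0 < f x"
          then have "x \<in> A k" by (cases "x \<in> A k") (auto simp: f_def)
          have "R (1 / Suc n) (\<lambda>y. ennreal (f y)) x \<le> R 0 (\<lambda>y. ennreal (f y)) x"
            by (rule resolvent_exp_antimono) simp
          also have "\<dots> \<le> R 0 ?g x"
            using g(2) by (intro resolvent_mono ennreal_leI) (auto simp: f_def indicator_def less_imp_le)
          also have "\<dots> \<le> ennreal (real (Suc k))" using \<open>x \<in> A k\<close> by (simp add: A_def)
          finally show "R (1 / Suc n) (\<lambda>y. ennreal (f y)) x \<le> ennreal (real (Suc k))" .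
        qed
      qed auto
      then show ?thesis by (subst resolvent_0_SUP) (auto intro: SUP_least)
    qed
    have km [measurable]: "(\<lambda>z. r 0 (snd z) (fst z)) \<in> borel_measurable (borel \<Otimes>\<^sub>M borel)"
      using kernel_measurable[of 0] kernel_sym[of 0] by (simp add: split_def)
    have [measurable]: "(\<lambda>y. r 0 x y) \<in> borel_measurable borel" for x
      by (rule kernel_measurable1) simp
    have "(\<integral>\<^sup>+x. potential r \<nu> x * ennreal (f x) \<partial>m)
        = (\<integral>\<^sup>+x. \<integral>\<^sup>+y. r 0 x y * ennreal (f x) \<partial>\<nu> \<partial>m)"
      unfolding potential_def by (intro nn_integral_cong nn_integral_multc[symmetric]) measurable
    also have "\<dots> = (\<integral>\<^sup>+y. \<integral>\<^sup>+x. r 0 x y * ennreal (f x) \<partial>m \<partial>\<nu>)"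
      by (rule Fubini') measurable
    also have "\<dots> = (\<integral>\<^sup>+y. R 0 (\<lambda>x. ennreal (f x)) y \<partial>\<nu>)"
    proof (intro nn_integral_cong)
      fix y
      show "(\<integral>\<^sup>+x. r 0 x y * ennreal (f x) \<partial>m) = R 0 (\<lambda>x. ennreal (f x)) y"
        using resolvent_eq_kernel[of 0 "\<lambda>x. ennreal (f x)" y] kernel_sym[of 0 y] by (simp add: mult.commute)
    qed
    also have "\<dots> \<le> (\<integral>\<^sup>+y. ennreal (real (Suc k)) \<partial>\<nu>)"
        by (intro nn_integral_mono bound)
    also have "\<dots> < \<infinity>"
      using \<nu>.emeasure_finite[of "space \<nu>"]
      by (simp add: ennreal_mult_eq_top_iff less_top[symmetric] del: of_nat_Suc)
    finally have "AE x in m. potential r \<nu> x * ennreal (f x) \<noteq> \<infinity>"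
      by (intro nn_integral_PInf_AE) auto
    then show ?thesis
    proof eventually_elim
      case (elim x)
      then show ?case using g(2)[of x] by (auto simp: f_def ennreal_mult_eq_top_iff less_top)
    qed
  qed
  have "AE x in m. \<forall>k. x \<in> A k \<longrightarrow> potential r \<nu> x < \<infinity>"
    unfolding AE_all_countable using fin by blast
  with g(3) show ?thesis
  proof eventually_elim
    case (elim x)
    then obtain n :: nat where "R 0 ?g x < of_nat n" using ennreal_Ex_less_of_nat by auto
    also have "\<dots> \<le> ennreal (real (Suc n))" by (simp add: ennreal_of_nat_eq_real_of_nat)
    finally show ?case using elim(2) by (auto simp: A_def dest: less_imp_le)
  qed
qed

end

section \<open>Hitting times\<close>

context hunt_process
begin

text \<open>Time 0 counts as a visit, and the infimum of the empty set is \<infinity>.\<close>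

definition hitting_time :: "'a set \<Rightarrow> 'w \<Rightarrow> ennreal" where
  "hitting_time U \<omega> = Inf {t. X t \<omega> \<in> Some ` U}"

lemma hitting_time_le: "X t \<omega> \<in> Some ` U \<Longrightarrow> hitting_time U \<omega> \<le> t"
  unfolding hitting_time_def by (rule Inf_lower) simp

lemma hitting_time_antimono: "U \<subseteq> V \<Longrightarrow> hitting_time V \<omega> \<le> hitting_time U \<omega>"
  unfolding hitting_time_def by (rule Inf_superset_mono) auto

text \<open>By right continuity a visit to the open set U lasts through some rational time, and
  keeping the rationals below s makes the right side an event of \<open>F s\<close>.\<close>

lemma hitting_time_le_iff:
  assumes \<omega>: "\<omega> \<in> space M" and U: "open U" and s: "t < s"
  shows "hitting_time U \<omega> \<le> t \<longleftrightarrow>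
    (\<forall>n :: nat. \<exists>q :: rat. ennreal (real_of_rat q)
        < t + ennreal (1 / real (Suc n)) \<and> ennreal (real_of_rat q) < s \<and>
      X (ennreal (real_of_rat q)) \<omega> \<in> Some ` U)"
proof
  assume le: "hitting_time U \<omega> \<le> t"
  show "\<forall>n :: nat. \<exists>q :: rat. ennreal (real_of_rat q)
      < t + ennreal (1 / real (Suc n)) \<and> ennreal (real_of_rat q) < s \<and>
      X (ennreal (real_of_rat q)) \<omega> \<in> Some ` U"
  proof
    fix n :: nat
    let ?b = "min (t + ennreal (1 / real (Suc n))) s"
    have "t < \<infinity>" using s top_greatest by (metis infinity_ennreal_def order.strict_trans2)
    then obtain a where a: "t = ennreal a" "0 \<le> a" by (cases t) auto
    have "t < t + ennreal (1 / real (Suc n))"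
      unfolding a(1) by (subst ennreal_plus[symmetric])
          (use a(2) in \<open>auto simp: ennreal_less_iff simp del: ennreal_plus\<close>)
    then have "hitting_time U \<omega> < ?b" using le s by (simp add: le_less_trans)
    then obtain u where u: "X u \<omega> \<in> Some ` U" "u < ?b"
      unfolding hitting_time_def Inf_less_iff by auto
    then obtain x where x: "X u \<omega> = Some x" "x \<in> U" by auto
    have uf: "u < \<infinity>" using u(2) top_greatest by (metis infinity_ennreal_def order.strict_trans2)
    have "\<exists>b>u. \<forall>y>u. y < b \<longrightarrow> X y \<omega> \<in> Some ` U"
      using right_cont_open[OF \<omega> uf x(1) U x(2)] unfolding eventually_at_right[OF u(2)] .
    then obtain b where b: "u < b" "\<And>y. u < y \<Longrightarrow> y < b
        \<Longrightarrow> X y \<omega> \<in> Some ` U" by blast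
    obtain q :: rat where "u < ennreal (real_of_rat q)" "ennreal (real_of_rat q) < min b ?b"
      using ennreal_rat_dense[of u "min b ?b"] b(1) u(2) by auto
    then show "\<exists>q :: rat. ennreal (real_of_rat q)
        < t + ennreal (1 / real (Suc n)) \<and> ennreal (real_of_rat q) < s \<and>
        X (ennreal (real_of_rat q)) \<omega> \<in> Some ` U"
      using b(2) by auto
  qed
next
  assume *: "\<forall>n :: nat. \<exists>q :: rat. ennreal (real_of_rat q)
      < t + ennreal (1 / real (Suc n)) \<and> ennreal (real_of_rat q) < s \<and>
      X (ennreal (real_of_rat q)) \<omega> \<in> Some ` U"
  have "hitting_time U \<omega> \<le> t + ennreal (1 / real (Suc n))" for n :: nat
    using * hitting_time_le by (meson less_imp_le order_trans)
  moreover have "(\<lambda>n. t + ennreal (1 / real (Suc n))) \<longlonglongrightarrow> t + ennreal 0"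
  proof (intro tendsto_add tendsto_const tendsto_ennrealI)
    show "(\<lambda>n. 1 / real (Suc n))
        \<longlonglongrightarrow> 0" using LIMSEQ_inverse_real_of_nat by (simp add: inverse_eq_divide)
  qed
  ultimately show "hitting_time U \<omega> \<le> t"
    by (intro LIMSEQ_le_const[where X = "\<lambda>n. t + ennreal (1 / real (Suc n))" and x = t]) auto
qed

text \<open>For finite t the event that U is hit up to time t lies in \<open>F s\<close> for every s
  > t; right continuity of the filtration brings it down to \<open>F t\<close>.\<close>

lemma hitting_time_stopping:
  assumes U: "open U"
  shows "stopping_time F (hitting_time U)"
proof
  fix t
  have "{\<omega> \<in> space M. hitting_time U \<omega> \<le> t} \<in> sets (F t)"
  proof (cases "t < \<infinity>")
    case True
    have "{\<omega> \<in> space M. hitting_time U \<omega> \<le> t} \<in> sets (F s)" if s: "t < s" for s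
    proof -
      have X_in: "{\<omega> \<in> space (F s). ennreal (real_of_rat q)
          < t + ennreal (1 / real (Suc n)) \<and> ennreal (real_of_rat q) < s \<and>
          X (ennreal (real_of_rat q)) \<omega> \<in> Some ` U} \<in> sets (F s)" for n :: nat and q :: rat
      proof (cases "ennreal (real_of_rat q) < t + ennreal (1 / real (Suc n)) \<and> ennreal (real_of_rat q) < s")
        case True
        have "X (ennreal (real_of_rat q)) -` (Some ` U) \<inter> space (F (ennreal (real_of_rat q)))
            \<in> sets (F (ennreal (real_of_rat q)))"
          using U by (intro measurable_sets[OF adapted Some_image_cemetery]) simp
        moreover have "sets (F (ennreal (real_of_rat q))) \<subseteq> sets (F s)" using True by (intro sets_F_mono) auto
        moreover have "X (ennreal (real_of_rat q)) -` (Some ` U) \<inter> space (F (ennreal (real_of_rat q))) =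
            {\<omega> \<in> space (F s). ennreal (real_of_rat q)
                < t + ennreal (1 / real (Suc n)) \<and> ennreal (real_of_rat q)
                < s \<and> X (ennreal (real_of_rat q)) \<omega> \<in> Some ` U}"
          using True by (auto simp: space_F)
        ultimately show ?thesis by (metis (no_types, lifting) subsetD)
      next
        case False
        then have "{\<omega> \<in> space (F s). ennreal (real_of_rat q)
            < t + ennreal (1 / real (Suc n)) \<and> ennreal (real_of_rat q) < s \<and>
          X (ennreal (real_of_rat q)) \<omega> \<in> Some ` U} = {}" by auto
        then show ?thesis by (simp only: sets.empty_sets)
      qed
      have "{\<omega> \<in> space M. hitting_time U \<omega> \<le> t}
          = {\<omega> \<in> space (F s). \<forall>n :: nat. \<exists>q :: rat.
          ennreal (real_of_rat q) < t + ennreal (1 / real (Suc n)) \<and> ennreal (real_of_rat q)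
              < s \<and> X (ennreal (real_of_rat q)) \<omega> \<in> Some ` U}"
        using hitting_time_le_iff[OF _ U s] by (auto simp: space_F)
      also have "\<dots> \<in> sets (F s)"
        by (intro sets.sets_Collect_countable_All sets.sets_Collect_countable_Ex X_in)
      finally show ?thesis .
    qed
    then show ?thesis unfolding filtration_right_cont[OF True] by blast
  next
    case False
    then have "t = \<infinity>" by (simp add: less_top[symmetric])
    then have "{\<omega> \<in> space M. hitting_time U \<omega> \<le> t} = space (F t)" by (auto simp: space_F)
    then show ?thesis by (simp only: sets.top)
  qed
  then show "Measurable.pred (F t) (\<lambda>\<omega>. hitting_time U \<omega> \<le> t)" by (simp add: pred_def space_F)
qed

text \<open>If the position at the hitting time were outside the closure, right continuity would
  keep the path away from U a little longer, against the choice of the infimum. The cemetery is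
  excluded because a visit happens at this time or later.\<close>

lemma X_hitting_time:
  assumes \<omega>: "\<omega> \<in> space M" and fin: "hitting_time U \<omega> < \<infinity>"
  shows "X (hitting_time U \<omega>) \<omega> \<in> Some ` closure U"
proof -
  let ?T = "hitting_time U \<omega>"
  obtain t where t: "X t \<omega> \<in> Some ` U"
    using fin unfolding hitting_time_def Inf_less_iff by auto
  have "X ?T \<omega> \<noteq> None"
  proof
    assume "X ?T \<omega> = None"
    then have "X t \<omega> = None" using hitting_time_le[OF t] by (rule stays_dead[OF \<omega>])
    then show False using t by auto
  qed
  then obtain x where x: "X ?T \<omega> = Some x" by (cases "X ?T \<omega>") auto
  have "x \<in> closure U"
  proof (rule ccontr)
    assume nx: "x \<notin> closure U"
    have "\<exists>b>?T. \<forall>y>?T. y < b \<longrightarrow> X y \<omega> \<in> Some ` (- closure U)"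
      using right_cont_open[OF \<omega> fin x, of "- closure U"] nx unfolding eventually_at_right[OF fin] by auto
    then obtain b where b: "?T < b" "\<And>y. ?T < y \<Longrightarrow> y < b
        \<Longrightarrow> X y \<omega> \<in> Some ` (- closure U)" by blast
    have "b \<le> ?T"
      unfolding hitting_time_def
    proof (rule Inf_greatest)
      fix s assume "s \<in> {t. X t \<omega> \<in> Some ` U}"
      then have s: "X s \<omega> \<in> Some ` U" by simp
      have "s \<noteq> ?T" using s x nx closure_subset[of U] by auto
      then have "?T < s" using hitting_time_le[OF s] by simp
      then show "b \<le> s" using b(2)[of s] s closure_subset[of U] by (cases "s < b") auto
    qed
    then show False using b(1) by simp
  qed
  then show ?thesis using x by simp
qed

lemma discount_le:
  assumes "ennreal a < hitting_time U \<omega>"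
  shows "discount U \<omega> \<le> ennreal (exp (- a))"
  unfolding discount_def
proof (rule SUP_least)
  fix t :: real assume t: "t \<in> {0..}"
  show "ennreal (exp (- t)) * visits U t \<omega> \<le> ennreal (exp (- a))"
  proof (cases "X (ennreal t) \<omega> \<in> Some ` U")
    case True
    then have "ennreal a < ennreal t" using hitting_time_le[OF True] assms by simp
    then have "a < t" by (metis ennreal_leI not_less)
    then show ?thesis by (auto simp: visits_01 intro!: ennreal_leI)
  qed (simp add: visits_01)
qed

lemma discount_le_1: "discount U \<omega> \<le> 1"
  unfolding discount_def by (intro SUP_least) (auto simp: visits_01 ennreal_le_1)

lemma discount_measurable:
  assumes "open U"
  shows "discount U \<in> borel_measurable M"
proof -
  have [measurable]: "U \<in> sets borel" using assms by simp
  have "(\<lambda>\<omega>. SUP k. grid_discount (1 / 2 ^ k) U \<omega>) \<in> borel_measurable M" by measurable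
  then show ?thesis
    by (subst measurable_cong[OF discount_eq_SUP_grid[OF _ assms zero_less_one]]) auto
qed

text \<open>
  If a process started at \<open>x\<close> came arbitrarily close to \<open>K\<close> before a finite time,
      quasi-left-continuity
  would let it reach \<open>K\<close>, and then \<open>E\<^sub>x u(X\<^sub>T) = \<infinity>\<close>.
\<close>

lemma hit_tendsto_0:
  assumes V: "\<And>n :: nat. open (V n)" "decseq V" "compact (closure (V 0))" "(\<Inter>n. closure (V n)) \<subseteq> K"
    and h: "\<And>n :: nat. h n \<in> borel_measurable borel" "\<And>n x. R 0 (h n) x \<le> u x" "\<And>x. u x
        \<le> liminf (\<lambda>n. R 0 (h n) x)"
    and u: "u \<in> borel_measurable borel" "\<And>y. y \<in> K \<Longrightarrow> u y = \<infinity>" "u x < \<infinity>"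
  shows "(\<lambda>n. hit (V n) x) \<longlonglongrightarrow> 0"
proof -
  define \<tau> where "\<tau> n = hitting_time (V n)" for n
  define T where "T \<omega> = (SUP n. \<tau> n \<omega>)" for \<omega>
  have \<tau>: "stopping_time F (\<tau> n)" for n unfolding \<tau>_def by (rule hitting_time_stopping[OF V(1)])
  have T: "stopping_time F T"
  proof
    fix t
    have "Measurable.pred (F t) (\<lambda>\<omega>. \<forall>n. \<tau> n \<omega> \<le> t)"
      using stopping_timeD[OF \<tau>] by (intro pred_intros_countable) auto
    then show "Measurable.pred (F t) (\<lambda>\<omega>. T \<omega> \<le> t)" by (simp add: T_def SUP_le_iff)
  qed
  have TM: "T \<in> borel_measurable M"
    by (rule measurable_stopping_time[OF T filtration_sub space_F])
  have inc: "incseq (\<lambda>n. \<tau> n \<omega>)" for \<omega>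
    unfolding incseq_def \<tau>_def using decseqD[OF V(2)] by (blast intro: hitting_time_antimono)
  have ql: "AE \<omega> in P (Some x). T \<omega>
      < \<infinity> \<longrightarrow> limitin cemetery_topology (\<lambda>n. X (\<tau> n \<omega>) \<omega>) (X
      (T \<omega>) \<omega>) sequentially"
    using \<tau> inc by (intro quasi_left_cont) (auto simp: T_def)
  have reach: "X (T \<omega>) \<omega> \<in> Some ` K" if \<omega>: "\<omega> \<in> space M" and fin: "T \<omega>
      < \<infinity>"
    and lim: "limitin cemetery_topology (\<lambda>n. X (\<tau> n \<omega>) \<omega>) (X
        (T \<omega>) \<omega>) sequentially" for \<omega>
  proof -
    have "X (T \<omega>) \<omega> \<in> Some ` closure (V n)" for n
    proof (rule ccontr)
      assume nin: "X (T \<omega>) \<omega> \<notin> Some ` closure (V n)"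
      \<comment> \<open>Compactness of the closure makes this an open set that contains the cemetery
        as well, so the limit position can be neither the cemetery nor a point outside
        \<open>closure (V n)\<close>.\<close>
      let ?O = "insert None (Some ` (UNIV - closure (V n)))"
      have "closure (V n) \<subseteq> closure (V 0)" using decseqD[OF V(2), of 0 n] by (intro closure_mono) auto
      then have "compact (closure (V n))"
        using compact_Int_closed[OF V(3) closed_closure[of "V n"]] by (metis inf.absorb_iff2)
      then have "openin cemetery_topology ?O"
        unfolding cemetery_topology_def openin_Alexandroff_compactification by (auto intro!: exI[of _ "closure (V n)"])
      moreover have "X (T \<omega>) \<omega> \<in> ?O" using nin by (cases "X (T \<omega>) \<omega>") auto
      ultimately have "\<forall>\<^sub>F k in sequentially. X (\<tau> k \<omega>) \<omega> \<in> ?O"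
        using lim unfolding limitin_def by blast
      then have "\<forall>\<^sub>F k in sequentially. X (\<tau> k \<omega>) \<omega> \<in> ?O \<and> n \<le> k"
        using eventually_ge_at_top[of n] by eventually_elim auto
      from eventually_happens'[OF sequentially_bot this]
      obtain k where k: "X (\<tau> k \<omega>) \<omega> \<in> ?O" "n \<le> k" by blast
      have "\<tau> k \<omega> \<le> T \<omega>" unfolding T_def by (rule SUP_upper) simp
      then have "\<tau> k \<omega> < \<infinity>" using fin by (rule le_less_trans)
      then have "X (\<tau> k \<omega>) \<omega> \<in> Some ` closure (V k)"
        unfolding \<tau>_def by (rule X_hitting_time[OF \<omega>])
      moreover have "closure (V k) \<subseteq> closure (V n)" using decseqD[OF V(2) k(2)] by (rule closure_mono)
      ultimately show False using k(1) by auto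
    qed
    then obtain y where y: "X (T \<omega>) \<omega>
        = Some y" "\<And>n. y \<in> closure (V n)" by (metis imageE option.inject)
    then have "y \<in> K" using V(4) by blast
    then show ?thesis using y(1) by simp
  qed
  have XT [measurable]: "(\<lambda>\<omega>. X (T \<omega>) \<omega>) \<in> P (Some x) \<rightarrow>\<^sub>M cemetery_borel"
    unfolding measurable_law by (rule X_random_time_measurable[OF TM])
  have cm: "(\<lambda>\<omega>. case_option 0 f (X (T \<omega>) \<omega>))
      \<in> borel_measurable (P (Some x))" if "f \<in> borel_measurable borel" for f :: "'a \<Rightarrow> ennreal"
    by (rule measurable_compose[OF XT case_option_measurable[OF that]])
  have "(\<integral>\<^sup>+\<omega>. case_option 0 u (X (T \<omega>) \<omega>) \<partial>P (Some x)) \<le>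
      (\<integral>\<^sup>+\<omega>. liminf (\<lambda>n. case_option 0 (R 0 (h n)) (X
          (T \<omega>) \<omega>)) \<partial>P (Some x))"
    using h(3) by (intro nn_integral_mono) (auto split: option.split)
  also have "\<dots> \<le> liminf (\<lambda>n. \<integral>\<^sup>+\<omega>. case_option 0 (R 0 (h n)) (X
      (T \<omega>) \<omega>) \<partial>P (Some x))"
    by (rule nn_integral_liminf) (intro cm resolvent_measurable h(1))
  also have "\<dots> \<le> liminf (\<lambda>n :: nat. u x)"
    by (intro Liminf_mono always_eventually allI order_trans[OF stopped_resolvent_le[OF h(1) T] h(2)])
  also have "\<dots> < \<infinity>" using u(3) by (simp add: Liminf_const)
  finally have "AE \<omega> in P (Some x). case_option 0 u (X (T \<omega>) \<omega>) \<noteq> \<infinity>"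
    using cm[OF u(1)] by (intro nn_integral_PInf_AE) auto
  with ql AE_space have T_inf: "AE \<omega> in P (Some x). T \<omega> = \<infinity>"
  proof eventually_elim
    case (elim \<omega>)
    show ?case
    proof (rule ccontr)
      assume "T \<omega> \<noteq> \<infinity>"
      then have "X (T \<omega>) \<omega> \<in> Some ` K" using elim reach[of \<omega>] by (simp add: less_top[symmetric])
      then show False using elim(3) u(2) by auto
    qed
  qed
  have "(\<lambda>n. \<integral>\<^sup>+\<omega>. discount (V n) \<omega> \<partial>P (Some x))
      \<longlonglongrightarrow> (\<integral>\<^sup>+\<omega>. 0 \<partial>P (Some x))"
  proof (rule nn_integral_dominated_convergence[where w = "\<lambda>_. 1"])
    show "AE \<omega> in P (Some x). (\<lambda>n. discount (V n) \<omega>) \<longlonglongrightarrow> 0"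
      using T_inf
    proof eventually_elim
      case (elim \<omega>)
      show ?case
      proof (rule order_tendstoI)
        fix a :: ennreal assume a: "0 < a"
        obtain q where q: "0 < ennreal (real_of_rat q)" "ennreal (real_of_rat q) < a"
          using ennreal_rat_dense[OF a] by auto
        define b where "b = real_of_rat q"
        have b: "0 < b" "ennreal b < a" using q unfolding b_def ennreal_less_zero_iff by auto
        \<comment> \<open>Hitting after time \<open>- ln b\<close> leaves a discount of at most b.
          For b > 1 the argument is negative and \<open>ennreal\<close> makes it 0, and the bound b
          holds all the same.\<close>
        have "ennreal (- ln b) < T \<omega>" using elim by simp
        then obtain n where n: "ennreal (- ln b) < \<tau> n \<omega>" unfolding T_def less_SUP_iff by auto
        have "discount (V k) \<omega> < a" if "n \<le> k" for k
        proof -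
          have "ennreal (- ln b) < \<tau> k \<omega>" using n inc[of \<omega>] that by (meson incseqD less_le_trans)
          then have "discount (V k) \<omega> \<le> ennreal (exp (- (- ln b)))" unfolding \<tau>_def by (rule discount_le)
          then show ?thesis using b by simp
        qed
        then show "\<forall>\<^sub>F n in sequentially. discount (V n) \<omega> < a" by (auto simp: eventually_sequentially)
      qed simp
    qed
  qed (auto simp: measurable_law discount_le_1 intro: discount_measurable V(1))
  then show ?thesis by (simp add: hit_def)
qed

end

context potential_setting
begin

lemma cap1_compact_infinite_potential:
  assumes \<nu>: "finite_measure \<nu>" "sets \<nu> = sets borel"
    and K: "compact K" "\<And>x. x \<in> K \<Longrightarrow> potential r \<nu> x = \<infinity>"
  shows "cap1 K = 0"
proof (cases "K = {}")
  \<comment> \<open>For empty K, \<open>infdist\<close> is 0 everywhere and the sets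
    \<open>V n\<close> of the other case would not shrink.\<close>
  case True
  have "(\<lambda>x. 0) \<in> admissible {}"
    unfolding admissible_def using domain_zero by (auto intro!: exI[of _ "{}"])
  then have "cap1 K \<le> ennreal (Q 1 (\<lambda>x. 0))" unfolding True by (rule cap1_le)
  then show ?thesis using B_scale_left[OF domain_zero domain_zero, of 1 0] by simp
next
  case False
  interpret \<nu>: finite_measure \<nu> by fact
  have s\<nu>: "sigma_finite_measure \<nu>" by unfold_locales
  obtain U u where U: "open U" "K \<subseteq> U" "compact (closure U)" "u \<in> D" "\<And>x. x \<in> U
      \<Longrightarrow> 1 \<le> u x"
    by (rule compact_neighbourhood_domain[OF K(1)]) (rule that)
  \<comment> \<open>Inside U, so that one equilibrium potential, that of U, dominates all the
    hitting functions; the closures are compact and their intersection lies in K.\<close>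
  define V where "V n = U \<inter> {x. infdist x K < 1 / Suc n}" for n
  have V_open: "open (V n)" for n
    unfolding V_def using U(1) by (intro open_Int open_Collect_less continuous_intros) auto
  have V_dec: "decseq V"
    unfolding decseq_def V_def
  proof (intro allI impI Int_mono order_refl Collect_mono)
    fix n k :: nat and x assume "n \<le> k" "infdist x K < 1 / Suc k"
    then show "infdist x K < 1 / Suc n" by (rule_tac less_le_trans) (auto intro!: divide_left_mono)
  qed
  have VK: "K \<subseteq> V n" for n using U(2) by (auto simp: V_def)
  have V_cpt: "compact (closure (V 0))"
  proof -
    have "closure (V 0) \<subseteq> closure U" by (intro closure_mono) (auto simp: V_def)
    then show ?thesis
      using compact_Int_closed[OF U(3) closed_closure[of "V 0"]] by (metis inf.absorb_iff2)
  qed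
  have V_lim: "(\<Inter>n. closure (V n)) \<subseteq> K"
  proof
    fix x assume x: "x \<in> (\<Inter>n. closure (V n))"
    have "infdist x K \<le> 1 / Suc n" for n
    proof -
      have "closure (V n) \<subseteq> {x. infdist x K \<le> 1 / Suc n}"
        by (intro closure_minimal closed_Collect_le continuous_intros) (auto simp: V_def)
      then show ?thesis using x by auto
    qed
    moreover have "(\<lambda>n. 1 / real (Suc n))
        \<longlonglongrightarrow> 0" using LIMSEQ_inverse_real_of_nat by (simp add: inverse_eq_divide)
    ultimately have "infdist x K \<le> 0" by (intro LIMSEQ_le_const[of "\<lambda>n. 1 / real (Suc n)"]) auto
    then have "infdist x K = 0" using infdist_nonneg[of x K] by simp
    then show "x \<in> K" using in_closed_iff_infdist_zero[OF compact_imp_closed[OF K(1)] False] by simp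
  qed
  obtain h :: "nat \<Rightarrow> 'a \<Rightarrow> ennreal" where h: "\<And>n. h n \<in> borel_measurable borel"
    "\<And>n x. R 0 (h n) x \<le> potential r \<nu> x" "\<And>x. potential r \<nu> x \<le> liminf (\<lambda>n. R 0 (h n) x)"
    by (rule potential_approximation[OF s\<nu> \<nu>(2)]) (rule that)
  show ?thesis
  proof (rule cap1_compact_null[OF K(1) V_open VK _ U(1,4,5)])
    show "AE x in m. (\<lambda>n. hit (V n) x) \<longlonglongrightarrow> 0"
      using potential_finite_AE[OF \<nu>]
    proof eventually_elim
      case (elim x)
      then show ?case
        by (intro hit_tendsto_0[OF V_open V_dec V_cpt V_lim h potential_measurable[OF s\<nu> \<nu>(2)] K(2)])
    qed
  qed (auto simp: V_def)
qed

end

theorem proposition3p2: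
  fixes m :: "'a :: {metric_space, second_countable_topology} measure"
    and D :: "('a \<Rightarrow> real) set"
    and \<E> :: "('a \<Rightarrow> real) \<Rightarrow> ('a \<Rightarrow> real) \<Rightarrow> real"
    and M :: "'w measure"
    and F :: "ennreal \<Rightarrow> 'w measure"
    and P :: "'a option \<Rightarrow> 'w measure"
    and X :: "ennreal \<Rightarrow> 'w \<Rightarrow> 'a option"
    and r :: "real \<Rightarrow> 'a \<Rightarrow> 'a \<Rightarrow> ennreal"
  assumes "potential_setting m D \<E> M F P X r"
  shows "bounded_measures \<subseteq> qe_finite_potential_measures m D \<E> r"
proof
  interpret potential_setting m D \<E> M F P X r by fact
  fix \<mu> :: "'a set \<Rightarrow> ereal" assume "\<mu> \<in> bounded_measures"
  then have \<mu>: "signed_borel_measure \<mu>" "emeasure (total_variation \<mu>) UNIV < \<infinity>"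
    by (auto simp: bounded_measures_def)
  have sets: "sets (total_variation \<mu>) = sets borel" by (rule sets_total_variation[OF \<mu>(1)])
  have fin: "finite_measure (total_variation \<mu>)"
    using \<mu>(2) sets_eq_imp_space_eq[OF sets] by (intro finite_measureI) auto
  then interpret \<nu>: finite_measure "total_variation \<mu>" .
  let ?u = "potential r (total_variation \<mu>)"
  have um: "?u \<in> borel_measurable borel" by (intro potential_measurable sets) unfold_locales
  have "cap1 {x. ?u x = \<infinity>} = 0"
  proof (rule cap1_Borel_null)
    show "{x. ?u x = \<infinity>} \<in> sets borel" using measurable_sets[OF um, of "{\<infinity>}"]
        by (simp add: vimage_def)
    show "cap1 K = 0" if "compact K" "K \<subseteq> {x. ?u x = \<infinity>}" for K
      using that by (intro cap1_compact_infinite_potential[OF fin sets]) auto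
  qed
  then have "capacity m D \<E> {x. ?u x = \<infinity>} = 0"
    using capacity_le_cap1[of "{x. ?u x = \<infinity>}"] by simp
  then have "quasi_everywhere m D \<E> (\<lambda>x. ?u x < \<infinity>)"
    unfolding quasi_everywhere_def by (intro exI[of _ "{x. ?u x = \<infinity>}"]) (auto simp: less_top)
  then show "\<mu> \<in> qe_finite_potential_measures m D \<E> r"
    using \<mu>(1) by (simp add: qe_finite_potential_measures_def)
qed

end
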